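(* Let $n\ge1$, $0\le r\le n$. Let $K^{(C_n)}_{(1^r)(1^{r-2j})}(t)$ and $K^{(D_n)}_{(1^r)(1^{r-2j})}(t)$, $0\le j\le\lfloor r/2\rfloor$, be the transition coefficients (Kostka polynomials) defined by $$s^{(C_n)}_{(1^r)}(x)=\sum_{j=0}^{\lfloor r/2\rfloor}K^{(C_n)}_{(1^r)(1^{r-2j})}(t)\,P^{(C_n,C_n)}_{(1^{r-2j})}(x\,|\,t;0,t),\qquad s^{(D_n)}_{(1^r)}(x)=\sum_{j=0}^{\lfloor r/2\rfloor}K^{(D_n)}_{(1^r)(1^{r-2j})}(t)\,P^{(D_n,D_n)}_{(1^{r-2j})}(x\,|\,0,t).$$ Then $K^{(C_n)}_{(1^r)(1^{r-2j})}(t)$ and $K^{(D_n)}_{(1^r)(1^{r-2j})}(t)$ are polynomials in $t$ with nonnegative integral coefficients, and $$K^{(C_n)}_{(1^r)(1^{r-2j})}(t)=t^{2j}\frac{[n-r+1]_{t^2}}{[n-r+j+1]_{t^2}}\left[{n-r+2j\atop j}\right]_{t^2}=\left[{n-r+2j\atop j}\right]_{t^2}-\left[{n-r+2j\atop j-1}\right]_{t^2},$$ $$K^{(D_n)}_{(1^r)(1^{r-2j})}(t)=t^j\frac{1+t^{n-r}}{1+t^{n-r+2j}}\left[{n-r+2j\atop j}\right]_{t^2}=t^{n-r+j}\left[{n-r+2j-1\atop j-1}\right]_{t^2}+t^j\left[{n-r+2j-1\atop j}\right]_{t^2}.$$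
   Context: $q$-notation: $[n]_q=\frac{1-q^n}{1-q}$, $\left[{m\atop j}\right]_q=\prod_{k=1}^j\frac{[m-k+1]_q}{[k]_q}$ for $j\ge0$ (equal to $1$ for $j=0$), and $\left[{m\atop -1}\right]_q=0$. Koornwinder polynomials. Let $x=(x_1,\dots,x_n)$, and let $a,b,c,d,q,t$ be generic complex parameters, $|q|<1$; put $\alpha=(abcd/q)^{1/2}$. The group $W_n=\mathbb{Z}_2^n\rtimes\mathfrak{S}_n$ acts on Laurent polynomials by permuting the variables and inverting $x_i\mapsto x_i^{-1}$. For a partition $\lambda=(\lambda_1\ge\dots\ge\lambda_n\ge0)$, $m_\lambda$ is the sum of the distinct monomials $x^\mu$, $\mu$ in the $W_n$-orbit of $\lambda$. Let $T_{q,x_i}^{\pm1}$ replace $x_i$ by $q^{\pm1}x_i$, and set $$\mathcal{D}_x=\sum_{i=1}^n\frac{(1-ax_i)(1-bx_i)(1-cx_i)(1-dx_i)}{\alpha t^{n-1}(1-x_i^2)(1-qx_i^2)}\prod_{j\ne i}\frac{(1-tx_ix_j)(1-tx_i/x_j)}{(1-x_ix_j)(1-x_i/x_j)}\big(T_{q,x_i}-1\big)$$ $$\qquad+\sum_{i=1}^n\frac{(1-a/x_i)(1-b/x_i)(1-c/x_i)(1-d/x_i)}{\alpha t^{n-1}(1-1/x_i^2)(1-q/x_i^2)}\prod_{j\ne i}\frac{(1-tx_j/x_i)(1-t/(x_ix_j))}{(1-x_j/x_i)(1-1/(x_ix_j))}\big(T_{q,x_i}^{-1}-1\big).$$ The Koornwinder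 polynomial $P_\lambda(x\,|\,a,b,c,d\,|\,q,t)$ is the unique $W_n$-invariant Laurent polynomial with $P_\lambda=m_\lambda+$ (linear combination of $m_\mu$, $\mu<\lambda$ in dominance order: $\mu_1+\dots+\mu_i\le\lambda_1+\dots+\lambda_i$ for all $i$) and $\mathcal{D}_xP_\lambda=d_\lambda P_\lambda$, where $d_\lambda=\sum_{j=1}^n\big(\alpha t^{n-j}q^{\lambda_j}+\alpha^{-1}t^{-n+j}q^{-\lambda_j}-\alpha t^{n-j}-\alpha^{-1}t^{-n+j}\big)$. $(1^r)$ is the partition with $r$ parts equal to $1$. Specializations: $P^{(C_n,C_n)}_{\lambda}(x\,|\,b;q,t)=P_\lambda(x\,|\,b^{1/2},-b^{1/2},q^{1/2}b^{1/2},-q^{1/2}b^{1/2}\,|\,q,t)$ and $P^{(D_n,D_n)}_\lambda(x\,|\,q,t)=P_\lambda(x\,|\,1,-1,q^{1/2},-q^{1/2}\,|\,q,t)$. The Schur polynomials are $s^{(C_n)}_{(1^r)}(x)=P^{(C_n,C_n)}_{(1^r)}(x\,|\,q;q,q)$ and $s^{(D_n)}_{(1^r)}(x)=P^{(D_n,D_n)}_{(1^r)}(x\,|\,q,q)$ (they do not depend on $q$). The Hall--Littlewood polynomials $P^{(C_n,C_n)}_{(1^r)}(x\,|\,t;0,t)$ and $P^{(D_n,D_n)}_{(1^r)}(x\,|\,0,t)$ are the values at $q=0$ (limits $q\to0$) of $P^{(C_n,C_n)}_{(1^r)}(x\,|\,t;q,t)$ and $P^{(D_n,D_n)}_{(1^r)}(x\,|\,q,t)$.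 *)

theory Defs
  imports Complex_Main
    "HOL-Combinatorics.Permutations"
    "HOL-Computational_Algebra.Polynomial"
begin

text \<open>The variables are \<open>x 1, \<dots>, x n\<close> for \<open>x :: nat \<Rightarrow> complex\<close>, and Laurent
  polynomials are represented by the functions they induce; only values at points with
  nonzero coordinates \<open>x 1, \<dots>, x n\<close> are meaningful.\<close>

definition qnum :: "complex \<Rightarrow> int \<Rightarrow> complex" where
  "qnum q m = (1 - q powi m) / (1 - q)"

definition qbinom :: "complex \<Rightarrow> int \<Rightarrow> int \<Rightarrow> complex" where
  "qbinom q m j = (if j < 0 then 0 else (\<Prod>k=1..j. qnum q (m - k + 1) / qnum q k))"

definition partition_of_length :: "nat \<Rightarrow> (nat \<Rightarrow> nat) \<Rightarrow> bool" where
  "partition_of_length n lam \<longleftrightarrow>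
     (\<forall>i\<in>{1..n}. \<forall>j\<in>{1..n}. i \<le> j \<longrightarrow> lam j \<le> lam i) \<and> (\<forall>i. i \<notin> {1..n} \<longrightarrow> lam i = 0)"

definition column :: "nat \<Rightarrow> nat \<Rightarrow> nat" where
  "column r = (\<lambda>i. if i \<in> {1..r} then 1 else 0)"

definition strictly_dominated :: "nat \<Rightarrow> (nat \<Rightarrow> nat) \<Rightarrow> (nat \<Rightarrow> nat) set" where
  "strictly_dominated n lam =
     {\<mu>. partition_of_length n \<mu> \<and> \<mu> \<noteq> lam \<and> (\<forall>i\<in>{1..n}. (\<Sum>k=1..i. \<mu> k) \<le> (\<Sum>k=1..i. lam k))}"

definition W_orbit :: "nat \<Rightarrow> (nat \<Rightarrow> nat) \<Rightarrow> (nat \<Rightarrow> int) set" where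
  "W_orbit n lam =
     {\<lambda>i. \<epsilon> i * int (lam (\<sigma> i)) | \<epsilon> \<sigma>. \<sigma> permutes {1..n} \<and> (\<forall>i. \<epsilon> i = 1 \<or> \<epsilon> i = -1)}"

definition msym :: "nat \<Rightarrow> (nat \<Rightarrow> nat) \<Rightarrow> (nat \<Rightarrow> complex) \<Rightarrow> complex" where
  "msym n lam x = (\<Sum>\<nu>\<in>W_orbit n lam. \<Prod>i=1..n. x i powi \<nu> i)"

text \<open>The branch of the square root is immaterial in the eigenvalue equation: both the
  operator and the eigenvalue are odd in \<open>\<alpha>\<close>.\<close>

definition koornwinder_alpha :: "complex \<Rightarrow> complex \<Rightarrow> complex \<Rightarrow> complex \<Rightarrow> complex \<Rightarrow> complex" where
  "koornwinder_alpha a b c d q = csqrt (a * b * c * d / q)"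

definition koornwinder_op ::
  "nat \<Rightarrow> complex \<Rightarrow> complex \<Rightarrow> complex \<Rightarrow> complex \<Rightarrow> complex \<Rightarrow> complex
    \<Rightarrow> ((nat \<Rightarrow> complex) \<Rightarrow> complex) \<Rightarrow> (nat \<Rightarrow> complex) \<Rightarrow> complex" where
  "koornwinder_op n a b c d q t f x =
    (\<Sum>i=1..n.
       (1 - a * x i) * (1 - b * x i) * (1 - c * x i) * (1 - d * x i)
         / (koornwinder_alpha a b c d q * t ^ (n - 1) * (1 - (x i)\<^sup>2) * (1 - q * (x i)\<^sup>2))
       * (\<Prod>j\<in>{1..n} - {i}.
            (1 - t * x i * x j) * (1 - t * x i / x j) / ((1 - x i * x j) * (1 - x i / x j)))
       * (f (x(i := q * x i)) - f x))
  + (\<Sum>i=1..n.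
       (1 - a / x i) * (1 - b / x i) * (1 - c / x i) * (1 - d / x i)
         / (koornwinder_alpha a b c d q * t ^ (n - 1) * (1 - 1 / (x i)\<^sup>2) * (1 - q / (x i)\<^sup>2))
       * (\<Prod>j\<in>{1..n} - {i}.
            (1 - t * x j / x i) * (1 - t / (x i * x j)) / ((1 - x j / x i) * (1 - 1 / (x i * x j))))
       * (f (x(i := x i / q)) - f x))"

definition koornwinder_eigenvalue ::
  "nat \<Rightarrow> complex \<Rightarrow> complex \<Rightarrow> complex \<Rightarrow> complex \<Rightarrow> complex \<Rightarrow> complex
    \<Rightarrow> (nat \<Rightarrow> nat) \<Rightarrow> complex" where
  "koornwinder_eigenvalue n a b c d q t lam =
    (let \<alpha> = koornwinder_alpha a b c d q in
     \<Sum>j=1..n. \<alpha> * t ^ (n - j) * q ^ lam j + inverse \<alpha> * inverse t ^ (n - j) * inverse q ^ lam j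
       - \<alpha> * t ^ (n - j) - inverse \<alpha> * inverse t ^ (n - j))"

text \<open>Points at which no denominator of the operator vanishes. They form a Zariski-dense
  open subset, so an identity on them is an identity of rational functions.\<close>

definition regular_point :: "nat \<Rightarrow> complex \<Rightarrow> (nat \<Rightarrow> complex) \<Rightarrow> bool" where
  "regular_point n q x \<longleftrightarrow>
     (\<forall>i\<in>{1..n}. x i \<noteq> 0 \<and> (x i)\<^sup>2 \<noteq> 1 \<and> q * (x i)\<^sup>2 \<noteq> 1 \<and> (x i)\<^sup>2 \<noteq> q) \<and>
     (\<forall>i\<in>{1..n}. \<forall>j\<in>{1..n}. i \<noteq> j \<longrightarrow> x i * x j \<noteq> 1 \<and> x i \<noteq> x j)"

text \<open>The first conjunct already makes \<open>P\<close> a \<open>W\<^sub>n\<close>-invariant Laurent polynomial, since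
  every \<open>msym n \<mu>\<close> is one.\<close>

definition is_koornwinder ::
  "nat \<Rightarrow> (nat \<Rightarrow> nat) \<Rightarrow> complex \<Rightarrow> complex \<Rightarrow> complex \<Rightarrow> complex \<Rightarrow> complex \<Rightarrow> complex
    \<Rightarrow> ((nat \<Rightarrow> complex) \<Rightarrow> complex) \<Rightarrow> bool" where
  "is_koornwinder n lam a b c d q t P \<longleftrightarrow>
     (\<exists>u. P = (\<lambda>x. msym n lam x + (\<Sum>\<mu>\<in>strictly_dominated n lam. u \<mu> * msym n \<mu> x))) \<and>
     (\<forall>x. regular_point n q x \<longrightarrow>
        koornwinder_op n a b c d q t P x = koornwinder_eigenvalue n a b c d q t lam * P x)"

definition koornwinder ::
  "nat \<Rightarrow> (nat \<Rightarrow> nat) \<Rightarrow> complex \<Rightarrow> complex \<Rightarrow> complex \<Rightarrow> complex \<Rightarrow> complex \<Rightarrow> complex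
    \<Rightarrow> (nat \<Rightarrow> complex) \<Rightarrow> complex" where
  "koornwinder n lam a b c d q t = (THE P. is_koornwinder n lam a b c d q t P)"

text \<open>Choosing other branches of the square roots below only permutes the four parameters,
  and the operator is symmetric in them.\<close>

definition macdonald_C ::
  "nat \<Rightarrow> (nat \<Rightarrow> nat) \<Rightarrow> complex \<Rightarrow> complex \<Rightarrow> complex \<Rightarrow> (nat \<Rightarrow> complex) \<Rightarrow> complex" where
  "macdonald_C n lam b q t =
     koornwinder n lam (csqrt b) (- csqrt b) (csqrt q * csqrt b) (- csqrt q * csqrt b) q t"

definition macdonald_D ::
  "nat \<Rightarrow> (nat \<Rightarrow> nat) \<Rightarrow> complex \<Rightarrow> complex \<Rightarrow> (nat \<Rightarrow> complex) \<Rightarrow> complex" where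
  "macdonald_D n lam q t = koornwinder n lam 1 (- 1) (csqrt q) (- csqrt q) q t"

text \<open>The Schur polynomials do not depend on \<open>q\<close>; the argument is kept here, and
  expansions are required for all admissible \<open>q\<close>.\<close>

definition schur_C :: "nat \<Rightarrow> nat \<Rightarrow> complex \<Rightarrow> (nat \<Rightarrow> complex) \<Rightarrow> complex" where
  "schur_C n r q = macdonald_C n (column r) q q q"

definition schur_D :: "nat \<Rightarrow> nat \<Rightarrow> complex \<Rightarrow> (nat \<Rightarrow> complex) \<Rightarrow> complex" where
  "schur_D n r q = macdonald_D n (column r) q q"

definition hall_littlewood_C :: "nat \<Rightarrow> nat \<Rightarrow> complex \<Rightarrow> (nat \<Rightarrow> complex) \<Rightarrow> complex" where
  "hall_littlewood_C n r t x = Lim (at 0) (\<lambda>q. macdonald_C n (column r) t q t x)"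

definition hall_littlewood_D :: "nat \<Rightarrow> nat \<Rightarrow> complex \<Rightarrow> (nat \<Rightarrow> complex) \<Rightarrow> complex" where
  "hall_littlewood_D n r t x = Lim (at 0) (\<lambda>q. macdonald_D n (column r) q t x)"

text \<open>\<open>K j\<close> is the coefficient of \<open>P (r - 2 * j)\<close>; the values at \<open>j > r div 2\<close> are
  normalised to zero so that \<open>K\<close> can be unique as a function.\<close>

definition transition_coeffs ::
  "nat \<Rightarrow> nat \<Rightarrow> (complex \<Rightarrow> (nat \<Rightarrow> complex) \<Rightarrow> complex)
    \<Rightarrow> (nat \<Rightarrow> (nat \<Rightarrow> complex) \<Rightarrow> complex) \<Rightarrow> (nat \<Rightarrow> complex) \<Rightarrow> bool" where
  "transition_coeffs n r s P K \<longleftrightarrow>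
     (\<forall>j. j > r div 2 \<longrightarrow> K j = 0) \<and>
     (\<forall>q x. 0 < norm q \<and> norm q < 1 \<and> (\<forall>i\<in>{1..n}. x i \<noteq> 0) \<longrightarrow>
        s q x = (\<Sum>j=0..r div 2. K j * P (r - 2 * j) x))"

definition is_kostka_C :: "nat \<Rightarrow> nat \<Rightarrow> complex \<Rightarrow> (nat \<Rightarrow> complex) \<Rightarrow> bool" where
  "is_kostka_C n r t = transition_coeffs n r (schur_C n r) (\<lambda>s. hall_littlewood_C n s t)"

definition is_kostka_D :: "nat \<Rightarrow> nat \<Rightarrow> complex \<Rightarrow> (nat \<Rightarrow> complex) \<Rightarrow> bool" where
  "is_kostka_D n r t = transition_coeffs n r (schur_D n r) (\<lambda>s. hall_littlewood_D n s t)"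

definition kostka_C :: "nat \<Rightarrow> nat \<Rightarrow> nat \<Rightarrow> complex \<Rightarrow> complex" where
  "kostka_C n r j t = (THE K. is_kostka_C n r t K) j"

definition kostka_D :: "nat \<Rightarrow> nat \<Rightarrow> nat \<Rightarrow> complex \<Rightarrow> complex" where
  "kostka_D n r j t = (THE K. is_kostka_D n r t K) j"

text \<open>Genericity of \<open>t\<close>: it keeps the eigenvalues of the polynomials indexed by columns
  distinct for all small \<open>q \<noteq> 0\<close>, and the denominators of the closed formulas nonzero.\<close>

definition generic_t :: "complex \<Rightarrow> bool" where
  "generic_t t \<longleftrightarrow> t \<noteq> 0 \<and> (\<forall>k::nat. k > 0 \<longrightarrow> t ^ k \<noteq> 1)"

definition nonneg_int_polynomial :: "(complex \<Rightarrow> complex) \<Rightarrow> bool" where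
  "nonneg_int_polynomial f \<longleftrightarrow>
     (\<exists>p :: int poly. (\<forall>i. coeff p i \<ge> 0) \<and>
        (\<forall>t. generic_t t \<longrightarrow> f t = poly (map_poly of_int p) t))"

end

theory Submission
  imports Defs "HOL-Library.FuncSet"
begin

text \<open>Put \<open>z\<^sub>i = x\<^sub>i + 1 / x\<^sub>i\<close> and \<open>\<Phi> = \<Prod>\<^sub>i (z\<^sub>i + Y)\<close> with \<open>Y = y + 1 / y\<close>. Applied to \<open>\<Phi>\<close> as a function of
  \<open>x\<close>, the Koornwinder operator acts, up to a scalar factor and an additive constant, as the
  Askey--Wilson operator with the same parameters and base \<open>t\<close> in \<open>y\<close>: both sides are polynomials in \<open>Y\<close>
  of degree less than \<open>n\<close>, and they agree at the \<open>n\<close> points \<open>Y = - z\<^sub>k\<close>. Hence the column polynomials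
  \<open>P\<^sub>r\<close> are the coefficients of \<open>\<Phi>\<close> in the basis of monic Askey--Wilson polynomials \<open>p\<^sub>m\<close>, namely
  \<open>\<Phi> = \<Sum>\<^sub>r P\<^sub>r(x) p\<^sub>n\<^sub>-\<^sub>r(Y)\<close>. For the Schur polynomials of types \<open>C\<close> and \<open>D\<close> the \<open>p\<^sub>m\<close> are Chebyshev
  polynomials of the second and first kind; for the Hall--Littlewood polynomials they are the continuous
  \<open>t\<^sup>2\<close>-Hermite polynomials and a companion family, both with explicit coefficients. The Kostka
  polynomials are the connection coefficients between these families.\<close>

text \<open>The base of the Askey-Wilson operator is \<open>t\<close> and not \<open>q\<close>
  because z_i moves by (1 - q) (1 - q x_i^2) / (q x_i) under x_i -> q x_i. This cancels the only
  denominator that contains \<open>q\<close>; what survives of \<open>q\<close> is a scalar and two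
  parameter combinations \<open>e\<close> and \<open>f\<close>. The obstacle is the limit q -> 0.
  For nonzero \<open>q\<close> the parameters of the Hall-Littlewood polynomials belong in general
  to none of the four explicit families, and the scalar diverges. Without the scalar, however, the
  operator is affine in \<open>(e, f)\<close>. It is therefore determined by three parameter points
  at which an eigenbasis is explicit, and it has a limit. Its matrix on the coefficients of \<Phi>
  is triangular, and eigenvectors of triangular matrices are rational in the entries while the
  eigenvalues stay distinct, so they converge too. Distinct eigenvalues, together with linear
  independence of the coefficients of \<Phi> on regular points, also give the existence and
  uniqueness that the definite description of the Koornwinder polynomials requires.\<close>

subsection \<open>Gaussian binomial coefficients\<close>

text \<open>\<open>gauss v a b\<close> is the Gaussian binomial coefficient of \<open>a + b\<close> over \<open>a\<close> in base \<open>v\<close>.\<close>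

fun gauss :: "'a::comm_ring_1 \<Rightarrow> nat \<Rightarrow> nat \<Rightarrow> 'a" where
  "gauss v 0 b = 1"
| "gauss v (Suc a) 0 = 1"
| "gauss v (Suc a) (Suc b) = gauss v a (Suc b) + v ^ Suc a * gauss v (Suc a) b"

lemma gauss_0_right [simp]: "gauss v a 0 = 1"
  by (cases a) auto

text \<open>The defining recursion is asymmetric in its arguments. Expanding both of its terms by
  the induction hypothesis and regrouping exchanges their roles. No division occurs, so the rule is
  available for the integer polynomials used for positivity.\<close>

lemma gauss_pascal':
  "gauss v (Suc a) (Suc b) = v ^ Suc b * gauss v a (Suc b) + gauss v (Suc a) b"
proof (induction "a + b" arbitrary: a b rule: less_induct)
  case less
  show ?case
  proof (cases a)
    case 0
    show ?thesis
    proof (cases b)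
      case 0
      with \<open>a = 0\<close> show ?thesis by simp
    next
      case (Suc b')
      have "gauss v (Suc 0) (Suc b') = v ^ Suc b' * gauss v 0 (Suc b') + gauss v (Suc 0) b'"
        using less[of 0 b'] \<open>a = 0\<close> Suc by simp
      with \<open>a = 0\<close> Suc show ?thesis by (simp add: algebra_simps)
    qed
  next
    case a: (Suc a')
    show ?thesis
    proof (cases b)
      case 0
      have "gauss v (Suc a') (Suc 0) = v ^ Suc 0 * gauss v a' (Suc 0) + gauss v (Suc a') 0"
        using less[of a' 0] a 0 by simp
      hence "gauss v (Suc (Suc a')) (Suc 0) = v * gauss v a' (Suc 0) + 1 + v ^ Suc (Suc a')"
        by (simp del: gauss.simps(3) add: gauss.simps(3)[of v "Suc a'" 0])
      also have "\<dots> = v * gauss v (Suc a') (Suc 0) + 1" by (simp add: algebra_simps)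
      finally show ?thesis using a 0 by simp
    next
      case b: (Suc b')
      have 1: "gauss v (Suc a') (Suc (Suc b')) = v ^ Suc (Suc b') * gauss v a' (Suc (Suc b')) + gauss v (Suc a') (Suc b')"
        using less[of a' "Suc b'"] a b by simp
      have 2: "gauss v (Suc (Suc a')) (Suc b') = v ^ Suc b' * gauss v (Suc a') (Suc b') + gauss v (Suc (Suc a')) b'"
        using less[of "Suc a'" b'] a b by simp
      have "gauss v (Suc a) (Suc b) = gauss v (Suc a') (Suc (Suc b')) + v ^ Suc a * gauss v (Suc (Suc a')) (Suc b')"
        unfolding a b by (rule gauss.simps)
      also have "\<dots> = v ^ Suc (Suc b') * (gauss v a' (Suc (Suc b')) + v ^ Suc a' * gauss v (Suc a') (Suc b'))
          + (gauss v (Suc a') (Suc b') + v ^ Suc (Suc a') * gauss v (Suc (Suc a')) b')"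
        unfolding 1 2 a b by (simp add: algebra_simps del: gauss.simps)
      also have "\<dots> = v ^ Suc b * gauss v a (Suc b) + gauss v (Suc a) b"
        unfolding a b by simp
      finally show ?thesis .
    qed
  qed
qed

lemma gauss_sym: "gauss v a b = gauss v b a"
proof (induction "a + b" arbitrary: a b rule: less_induct)
  case less
  show ?case
  proof (cases a; cases b)
    fix a' b' assume a: "a = Suc a'" and b: "b = Suc b'"
    have 1: "gauss v a' (Suc b') = gauss v (Suc b') a'" "gauss v (Suc a') b' = gauss v b' (Suc a')"
      using less[of a' "Suc b'"] less[of "Suc a'" b'] a b by simp_all
    have "gauss v a b = v ^ Suc b' * gauss v a' (Suc b') + gauss v (Suc a') b'"
      unfolding a b by (rule gauss_pascal')
    with 1 show ?thesis unfolding a b by simp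
  qed auto
qed

text \<open>The quotient of \<open>v\<close>-factorials, cleared of denominators so that it makes
  sense in every commutative ring.\<close>

lemma gauss_qfact:
  "gauss v a b * ((\<Prod>i=1..a. 1 - v ^ i) * (\<Prod>i=1..b. 1 - v ^ i)) = (\<Prod>i=1..a+b. 1 - v ^ i)"
proof (induction v a b rule: gauss.induct)
  case (3 v a b)
  have "gauss v (Suc a) (Suc b) * ((\<Prod>i=1..Suc a. 1 - v ^ i) * (\<Prod>i=1..Suc b. 1 - v ^ i))
    = (1 - v ^ Suc a) * (gauss v a (Suc b) * ((\<Prod>i=1..a. 1 - v ^ i) * (\<Prod>i=1..Suc b. 1 - v ^ i)))
      + v ^ Suc a * (1 - v ^ Suc b) * (gauss v (Suc a) b * ((\<Prod>i=1..Suc a. 1 - v ^ i) * (\<Prod>i=1..b. 1 - v ^ i)))"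
    by (simp add: algebra_simps)
  also have "\<dots> = (1 - v ^ (Suc a + Suc b)) * (\<Prod>i=1..Suc a + b. 1 - v ^ i)"
    unfolding 3 by (simp add: algebra_simps power_add)
  finally show ?case by (simp add: mult.commute)
qed auto

context
  fixes v :: complex
  assumes v: "\<And>k::nat. k > 0 \<Longrightarrow> v ^ k \<noteq> 1"
begin

lemma one_minus_pow_nz: "k > 0 \<Longrightarrow> 1 - v ^ k \<noteq> 0"
  using v[of k] by auto

lemma qfact_nz: "(\<Prod>i=1..a. 1 - v ^ i) \<noteq> 0"
  using one_minus_pow_nz by auto

text \<open>Multiplied by the factorials of \<open>a\<close> and \<open>b\<close>, both sides become
  the factorial of \<open>a + b + 1\<close>. This ratio of neighbours in one row is the source of
  the coefficient recurrences for the Hall-Littlewood families.\<close>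

lemma gauss_step: "gauss v a (Suc b) * (1 - v ^ Suc b) = gauss v (Suc a) b * (1 - v ^ Suc a)"
proof -
  have "gauss v a (Suc b) * (1 - v ^ Suc b) * ((\<Prod>i=1..a. 1 - v ^ i) * (\<Prod>i=1..b. 1 - v ^ i))
      = gauss v (Suc a) b * (1 - v ^ Suc a) * ((\<Prod>i=1..a. 1 - v ^ i) * (\<Prod>i=1..b. 1 - v ^ i))"
    using gauss_qfact[of v a "Suc b"] gauss_qfact[of v "Suc a" b]
    by (simp add: mult_ac del: gauss.simps)
  thus ?thesis using qfact_nz[of a] qfact_nz[of b] by auto
qed

lemma gauss_mult_top: "gauss v (Suc a) b * (1 - v ^ Suc a) = (1 - v ^ (Suc (a + b))) * gauss v a b"
proof -
  have "gauss v (Suc a) b * (1 - v ^ Suc a) * ((\<Prod>i=1..a. 1 - v ^ i) * (\<Prod>i=1..b. 1 - v ^ i))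
      = (1 - v ^ (Suc (a + b))) * gauss v a b * ((\<Prod>i=1..a. 1 - v ^ i) * (\<Prod>i=1..b. 1 - v ^ i))"
    using gauss_qfact[of v a b] gauss_qfact[of v "Suc a" b]
    by (simp add: mult_ac del: gauss.simps)
  thus ?thesis using qfact_nz[of a] qfact_nz[of b] by auto
qed

lemma v_neq_1: "v \<noteq> 1" using v[of 1] by simp

lemma qnum_nat: "qnum v (int m) = (1 - v ^ m) / (1 - v)"
  by (simp add: qnum_def)

lemma qbinom_gauss: "qbinom v (int (a + b)) (int a) = gauss v a b"
proof -
  have "qbinom v (int (a + b)) (int a) = (\<Prod>k=1..int a. qnum v (int (a + b) - k + 1) / qnum v k)"
    by (simp add: qbinom_def)
  also have "\<dots> = (\<Prod>k=1..a. (1 - v ^ (a + b + 1 - k)) / (1 - v ^ k))"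
  proof (rule prod.reindex_bij_witness[of _ int nat])
    fix k :: int assume k: "k \<in> {1..int a}"
    then obtain k' where k': "k = int k'" by (metis atLeastAtMost_iff int_nat_eq order_trans zero_le_one)
    have "int (a + b) - k + 1 = int (a + b + 1 - k')" using k k' by auto
    hence "qnum v (int (a + b) - k + 1) / qnum v k
       = ((1 - v ^ (a + b + 1 - k')) / (1 - v)) / ((1 - v ^ k') / (1 - v))"
      by (simp only: qnum_nat k')
    thus "(1 - v ^ (a + b + 1 - nat k)) / (1 - v ^ nat k) = qnum v (int (a + b) - k + 1) / qnum v k"
      using v_neq_1 k' by simp
  qed auto
  also have "\<dots> = (\<Prod>k=1..a. (1 - v ^ (a + b + 1 - k))) / (\<Prod>k=1..a. (1 - v ^ k))"
    by (simp add: prod_dividef)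
  \<comment> \<open>Reversing the order of the factors leaves the quotient of the factorials of
    \<open>a + b\<close> and \<open>b\<close>.\<close>
  also have "(\<Prod>k=1..a. (1 - v ^ (a + b + 1 - k))) = (\<Prod>k=1..a. (1 - v ^ (b + k)))"
    by (rule prod.reindex_bij_witness[of _ "\<lambda>k. a + 1 - k" "\<lambda>k. a + 1 - k"]) (auto simp: algebra_simps)
  also have "\<dots> / (\<Prod>k=1..a. (1 - v ^ k)) = gauss v a b"
  proof -
    have "(\<Prod>k=1..a. (1 - v ^ (b + k))) * (\<Prod>i=1..b. 1 - v ^ i) = (\<Prod>i=1..a+b. 1 - v ^ i)"
      by (induction a) (simp_all add: algebra_simps)
    hence "(\<Prod>k=1..a. (1 - v ^ (b + k))) * (\<Prod>i=1..b. 1 - v ^ i)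
        = gauss v a b * (\<Prod>i=1..a. 1 - v ^ i) * (\<Prod>i=1..b. 1 - v ^ i)"
      using gauss_qfact[of v a b] by (simp add: algebra_simps)
    hence "(\<Prod>k=1..a. (1 - v ^ (b + k))) = gauss v a b * (\<Prod>i=1..a. 1 - v ^ i)"
      using qfact_nz[of b] by simp
    thus ?thesis using qfact_nz[of a] by (simp add: field_simps)
  qed
  finally show ?thesis .
qed

end

section \<open>Integer polynomials with nonnegative coefficients\<close>

definition nonneg_poly :: "int poly \<Rightarrow> bool" where
  "nonneg_poly p \<longleftrightarrow> (\<forall>i. coeff p i \<ge> 0)"

lemma nonneg_poly_simps [intro]:
  "nonneg_poly 0" "nonneg_poly 1"
  "nonneg_poly p \<Longrightarrow> nonneg_poly q \<Longrightarrow> nonneg_poly (p + q)"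
  "nonneg_poly p \<Longrightarrow> nonneg_poly q \<Longrightarrow> nonneg_poly (p * q)"
  "nonneg_poly (monom 1 k)"
  by (auto simp: nonneg_poly_def coeff_mult intro!: sum_nonneg)

lemma nonneg_poly_power [intro]: "nonneg_poly p \<Longrightarrow> nonneg_poly (p ^ k)"
  by (induction k) auto

lemma nonneg_poly_gauss: "nonneg_poly v \<Longrightarrow> nonneg_poly (gauss v a b)"
  by (induction v a b rule: gauss.induct) (auto simp del: power_Suc)

text \<open>The differences \<open>gauss v (Suc a) b - v ^ c * gauss v a (Suc b)\<close> with
  \<open>c \<le> b - a\<close> form the smallest family containing those with \<open>c = 0\<close> that is closed under both
  forms of Pascal's rule.\<close>

lemma nonneg_poly_gauss_diff:
  assumes v: "nonneg_poly v"
  shows "a \<le> b \<Longrightarrow> c \<le> b - a \<Longrightarrow> nonneg_poly (gauss v (Suc a) b - v ^ c * gauss v a (Suc b))"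
proof (induction "a + b" arbitrary: a b c rule: less_induct)
  case less
  show ?case
  proof (cases "b = a")
    case True
    \<comment> \<open>Here \<open>c = 0\<close>, and the two terms agree by symmetry.\<close>
    have "gauss v (Suc a) b - v ^ c * gauss v a (Suc b) = 0"
      using True less.prems gauss_sym[of v a "Suc a"] by simp
    thus ?thesis by (simp only:) auto
  next
    case False
    then obtain b' where b: "b = Suc b'" "a \<le> b'" using less.prems by (cases b) auto
    show ?thesis
    \<comment> \<open>The dual Pascal rule keeps \<open>c\<close> on the difference at
      \<open>(a, b')\<close> and raises it by one on the difference at \<open>(a - 1, b)\<close>.
      Only \<open>c = b - a\<close> is then out of range for the first difference, and there the
      defining rule is used, which lowers \<open>c\<close> on the first and keeps it on the
      second.\<close>
    proof (cases "c \<le> b' - a")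
      case True
      have 1: "nonneg_poly (gauss v (Suc a) b' - v ^ c * gauss v a (Suc b'))"
        using less.hyps[of a b' c] True b less.prems by simp
      \<comment> \<open>For \<open>a = 0\<close> the missing entry is the Gaussian coefficient with
        lower index -1, hence the value 0.\<close>
      have 2: "nonneg_poly (gauss v a b - v ^ Suc c * (if a = 0 then 0 else gauss v (a - 1) (Suc b)))"
      proof (cases a)
        case 0 thus ?thesis by auto
      next
        case (Suc a')
        thus ?thesis using less.hyps[of a' b "Suc c"] True b less.prems by (auto simp: nonneg_poly_simps(2))
      qed
      have "gauss v (Suc a) b - v ^ c * gauss v a (Suc b) =
        (gauss v (Suc a) b' - v ^ c * gauss v a (Suc b'))
        + v ^ Suc b' * (gauss v a b - v ^ Suc c * (if a = 0 then 0 else gauss v (a - 1) (Suc b)))"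
        unfolding b using gauss_pascal'[of v a b'] 
        by (cases a) (auto simp: gauss_pascal' algebra_simps simp del: gauss.simps(3))
      thus ?thesis
        by (simp only:) (intro nonneg_poly_simps nonneg_poly_power 1 2 v)
    next
      case False
      then obtain c' where c: "c = Suc c'" "c' \<le> b' - a" using less.prems b by (cases c) auto
      have 1: "nonneg_poly (gauss v (Suc a) b' - v ^ c' * gauss v a (Suc b'))"
        using less.hyps[of a b' c'] c b less.prems by simp
      have 2: "nonneg_poly (gauss v a b - v ^ c * (if a = 0 then 0 else gauss v (a - 1) (Suc b)))"
      proof (cases a)
        case 0 thus ?thesis by auto
      next
        case (Suc a')
        thus ?thesis using less.hyps[of a' b "c"] c b less.prems by auto
      qed
      have "gauss v (Suc a) b - v ^ c * gauss v a (Suc b) =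
        v ^ Suc a * (gauss v (Suc a) b' - v ^ c' * gauss v a (Suc b'))
        + (gauss v a b - v ^ c * (if a = 0 then 0 else gauss v (a - 1) (Suc b)))"
        unfolding b c by (cases a) (auto simp: algebra_simps)
      thus ?thesis
        by (simp only:) (intro nonneg_poly_simps nonneg_poly_power 1 2 v)
    qed
  qed
qed

lemma poly_of_int_hom:
  fixes t :: complex
  shows "poly (map_poly of_int (p + q)) t = poly (map_poly of_int p) t + poly (map_poly of_int q) t"
    and "poly (map_poly of_int (p - q)) t = poly (map_poly of_int p) t - poly (map_poly of_int q) t"
    and "poly (map_poly of_int (p * q)) t = poly (map_poly of_int p) t * poly (map_poly of_int q) t"
    and "poly (map_poly of_int (p ^ k)) t = poly (map_poly of_int p) t ^ k"
    and "poly (map_poly of_int (monom 1 k)) t = t ^ k"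
    and "poly (map_poly of_int 1) t = 1"
proof -
  have mult: "map_poly of_int (p * q) = map_poly of_int p * (map_poly of_int q :: complex poly)" for p q
    by (rule poly_eqI) (simp add: coeff_map_poly coeff_mult)
  show "poly (map_poly of_int (p + q)) t = poly (map_poly of_int p) t + poly (map_poly of_int q) t"
    by (subst poly_add[symmetric], rule arg_cong[of _ _ "\<lambda>p. poly p t"], rule poly_eqI) (simp add: coeff_map_poly)
  show "poly (map_poly of_int (p - q)) t = poly (map_poly of_int p) t - poly (map_poly of_int q) t"
    by (subst poly_diff[symmetric], rule arg_cong[of _ _ "\<lambda>p. poly p t"], rule poly_eqI) (simp add: coeff_map_poly)
  show "poly (map_poly of_int (p * q)) t = poly (map_poly of_int p) t * poly (map_poly of_int q) t"
    by (simp add: mult)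
  show "poly (map_poly of_int (p ^ k)) t = poly (map_poly of_int p) t ^ k"
    by (induction k) (simp_all add: mult)
  show "poly (map_poly of_int (monom 1 k)) t = t ^ k"
    by (simp add: map_poly_monom poly_monom)
  show "poly (map_poly of_int 1) t = 1" by simp
qed

lemma poly_of_int_gauss:
  fixes t :: complex
  shows "poly (map_poly of_int (gauss v a b)) t = gauss (poly (map_poly of_int v) t) a b"
  by (induction v a b rule: gauss.induct) (simp_all add: poly_of_int_hom del: power_Suc)

subsection \<open>Monomial symmetric polynomials of columns\<close>

text \<open>With \<open>z i = x i + 1 / x i\<close> the monomial symmetric polynomial of \<open>(1\<^sup>s)\<close> is the elementary
  symmetric polynomial of degree \<open>s\<close> in \<open>z\<close>, that is, the coefficient of degree \<open>n - s\<close> of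
  \<open>linprod {1..n} z\<close>. Columns are indexed by \<open>n - s\<close> in what follows.\<close>

definition linprod :: "nat set \<Rightarrow> (nat \<Rightarrow> complex) \<Rightarrow> complex poly" where
  "linprod A z = (\<Prod>i\<in>A. [:z i, 1:])"

abbreviation joukowski :: "(nat \<Rightarrow> complex) \<Rightarrow> nat \<Rightarrow> complex" where
  "joukowski x \<equiv> \<lambda>i. x i + inverse (x i)"

lemma poly_linprod: "poly (linprod A z) Y = (\<Prod>i\<in>A. z i + Y)"
  by (simp add: linprod_def poly_prod)

lemma degree_linprod: "finite A \<Longrightarrow> degree (linprod A z) = card A"
  unfolding linprod_def by (subst degree_prod_eq_sum_degree) auto

lemma coeff_linprod_eq_0: "finite A \<Longrightarrow> card A < k \<Longrightarrow> coeff (linprod A z) k = 0"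
  by (simp add: coeff_eq_0 degree_linprod)

lemma linprod_insert: "finite A \<Longrightarrow> a \<notin> A \<Longrightarrow> linprod (insert a A) z = [:z a, 1:] * linprod A z"
  by (simp add: linprod_def)

lemma column_inj: "column r = column s \<Longrightarrow> r = s"
proof -
  have *: "{i. column r i = 1} = {1..r}" for r by (auto simp: column_def)
  assume "column r = column s"
  hence "{1..r} = {1..s}" using * by metis
  hence "card {1..r} = card {1..s}" by (simp only:)
  thus ?thesis by (simp only: card_atLeastAtMost diff_Suc_1)
qed

lemma column_partition: "r \<le> n \<Longrightarrow> partition_of_length n (column r)"
  by (auto simp: partition_of_length_def column_def)

lemma sum_column: "(\<Sum>k=1..i. column r k) = min i r"
proof -
  have "(\<Sum>k=1..i. column r k) = (\<Sum>k\<in>{1..i} \<inter> {1..r}. 1)"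
    unfolding column_def by (subst sum.inter_restrict) (auto intro!: sum.cong)
  also have "{1..i} \<inter> {1..r} = {1..min i r}" by auto
  finally show ?thesis by simp
qed

text \<open>Dominance does not fix the weight, so shorter columns of both parities occur. The first
  partial sum bounds every part by 1, which makes a dominated partition a column of some length
  \<open>m\<close>; the partial sum at \<open>m\<close> then gives \<open>m \<le> r\<close>.\<close>

lemma strictly_dominated_column:
  assumes "r \<le> n"
  shows "strictly_dominated n (column r) = column ` {..<r}"
proof (intro equalityI subsetI)
  fix \<mu> assume "\<mu> \<in> strictly_dominated n (column r)"
  hence p: "partition_of_length n \<mu>" and ne: "\<mu> \<noteq> column r"
    and le: "\<And>i. i \<in> {1..n} \<Longrightarrow> (\<Sum>k=1..i. \<mu> k) \<le> min i r"
    unfolding strictly_dominated_def mem_Collect_eq sum_column by blast+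
  have out: "\<mu> i = 0" if "i \<notin> {1..n}" for i using p that by (auto simp: partition_of_length_def)
  have anti: "\<mu> j \<le> \<mu> i" if "1 \<le> i" "i \<le> j" for i j
    using p that out[of j] by (cases "j \<le> n") (auto simp: partition_of_length_def)
  define s where "s = card {i. \<mu> i \<noteq> 0}"
  have fin: "finite {i. \<mu> i \<noteq> 0}" 
  proof (rule finite_subset)
    show "{i. \<mu> i \<noteq> 0} \<subseteq> {1..n}" using out by (metis (mono_tags, lifting) mem_Collect_eq subsetI)
  qed simp
  have one: "\<mu> i \<le> 1" for i
  proof (cases "i \<in> {1..n}")
    case True
    hence "\<mu> i \<le> \<mu> 1" using anti[of 1 i] by auto
    also have "\<mu> 1 \<le> 1" using le[of 1] True by auto
    finally show ?thesis .
  qed (simp add: out)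
  have "\<exists>m. {i. \<mu> i \<noteq> 0} = {1..m}"
  proof (cases "{i. \<mu> i \<noteq> 0} = {}")
    case False
    let ?M = "Max {i. \<mu> i \<noteq> 0}"
    have M: "?M \<in> {i. \<mu> i \<noteq> 0}" using Max_in fin False by blast
    have "{i. \<mu> i \<noteq> 0} = {1..?M}"
    proof (intro equalityI subsetI)
      fix i assume "i \<in> {i. \<mu> i \<noteq> 0}"
      thus "i \<in> {1..?M}" using fin out[of i] by (auto intro: Max_ge)
    next
      fix i assume "i \<in> {1..?M}"
      thus "i \<in> {i. \<mu> i \<noteq> 0}" using anti[of i ?M] M by auto
    qed
    thus ?thesis by blast
  qed auto
  then obtain m where m: "{i. \<mu> i \<noteq> 0} = {1..m}" by blast
  have eq: "\<mu> = column m"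
  proof
    fix i show "\<mu> i = column m i" using m one[of i] by (auto simp: column_def set_eq_iff dest!: spec[of _ i])
  qed
  have mn: "m \<le> n"
  proof (rule ccontr)
    assume "\<not> m \<le> n"
    hence "\<mu> m \<noteq> 0" using m by auto
    thus False using out[of m] \<open>\<not> m \<le> n\<close> by auto
  qed
  have "m \<le> r"
  proof (cases "m = 0")
    case False
    thus ?thesis using le[of m] mn sum_column[of m m] unfolding eq by auto
  qed auto
  moreover have "m \<noteq> r" using eq ne by auto
  ultimately show "\<mu> \<in> column ` {..<r}" using eq by auto
next
  fix \<mu> assume "\<mu> \<in> column ` {..<r}"
  then obtain s where s: "s < r" "\<mu> = column s" by auto
  have "column s \<noteq> column r" using s column_inj by blast
  thus "\<mu> \<in> strictly_dominated n (column r)"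
    using assms column_partition[of s n] s unfolding strictly_dominated_def mem_Collect_eq s(2) sum_column
    by (auto simp del: One_nat_def)
qed

definition sign_vectors :: "nat \<Rightarrow> nat \<Rightarrow> (nat \<Rightarrow> int) set" where
  "sign_vectors n s = {\<nu>. (\<forall>i. \<nu> i \<in> {-1,0,1}) \<and> (\<forall>i. i \<notin> {1..n} \<longrightarrow> \<nu> i = 0) \<and> card {i\<in>{1..n}. \<nu> i \<noteq> 0} = s}"

lemma W_orbit_column:
  assumes "s \<le> n"
  shows "W_orbit n (column s) = sign_vectors n s"
proof (intro equalityI subsetI)
  fix \<nu> assume "\<nu> \<in> W_orbit n (column s)"
  then obtain \<epsilon> \<sigma> where \<nu>: "\<nu> = (\<lambda>i. \<epsilon> i * int (column s (\<sigma> i)))" and \<sigma>: "\<sigma> permutes {1..n}"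
    and \<epsilon>: "\<And>i. \<epsilon> i = 1 \<or> \<epsilon> i = (-1 :: int)"
    unfolding W_orbit_def by blast
  have "\<nu> i \<in> {-1,0,1}" for i using \<epsilon>[of i] by (auto simp: \<nu> column_def)
  moreover have "\<nu> i = 0" if "i \<notin> {1..n}" for i
  proof -
    have "\<sigma> i = i" using \<sigma> that by (simp add: permutes_def)
    thus ?thesis using that assms by (auto simp: \<nu> column_def)
  qed
  moreover have "card {i\<in>{1..n}. \<nu> i \<noteq> 0} = s"
  proof -
    have "{i\<in>{1..n}. \<nu> i \<noteq> 0} = {i\<in>{1..n}. \<sigma> i \<in> {1..s}}"
    proof -
      have "\<epsilon> i \<noteq> 0" for i using \<epsilon>[of i] by auto
      thus ?thesis by (auto simp: \<nu> column_def)
    qed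
    moreover have "\<sigma> ` \<dots> = {1..s}"
    proof -
      have "{1..s} \<subseteq> \<sigma> ` {1..n}" using permutes_image[OF \<sigma>] assms by auto
      thus ?thesis by auto
    qed
    moreover have "inj_on \<sigma> {i\<in>{1..n}. \<sigma> i \<in> {1..s}}"
      using permutes_inj[OF \<sigma>] by (rule inj_on_subset) auto
    ultimately show ?thesis using card_image[of \<sigma> "{i\<in>{1..n}. \<sigma> i \<in> {1..s}}"] by simp
  qed
  ultimately show "\<nu> \<in> sign_vectors n s" unfolding sign_vectors_def by blast
next
  fix \<nu> assume "\<nu> \<in> sign_vectors n s"
  hence \<nu>: "\<And>i. \<nu> i \<in> {-1,0,1}" "\<And>i. i \<notin> {1..n} \<Longrightarrow> \<nu> i = 0" "card {i\<in>{1..n}. \<nu> i \<noteq> 0} = s"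
    unfolding sign_vectors_def by auto
  define I where "I = {i\<in>{1..n}. \<nu> i \<noteq> 0}"
  have I: "I \<subseteq> {1..n}" "finite I" "card I = card {1..s}" using \<nu>(3) by (auto simp: I_def)
  obtain f where f: "bij_betw f I {1..s}"
    using finite_same_card_bij[OF I(2) finite_atLeastAtMost I(3)] by blast
  have "card ({1..n} - I) = card ({1..n} - {1..s})"
    using I assms by (simp add: card_Diff_subset)
  then obtain g where g: "bij_betw g ({1..n} - I) ({1..n} - {1..s})"
    using finite_same_card_bij by blast
  \<comment> \<open>Glued from a bijection of the support onto \<open>{1..s}\<close> and one between
    the complements, and the identity outside \<open>{1..n}\<close>.\<close>
  define \<sigma> where "\<sigma> = (\<lambda>i. if i \<in> I then f i else if i \<in> {1..n} then g i else i)"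
  have "bij_betw \<sigma> I {1..s}" using f by (rule bij_betw_cong[THEN iffD1, rotated]) (auto simp: \<sigma>_def)
  moreover have "bij_betw \<sigma> ({1..n} - I) ({1..n} - {1..s})"
    using g by (rule bij_betw_cong[THEN iffD1, rotated]) (auto simp: \<sigma>_def)
  ultimately have "bij_betw \<sigma> (I \<union> ({1..n} - I)) ({1..s} \<union> ({1..n} - {1..s}))"
    by (rule bij_betw_combine) auto
  moreover have "I \<union> ({1..n} - I) = {1..n}" "{1..s} \<union> ({1..n} - {1..s}) = {1..n}"
    using I assms by auto
  ultimately have "bij_betw \<sigma> {1..n} {1..n}" by simp
  hence perm: "\<sigma> permutes {1..n}" by (rule bij_imp_permutes) (use I in \<open>auto simp: \<sigma>_def\<close>)
  define \<epsilon> where "\<epsilon> = (\<lambda>i. if \<nu> i = -1 then -1 else (1::int))"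
  have "\<nu> = (\<lambda>i. \<epsilon> i * int (column s (\<sigma> i)))"
  proof
    fix i
    show "\<nu> i = \<epsilon> i * int (column s (\<sigma> i))"
    proof (cases "i \<in> I")
      case True
      hence "\<sigma> i \<in> {1..s}" using f by (auto simp: \<sigma>_def bij_betw_def)
      thus ?thesis using True \<nu>(1)[of i] by (auto simp: \<epsilon>_def column_def I_def)
    next
      case False
      hence 0: "\<nu> i = 0" using \<nu>(2)[of i] by (auto simp: I_def)
      have "\<sigma> i \<notin> {1..s}"
      proof (cases "i \<in> {1..n}")
        case True
        hence "\<sigma> i \<in> {1..n} - {1..s}" using g False by (auto simp: \<sigma>_def bij_betw_def)
        thus ?thesis by auto
      next
        case 2: False
        thus ?thesis using False assms by (auto simp: \<sigma>_def)
      qed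
      thus ?thesis using 0 by (auto simp: column_def)
    qed
  qed
  thus "\<nu> \<in> W_orbit n (column s)" unfolding W_orbit_def mem_Collect_eq
    by (intro exI[of _ \<epsilon>] exI[of _ \<sigma>] conjI perm) (simp_all add: \<epsilon>_def)
qed

text \<open>Each factor of \<open>linprod\<close> is 1/x_i + Y + x_i. Choosing one term per factor,
  called \<open>h i e\<close> in the proof, gives a vector with entries -1, 0, 1, and every entry 0
  contributes one power of Y; hence the index \<open>n - s\<close>.\<close>

lemma msym_column:
  assumes "s \<le> n"
  shows "msym n (column s) x = coeff (linprod {1..n} (joukowski x)) (n - s)"
proof -
  define h where "h = (\<lambda>i (e::int). if e = 0 then monom 1 1 else [:x i powi e:])"
  have h: "(\<Prod>i\<in>A. h i (\<nu> i)) = smult (\<Prod>i\<in>A. x i powi \<nu> i) (monom 1 (card {i\<in>A. \<nu> i = 0}))"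
    if "finite A" for A and \<nu> :: "nat \<Rightarrow> int"
    using that
  proof (induction A rule: finite_induct)
    case (insert a A)
    show ?case
    proof (cases "\<nu> a = 0")
      case True
      hence "{i\<in>insert a A. \<nu> i = 0} = insert a {i\<in>A. \<nu> i = 0}" by auto
      with True insert show ?thesis by (simp add: h_def mult_monom)
    next
      case False
      hence "{i\<in>insert a A. \<nu> i = 0} = {i\<in>A. \<nu> i = 0}" by auto
      with False insert show ?thesis by (simp add: h_def mult.commute)
    qed
  qed (simp add: one_pCons)
  let ?P = "PiE {1..n} (\<lambda>_. {-1,0,1::int})"
  have lin: "[:joukowski x i, 1:] = (\<Sum>e\<in>{-1,0,1}. h i e)" for i
    by (simp add: h_def monom_altdef power_int_minus algebra_simps)
  have "linprod {1..n} (joukowski x) = (\<Sum>\<nu>\<in>?P. \<Prod>i\<in>{1..n}. h i (\<nu> i))"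
    unfolding linprod_def lin by (rule prod_sum_PiE) auto
  hence "coeff (linprod {1..n} (joukowski x)) (n - s) =
      (\<Sum>\<nu>\<in>?P. if card {i\<in>{1..n}. \<nu> i = 0} = n - s then \<Prod>i=1..n. x i powi \<nu> i else 0)"
    by (simp add: h coeff_sum) (rule sum.cong, auto)
  also have "\<dots> = (\<Sum>\<nu>\<in>{\<nu>\<in>?P. card {i\<in>{1..n}. \<nu> i = 0} = n - s}. \<Prod>i=1..n. x i powi \<nu> i)"
    by (rule sum.inter_filter[symmetric]) (auto intro!: finite_PiE)
  also have "\<dots> = (\<Sum>\<nu>\<in>sign_vectors n s. \<Prod>i=1..n. x i powi \<nu> i)"
  proof -
    \<comment> \<open>Functions in \<open>PiE\<close> are \<open>undefined\<close> outside
      \<open>{1..n}\<close> while sign vectors are 0 there; \<open>?ext\<close> and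
      \<open>restrict\<close> translate between the two conventions.\<close>
    let ?ext = "\<lambda>\<nu> i. if i \<in> {1..n} then \<nu> i else (0::int)"
    let ?Q = "{\<nu>\<in>?P. card {i\<in>{1..n}. \<nu> i = 0} = n - s}"
    have card: "card {i\<in>{1..n}. \<nu> i = 0} + card {i\<in>{1..n}. \<nu> i \<noteq> 0} = n" for \<nu> :: "nat \<Rightarrow> int"
    proof -
      have "{i\<in>{1..n}. \<nu> i = 0} \<union> {i\<in>{1..n}. \<nu> i \<noteq> 0} = {1..n}" by blast
      hence "card ({i\<in>{1..n}. \<nu> i = 0} \<union> {i\<in>{1..n}. \<nu> i \<noteq> 0}) = n" by simp
      thus ?thesis by (subst (asm) card_Un_disjoint) auto
    qed
    have card_ext: "{i\<in>{1..n}. ?ext \<nu> i \<noteq> 0} = {i\<in>{1..n}. \<nu> i \<noteq> 0}"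
      and card_res: "{i\<in>{1..n}. restrict \<nu> {1..n} i = 0} = {i\<in>{1..n}. \<nu> i = 0}" for \<nu>
      by (rule Collect_cong, auto)+
    have res_ext: "restrict (?ext \<nu>) {1..n} = \<nu>" if "\<nu> \<in> ?Q" for \<nu>
    proof
      fix i show "restrict (?ext \<nu>) {1..n} i = \<nu> i"
        using that by (auto simp: restrict_def PiE_def extensional_def)
    qed
    have ext_mem: "?ext \<nu> \<in> sign_vectors n s" if "\<nu> \<in> ?Q" for \<nu>
    proof -
      have "\<nu> i \<in> {-1,0,1}" if "i \<in> {1..n}" for i using \<open>\<nu> \<in> ?Q\<close> that by blast
      moreover have "card {i\<in>{1..n}. \<nu> i \<noteq> 0} = s" using card[of \<nu>] assms \<open>\<nu> \<in> ?Q\<close> by simp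
      ultimately show ?thesis unfolding sign_vectors_def mem_Collect_eq card_ext by simp
    qed
    have ext_res: "?ext (restrict \<nu> {1..n}) = \<nu>" if "\<nu> \<in> sign_vectors n s" for \<nu>
    proof
      fix i show "?ext (restrict \<nu> {1..n}) i = \<nu> i"
        using that by (auto simp: sign_vectors_def)
    qed
    have res_mem: "restrict \<nu> {1..n} \<in> ?Q" if "\<nu> \<in> sign_vectors n s" for \<nu>
    proof -
      have "\<nu> i \<in> {-1,0,1}" for i using that unfolding sign_vectors_def by blast
      moreover have "card {i\<in>{1..n}. \<nu> i = 0} = n - s"
        using card[of \<nu>] that unfolding sign_vectors_def by simp
      ultimately show ?thesis unfolding mem_Collect_eq card_res by (intro conjI restrict_PiE_iff[THEN iffD2]) auto
    qed
    have prod_ext: "(\<Prod>i=1..n. x i powi ?ext \<nu> i) = (\<Prod>i=1..n. x i powi \<nu> i)" for \<nu>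
      by (rule prod.cong) auto
    show ?thesis
      by (rule sum.reindex_bij_witness[of _ "\<lambda>\<nu>. restrict \<nu> {1..n}" ?ext])
        (erule res_ext ext_mem ext_res res_mem | rule prod_ext)+
  qed
  finally show ?thesis by (simp add: msym_def W_orbit_column[OF assms])
qed

text \<open>Freeing the last variable \<open>w\<close> turns the relation into
  \<open>w * S + S' = 0\<close>, with \<open>S\<close> formed from \<open>v\<close> and
  \<open>S'\<close> from the shifted sequence in the remaining variables. Two values of
  \<open>w\<close> force \<open>S = S' = 0\<close>, and the induction hypothesis applies to both
  sequences. The finite set \<open>F\<close> collects the values that regularity forbids.\<close>

lemma linprod_coeffs_independent_aux:
  assumes "finite F"
  shows "(\<And>z. (\<forall>i\<in>{1..n}. z i \<notin> F) \<Longrightarrow> inj_on z {1..n} \<Longrightarrow> (\<Sum>k\<le>n. v k * coeff (linprod {1..n} z) k) = 0)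
    \<Longrightarrow> k \<le> n \<Longrightarrow> v k = 0"
proof (induction n arbitrary: v k)
  case 0
  from "0.prems"(1)[of id] "0.prems"(2) show ?case by (simp add: linprod_def)
next
  case (Suc n)
  have both: "(\<Sum>k\<le>n. v k * coeff (linprod {1..n} z) k) = 0 \<and> (\<Sum>k\<le>n. v (Suc k) * coeff (linprod {1..n} z) k) = 0"
    if z: "\<forall>i\<in>{1..n}. z i \<notin> F" "inj_on z {1..n}" for z
  proof -
    let ?S = "\<Sum>k\<le>n. v k * coeff (linprod {1..n} z) k"
    let ?S' = "\<Sum>k\<le>n. v (Suc k) * coeff (linprod {1..n} z) k"
    have eq: "w * ?S + ?S' = 0" if w: "w \<notin> F \<union> z ` {1..n}" for w
    proof -
      let ?z = "z(Suc n := w)"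
      have "inj_on ?z {1..Suc n}"
      proof -
        have "{1..Suc n} = insert (Suc n) {1..n}" by auto
        moreover have "inj_on ?z {1..n} = inj_on z {1..n}" by (rule inj_on_cong) auto
        moreover have "?z (Suc n) \<notin> ?z ` ({1..n} - {Suc n})" using w by auto
        ultimately show ?thesis using z(2) by (simp only: inj_on_insert) blast
      qed
      moreover have "\<forall>i\<in>{1..Suc n}. ?z i \<notin> F" using z(1) w by auto
      ultimately have "(\<Sum>k\<le>Suc n. v k * coeff (linprod {1..Suc n} ?z) k) = 0"
        using Suc.prems(1) by blast
      moreover have "linprod {1..Suc n} ?z = [:w, 1:] * linprod {1..n} z"
      proof -
        have "linprod {1..Suc n} ?z = [:w, 1:] * linprod {1..n} ?z"
          by (simp add: linprod_def mult.commute)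
        moreover have "linprod {1..n} ?z = linprod {1..n} z"
          unfolding linprod_def by (rule prod.cong) auto
        ultimately show ?thesis by simp
      qed
      ultimately have "(\<Sum>k\<le>Suc n. v k * (w * coeff (linprod {1..n} z) k + (case k of 0 \<Rightarrow> 0 | Suc j \<Rightarrow> coeff (linprod {1..n} z) j))) = 0"
        by (simp only: mult_pCons_left mult_zero_left pCons_0_0 add_0_right coeff_add coeff_smult coeff_pCons mult_1 smult_1_left)
      hence "(\<Sum>k\<le>Suc n. v k * (w * coeff (linprod {1..n} z) k)) +
        (\<Sum>k\<le>Suc n. v k * (case k of 0 \<Rightarrow> 0 | Suc j \<Rightarrow> coeff (linprod {1..n} z) j)) = 0"
        by (simp only: distrib_left sum.distrib)
      moreover have "(\<Sum>k\<le>Suc n. v k * (case k of 0 \<Rightarrow> 0 | Suc j \<Rightarrow> coeff (linprod {1..n} z) j)) = ?S'"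
        by (subst sum.atMost_Suc_shift) simp
      moreover have "(\<Sum>k\<le>Suc n. v k * (w * coeff (linprod {1..n} z) k)) = w * ?S"
        by (simp add: coeff_linprod_eq_0 sum_distrib_left algebra_simps)
      ultimately show ?thesis by simp
    qed
    have "infinite (- (F \<union> z ` {1..n}))"
      using assms infinite_UNIV_char_0 by (simp add: Compl_eq_Diff_UNIV Diff_infinite_finite)
    hence "- (F \<union> z ` {1..n}) \<noteq> {}" by (intro notI) simp
    then obtain w where w: "w \<in> - (F \<union> z ` {1..n})" by blast
    have "infinite (- (F \<union> z ` {1..n}) - {w})"
      using \<open>infinite (- (F \<union> z ` {1..n}))\<close> by simp
    hence "- (F \<union> z ` {1..n}) - {w} \<noteq> {}" by (metis finite.emptyI)
    then obtain w' where w': "w' \<in> - (F \<union> z ` {1..n}) - {w}" by blast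
    have "(w - w') * ?S = (w * ?S + ?S') - (w' * ?S + ?S')" by (simp only: left_diff_distrib) simp
    also have "w * ?S + ?S' = 0" by (rule eq) (use w in blast)
    also have "w' * ?S + ?S' = 0" by (rule eq) (use w' in blast)
    finally have "(w - w') * ?S = 0" by (simp only: diff_self)
    hence "?S = 0" using w' by auto
    thus ?thesis using eq[of w] w by auto
  qed
  show ?case
  proof (cases k)
    case 0
    thus ?thesis using Suc.IH[of v 0] both by auto
  next
    case (Suc j)
    thus ?thesis using Suc.IH[of "\<lambda>k. v (Suc k)" j] both Suc.prems(2) by auto
  qed
qed

lemma joukowski_surj: "\<exists>x::complex. x \<noteq> 0 \<and> x + inverse x = z"
proof -
  define x where "x = (z + csqrt (z\<^sup>2 - 4)) / 2"
  define y where "y = (z - csqrt (z\<^sup>2 - 4)) / 2"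
  have "x * y = (z\<^sup>2 - (csqrt (z\<^sup>2 - 4))\<^sup>2) / 4"
    by (simp add: x_def y_def power2_eq_square algebra_simps)
  hence xy: "x * y = 1" by simp
  hence "inverse x = y" by (metis inverse_unique)
  moreover have "x + y = z" by (simp add: x_def y_def field_simps)
  moreover have "x \<noteq> 0" using xy by auto
  ultimately show ?thesis by blast
qed

lemma linprod_coeffs_independent:
  assumes "q \<noteq> 0"
    and "\<And>x. regular_point n q x \<Longrightarrow> (\<Sum>k\<le>n. v k * coeff (linprod {1..n} (joukowski x)) k) = 0"
    and "k \<le> n"
  shows "v k = 0"
\<comment> \<open>Avoiding 2 and -2 keeps x_i^2 away from 1; avoiding the other two values keeps
  x_i^2 away from \<open>q\<close> and from 1/q. Injectivity of \<open>z\<close> settles the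
  conditions on pairs.\<close>
proof (rule linprod_coeffs_independent_aux[where F = "{2, -2, csqrt q + inverse (csqrt q), - (csqrt q + inverse (csqrt q))}" and n = n])
  fix z :: "nat \<Rightarrow> complex"
  assume z: "\<forall>i\<in>{1..n}. z i \<notin> {2, -2, csqrt q + inverse (csqrt q), - (csqrt q + inverse (csqrt q))}"
    "inj_on z {1..n}"
  have "\<exists>x. \<forall>i. x i \<noteq> 0 \<and> x i + inverse (x i) = z i"
    by (rule choice) (use joukowski_surj in blast)
  then obtain x where x: "\<And>i. x i \<noteq> 0" "\<And>i. x i + inverse (x i) = z i" by blast
  have "regular_point n q x"
    unfolding regular_point_def
  proof (intro conjI ballI impI)
    fix i assume i: "i \<in> {1..n}"
    show "x i \<noteq> 0" by (rule x)
    show "(x i)\<^sup>2 \<noteq> 1"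
    proof
      assume "(x i)\<^sup>2 = 1"
      hence "x i = 1 \<or> x i = -1" by (simp add: power2_eq_1_iff)
      thus False using x(2)[of i] z(1) i by auto
    qed
    show "(x i)\<^sup>2 \<noteq> q"
    proof
      assume "(x i)\<^sup>2 = q"
      hence "(x i)\<^sup>2 = (csqrt q)\<^sup>2" by simp
      hence "x i = csqrt q \<or> x i = - csqrt q" unfolding power2_eq_iff .
      thus False using x(2)[of i] z(1) i by auto
    qed
    show "q * (x i)\<^sup>2 \<noteq> 1"
    proof
      assume "q * (x i)\<^sup>2 = 1"
      hence "(csqrt q * x i)\<^sup>2 = 1" by (simp add: power_mult_distrib)
      hence "csqrt q * x i = 1 \<or> csqrt q * x i = -1" by (simp add: power2_eq_1_iff)
      hence "x i = inverse (csqrt q) \<or> x i = - inverse (csqrt q)"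
        using assms(1) by (auto simp: field_simps) 
      hence "z i = csqrt q + inverse (csqrt q) \<or> z i = - (csqrt q + inverse (csqrt q))"
        using x(2)[of i] by (auto simp: algebra_simps)
      thus False using z(1) i by blast
    qed
  next
    fix i j assume ij: "i \<in> {1..n}" "j \<in> {1..n}" "i \<noteq> j"
    hence "z i \<noteq> z j" using inj_onD[OF z(2)] by blast
    thus "x i \<noteq> x j" using x(2)[of i] x(2)[of j] by auto
    show "x i * x j \<noteq> 1"
    proof
      assume "x i * x j = 1"
      hence "x j = inverse (x i)" by (metis inverse_unique)
      thus False using x(2)[of i] x(2)[of j] \<open>z i \<noteq> z j\<close> by (simp add: add.commute)
    qed
  qed
  moreover have "joukowski x = z" using x(2) by auto
  ultimately show "(\<Sum>k\<le>n. v k * coeff (linprod {1..n} z) k) = 0" using assms(2)[of x] by simp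
qed (use assms(3) in simp_all)

subsection \<open>Triangular operators\<close>

text \<open>Forward substitution in the eigenvector equation of a lower triangular matrix for its
  \<open>i\<close>-th diagonal entry, normalised to 1 in row \<open>i\<close>. Being an explicit
  rational expression in the entries, it can be followed through a limit.\<close>

fun tri_eigvec :: "(nat \<Rightarrow> nat \<Rightarrow> complex) \<Rightarrow> nat \<Rightarrow> nat \<Rightarrow> complex" where
  "tri_eigvec l i m = (if m < i then 0 else if m = i then 1
     else (\<Sum>k\<in>{..<m}. l m k * tri_eigvec l i k) / (l i i - l m m))"

declare tri_eigvec.simps [simp del]

lemma tri_eigvec_below: "m < i \<Longrightarrow> tri_eigvec l i m = 0"
  and tri_eigvec_diag: "tri_eigvec l i i = 1"
  by (simp_all add: tri_eigvec.simps)

lemma tri_sum_split: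
  fixes l :: "nat \<Rightarrow> nat \<Rightarrow> complex"
  assumes "\<And>k. m < k \<Longrightarrow> l m k = 0" "m \<le> n"
  shows "(\<Sum>k\<le>n. l m k * v k) = (\<Sum>k<m. l m k * v k) + l m m * v m"
proof -
  have "(\<Sum>k\<le>n. l m k * v k) = (\<Sum>k\<le>m. l m k * v k)"
    by (rule sum.mono_neutral_right) (use assms in auto)
  thus ?thesis by (simp add: lessThan_Suc_atMost[symmetric])
qed

lemma tri_eigvec_eigen:
  assumes tri: "\<And>m k. m \<le> n \<Longrightarrow> m < k \<Longrightarrow> l m k = 0"
    and dist: "\<And>m. i < m \<Longrightarrow> m \<le> n \<Longrightarrow> l m m \<noteq> l i i"
    and m: "m \<le> n"
  shows "(\<Sum>k\<le>n. l m k * tri_eigvec l i k) = l i i * tri_eigvec l i m"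
proof -
  have split: "(\<Sum>k\<le>n. l m k * tri_eigvec l i k) = (\<Sum>k<m. l m k * tri_eigvec l i k) + l m m * tri_eigvec l i m"
    by (rule tri_sum_split) (use tri m in auto)
  show ?thesis
  proof (cases "m \<le> i")
    case True
    hence "(\<Sum>k<m. l m k * tri_eigvec l i k) = 0"
      by (intro sum.neutral) (auto simp: tri_eigvec_below)
    thus ?thesis using True split by (cases "m = i") (auto simp: tri_eigvec_below)
  next
    case False
    hence "tri_eigvec l i m * (l i i - l m m) = (\<Sum>k<m. l m k * tri_eigvec l i k)"
      using dist[of m] m by (subst tri_eigvec.simps) auto
    thus ?thesis using split by (simp add: algebra_simps)
  qed
qed

lemma tri_eigvec_unique:
  assumes tri: "\<And>m k. m \<le> n \<Longrightarrow> m < k \<Longrightarrow> l m k = 0"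
    and dist: "\<And>m. i < m \<Longrightarrow> m \<le> n \<Longrightarrow> l m m \<noteq> l i i"
    and v: "v i = 1" "\<And>m. m < i \<Longrightarrow> v m = 0"
    and eig: "\<And>m. m \<le> n \<Longrightarrow> (\<Sum>k\<le>n. l m k * v k) = l i i * v m"
  shows "m \<le> n \<Longrightarrow> v m = tri_eigvec l i m"
proof (induction m rule: less_induct)
  case (less m)
  show ?case
  proof (cases "m \<le> i")
    case True
    thus ?thesis using v by (cases "m = i") (auto simp: tri_eigvec_below tri_eigvec_diag)
  next
    case False
    have "(\<Sum>k\<le>n. l m k * v k) = (\<Sum>k<m. l m k * v k) + l m m * v m"
      by (rule tri_sum_split) (use tri less.prems in auto)
    hence "v m * (l i i - l m m) = (\<Sum>k<m. l m k * v k)"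
      using eig[of m] less.prems by (simp add: algebra_simps)
    also have "\<dots> = (\<Sum>k<m. l m k * tri_eigvec l i k)"
      using less by (intro sum.cong) auto
    finally show ?thesis using dist[of m] False less.prems
      by (subst tri_eigvec.simps) (auto simp: field_simps)
  qed
qed

lemma tendsto_tri_eigvec:
  assumes lim: "\<And>m k. m \<le> n \<Longrightarrow> k \<le> n \<Longrightarrow> ((\<lambda>q. l q m k) \<longlongrightarrow> l0 m k) F"
    and dist: "\<And>m. i < m \<Longrightarrow> m \<le> n \<Longrightarrow> l0 m m \<noteq> l0 i i"
    and i: "i \<le> n"
  shows "m \<le> n \<Longrightarrow> ((\<lambda>q. tri_eigvec (l q) i m) \<longlongrightarrow> tri_eigvec l0 i m) F"
proof (induction m rule: less_induct)
  case (less m)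
  show ?case
  proof (cases "m \<le> i")
    case True
    thus ?thesis by (cases "m = i") (auto simp: tri_eigvec_below tri_eigvec_diag)
  next
    case False
    have "((\<lambda>q. (\<Sum>k\<in>{..<m}. l q m k * tri_eigvec (l q) i k) / (l q i i - l q m m))
      \<longlongrightarrow> (\<Sum>k\<in>{..<m}. l0 m k * tri_eigvec l0 i k) / (l0 i i - l0 m m)) F"
      using less dist[of m] False i by (intro tendsto_intros lim) auto
    thus ?thesis using False by (subst (1 2) tri_eigvec.simps) auto
  qed
qed

section \<open>Monic polynomial sequences and change of basis\<close>

definition monic_seq :: "(nat \<Rightarrow> complex poly) \<Rightarrow> bool" where
  "monic_seq p \<longleftrightarrow> (\<forall>m. degree (p m) = m \<and> coeff (p m) m = 1)"

lemma monic_seqD: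
  assumes "monic_seq p"
  shows "degree (p m) = m" "coeff (p m) m = 1" "m < k \<Longrightarrow> coeff (p m) k = 0"
  using assms by (auto simp: monic_seq_def intro!: coeff_eq_0)

lemma monic_seq_expand_aux:
  assumes p: "monic_seq p"
  shows "(\<And>k. k > n \<Longrightarrow> coeff f k = 0) \<Longrightarrow> \<exists>c. c n = coeff f n \<and> f = (\<Sum>m\<le>n. smult (c m) (p m))"
proof (induction n arbitrary: f)
  case 0
  have "f = smult (coeff f 0) (p 0)"
  proof (rule poly_eqI)
    fix k show "coeff f k = coeff (smult (coeff f 0) (p 0)) k"
      using 0[of k] monic_seqD(2)[OF p, of 0] monic_seqD(3)[OF p, of 0 k] by (cases "k = 0") simp_all
  qed
  thus ?case by (intro exI[of _ "\<lambda>_. coeff f 0"]) simp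
next
  case (Suc n)
  define g where "g = f - smult (coeff f (Suc n)) (p (Suc n))"
  have "coeff g k = 0" if "k > n" for k
  proof (cases "k = Suc n")
    case True thus ?thesis by (simp add: g_def monic_seqD[OF p])
  next
    case False thus ?thesis using that Suc.prems by (simp add: g_def monic_seqD[OF p])
  qed
  then obtain c where c: "g = (\<Sum>m\<le>n. smult (c m) (p m))" using Suc.IH by blast
  have "f = g + smult (coeff f (Suc n)) (p (Suc n))" by (simp add: g_def)
  also have "\<dots> = (\<Sum>m\<le>Suc n. smult ((c(Suc n := coeff f (Suc n))) m) (p m))"
    by (simp add: c)
  finally show ?case by (intro exI[of _ "c(Suc n := coeff f (Suc n))"]) simp
qed

lemma monic_seq_eq_0:
  assumes p: "monic_seq p"
  shows "(\<Sum>m\<le>n. smult (c m) (p m)) = 0 \<Longrightarrow> i \<le> n \<Longrightarrow> c i = 0"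
proof (induction n)
  case 0
  have "coeff (\<Sum>m\<le>0. smult (c m) (p m)) 0 = 0" by (simp only: 0 coeff_0)
  hence "c 0 * coeff (p 0) 0 = 0" by (simp only: atMost_0 sum.insert coeff_smult sum.empty finite.emptyI empty_iff not_False_eq_True add_0_right)
  thus ?case using 0 monic_seqD(2)[OF p, of 0] by simp
next
  case (Suc n)
  have "coeff (\<Sum>m\<le>Suc n. smult (c m) (p m)) (Suc n) = 0" by (simp only: Suc.prems coeff_0)
  hence "c (Suc n) = 0" by (simp add: coeff_sum monic_seqD[OF p])
  thus ?case using Suc by (cases "i = Suc n") auto
qed

lemma monic_seq_unique:
  assumes p: "monic_seq p" and eq: "(\<Sum>m\<le>n. smult (c m) (p m)) = (\<Sum>m\<le>n. smult (d m) (p m))" and "i \<le> n"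
  shows "c i = d i"
proof -
  have "(\<Sum>m\<le>n. smult (c m - d m) (p m)) = 0"
    using eq by (simp add: smult_diff_left sum_subtractf)
  from monic_seq_eq_0[OF p this \<open>i \<le> n\<close>] show ?thesis by simp
qed

text \<open>The inverse of the coefficient matrix of \<open>p\<close>, characterised by its defining
  relation; the entries above the diagonal are normalised to 0.\<close>

definition inv_coeffs :: "(nat \<Rightarrow> complex poly) \<Rightarrow> nat \<Rightarrow> nat \<Rightarrow> complex" where
  "inv_coeffs p = (SOME R. \<forall>k. R k k = 1 \<and> (\<forall>m>k. R k m = 0) \<and> monom 1 k = (\<Sum>m\<le>k. smult (R k m) (p m)))"

lemma inv_coeffs_aux:
  assumes p: "monic_seq p"
  shows "inv_coeffs p k k = 1" "k < m \<Longrightarrow> inv_coeffs p k m = 0"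
    "monom 1 k = (\<Sum>m\<le>k. smult (inv_coeffs p k m) (p m))"
proof -
  have "\<exists>r. r k = 1 \<and> (\<forall>m>k. r m = 0) \<and> monom 1 k = (\<Sum>m\<le>k. smult (r m) (p m))" for k
  proof -
    have "\<exists>c. c k = coeff (monom 1 k) k \<and> monom 1 k = (\<Sum>m\<le>k. smult (c m) (p m))"
      by (rule monic_seq_expand_aux[OF p]) simp
    then obtain c where c: "c k = 1" "monom 1 k = (\<Sum>m\<le>k. smult (c m) (p m))" by auto
    show ?thesis
      by (rule exI[of _ "\<lambda>m. if m \<le> k then c m else 0"]) (use c in auto)
  qed
  hence "\<exists>R. \<forall>k. R k k = 1 \<and> (\<forall>m>k. R k m = 0) \<and> monom 1 k = (\<Sum>m\<le>k. smult (R k m) (p m))"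
    by (intro choice) blast
  from someI_ex[OF this, folded inv_coeffs_def]
  have R: "\<forall>k. inv_coeffs p k k = 1 \<and> (\<forall>m>k. inv_coeffs p k m = 0)
      \<and> monom 1 k = (\<Sum>m\<le>k. smult (inv_coeffs p k m) (p m))" .
  note R' = spec[OF R, of k]
  show "inv_coeffs p k k = 1" using R' by (rule conjunct1)
  show "k < m \<Longrightarrow> inv_coeffs p k m = 0"
    using R'[THEN conjunct2, THEN conjunct1] by (elim allE[of _ m] impE)
  show "monom 1 k = (\<Sum>m\<le>k. smult (inv_coeffs p k m) (p m))"
    using R' by (elim conjE)
qed

lemma monom_inv_coeffs:
  assumes p: "monic_seq p" and "k \<le> n"
  shows "monom 1 k = (\<Sum>m\<le>n. smult (inv_coeffs p k m) (p m))"
proof -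
  have "(\<Sum>m\<le>n. smult (inv_coeffs p k m) (p m)) = (\<Sum>m\<le>k. smult (inv_coeffs p k m) (p m))"
    by (rule sum.mono_neutral_right) (use assms in \<open>auto simp: inv_coeffs_aux[OF p]\<close>)
  thus ?thesis using inv_coeffs_aux(3)[OF p] by simp
qed

lemma expand_inv_coeffs:
  assumes p: "monic_seq p" and deg: "\<And>k. k > n \<Longrightarrow> coeff f k = 0"
  shows "f = (\<Sum>m\<le>n. smult (\<Sum>k\<le>n. inv_coeffs p k m * coeff f k) (p m))"
proof -
  have "f = (\<Sum>k\<le>n. monom (coeff f k) k)"
    by (rule poly_eqI) (use deg in \<open>auto simp: coeff_sum\<close>)
  also have "\<dots> = (\<Sum>k\<le>n. smult (coeff f k) (monom 1 k))" by (simp add: smult_monom)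
  also have "\<dots> = (\<Sum>k\<le>n. smult (coeff f k) (\<Sum>m\<le>n. smult (inv_coeffs p k m) (p m)))"
    by (rule sum.cong) (use monom_inv_coeffs[OF p] in auto)
  also have "\<dots> = (\<Sum>k\<le>n. \<Sum>m\<le>n. smult (inv_coeffs p k m * coeff f k) (p m))"
    by (intro sum.cong refl poly_eqI) (simp add: coeff_sum sum_distrib_left mult_ac)
  also have "\<dots> = (\<Sum>m\<le>n. smult (\<Sum>k\<le>n. inv_coeffs p k m * coeff f k) (p m))"
    by (subst sum.swap) (intro sum.cong refl poly_eqI, simp add: coeff_sum sum_distrib_right)
  finally show ?thesis .
qed

lemma inv_coeffs_inverse:
  assumes p: "monic_seq p" and "i \<le> n" "j \<le> n"
  shows "(\<Sum>k\<le>n. inv_coeffs p k j * coeff (p i) k) = (if i = j then 1 else 0)"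
proof (rule monic_seq_unique[OF p _ \<open>j \<le> n\<close>, of "\<lambda>j. \<Sum>k\<le>n. inv_coeffs p k j * coeff (p i) k"])
  have "(\<Sum>m\<le>n. smult (\<Sum>k\<le>n. inv_coeffs p k m * coeff (p i) k) (p m)) = p i"
    by (rule expand_inv_coeffs[OF p, symmetric]) (use assms in \<open>auto simp: monic_seqD\<close>)
  also have "\<dots> = (\<Sum>m\<le>n. if i = m then p m else 0)" using \<open>i \<le> n\<close> by simp
  also have "\<dots> = (\<Sum>m\<le>n. smult (if i = m then 1 else 0) (p m))" by (intro sum.cong) auto
  finally show "(\<Sum>m\<le>n. smult (\<Sum>k\<le>n. inv_coeffs p k m * coeff (p i) k) (p m)) = \<dots>" .
qed

text \<open>Row \<open>m\<close> is the image of the monomial of degree \<open>m\<close> under the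
  linear map that multiplies each \<open>p i\<close> by \<open>d i\<close>.\<close>

definition diag_matrix :: "(nat \<Rightarrow> complex poly) \<Rightarrow> (nat \<Rightarrow> complex) \<Rightarrow> nat \<Rightarrow> nat \<Rightarrow> complex" where
  "diag_matrix p d m k = (\<Sum>i\<le>m. inv_coeffs p m i * d i * coeff (p i) k)"

lemma diag_matrix_upto:
  assumes p: "monic_seq p" and "m \<le> n"
  shows "diag_matrix p d m k = (\<Sum>i\<le>n. inv_coeffs p m i * d i * coeff (p i) k)"
  unfolding diag_matrix_def
  by (rule sum.mono_neutral_left) (use assms in \<open>auto simp: inv_coeffs_aux[OF p]\<close>)

lemma diag_matrix_tri:
  assumes p: "monic_seq p"
  shows "m < k \<Longrightarrow> diag_matrix p d m k = 0"
  unfolding diag_matrix_def by (rule sum.neutral) (auto simp: monic_seqD[OF p])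

lemma diag_matrix_diag:
  assumes p: "monic_seq p"
  shows "diag_matrix p d m m = d m"
proof -
  have "diag_matrix p d m m = (\<Sum>i\<le>m. if i = m then d m else 0)"
    unfolding diag_matrix_def
    by (rule sum.cong) (auto simp: monic_seqD[OF p] inv_coeffs_aux[OF p])
  thus ?thesis by simp
qed

text \<open>The matrix is a product R D C with C R = 1, so its column eigenvectors are the columns
  of R: the coefficient functionals with respect to \<open>p\<close>, not the \<open>p i\<close>
  themselves. This is where the duality between \<open>x\<close> and Y enters.\<close>

lemma tri_eigvec_diag_matrix:
  assumes p: "monic_seq p" and dist: "\<And>m. i < m \<Longrightarrow> m \<le> n \<Longrightarrow> d m \<noteq> d i" and m: "m \<le> n" and i: "i \<le> n"
  shows "tri_eigvec (diag_matrix p d) i m = inv_coeffs p m i"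
proof (rule tri_eigvec_unique[symmetric, where n = n])
  fix m assume m: "m \<le> n"
  have "(\<Sum>k\<le>n. diag_matrix p d m k * inv_coeffs p k i)
      = (\<Sum>k\<le>n. \<Sum>j\<le>n. inv_coeffs p m j * d j * (inv_coeffs p k i * coeff (p j) k))"
    by (simp add: diag_matrix_upto[OF p m] sum_distrib_left sum_distrib_right algebra_simps)
  also have "\<dots> = (\<Sum>j\<le>n. inv_coeffs p m j * d j * (\<Sum>k\<le>n. inv_coeffs p k i * coeff (p j) k))"
    by (subst sum.swap) (simp add: sum_distrib_left)
  also have "\<dots> = (\<Sum>j\<le>n. if j = i then inv_coeffs p m i * d i else 0)"
    by (rule sum.cong) (auto simp: inv_coeffs_inverse[OF p _ i])
  also have "\<dots> = diag_matrix p d i i * inv_coeffs p m i"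
    using i by (simp add: diag_matrix_diag[OF p])
  finally show "(\<Sum>k\<le>n. diag_matrix p d m k * inv_coeffs p k i) = \<dots>" .
next
  fix m assume "i < m" "m \<le> n"
  thus "diag_matrix p d m m \<noteq> diag_matrix p d i i" using dist by (simp add: diag_matrix_diag[OF p])
qed (simp_all add: diag_matrix_tri[OF p] inv_coeffs_aux[OF p] m)

subsection \<open>The normalised operator\<close>

text \<open>The parameters enter through \<open>(1 - a u) (1 - b u) (1 - c u) (1 - d u) = 1 - e u\<^sup>2 + f u\<^sup>4\<close>.
  On polynomials that are affine in each \<open>x\<^sub>i + 1 / x\<^sub>i\<close> the operator depends on \<open>q\<close> only through the
  scalar \<open>(1 - q) / (q \<alpha> t\<^sup>n\<^sup>-\<^sup>1)\<close>, which is split off here.\<close>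

definition weight :: "nat \<Rightarrow> complex \<Rightarrow> complex \<Rightarrow> complex \<Rightarrow> (nat \<Rightarrow> complex) \<Rightarrow> nat \<Rightarrow> complex \<Rightarrow> complex" where
  "weight n t e f x i u = (1 - e * u ^ 2 + f * u ^ 4) / (u * (1 - u ^ 2)) *
     (\<Prod>j\<in>{1..n} - {i}. (1 - t * u * x j) * (1 - t * u / x j) / ((1 - u * x j) * (1 - u / x j)))"

text \<open>A generating polynomial: its coefficient of degree \<open>k\<close> is the normalised
  operator applied to the coefficient of degree \<open>k\<close> of \<Phi>. Removing factor
  \<open>i\<close> from \<Phi> is the divided difference in z_i.\<close>

definition op_poly :: "nat \<Rightarrow> complex \<Rightarrow> complex \<Rightarrow> complex \<Rightarrow> (nat \<Rightarrow> complex) \<Rightarrow> complex poly" where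
  "op_poly n t e f x = (\<Sum>i=1..n. smult (weight n t e f x i (x i) + weight n t e f x i (inverse (x i)))
     (linprod ({1..n} - {i}) (joukowski x)))"

text \<open>For \<open>m \<le> n\<close> this is (1 - t^(n-m)) (1 - f t^(n+m-1)) / (1 - t). It
  belongs to the column of length \<open>n - m\<close> and vanishes for the empty column, since the
  operator annihilates constants.\<close>

definition eigval :: "nat \<Rightarrow> complex \<Rightarrow> complex \<Rightarrow> nat \<Rightarrow> complex" where
  "eigval n t f m = (1 - t ^ (n - m) - f * t ^ (n - 1) * (t ^ m - t ^ n)) / (1 - t)"

lemma linprod_update_diff:
  assumes "i \<in> {1..n}"
  shows "coeff (linprod {1..n} (joukowski (x(i := y)))) k - coeff (linprod {1..n} (joukowski x)) k
    = (y + inverse y - (x i + inverse (x i))) * coeff (linprod ({1..n} - {i}) (joukowski x)) k"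
proof -
  have ins: "{1..n} = insert i ({1..n} - {i})" using assms by auto
  have split: "linprod {1..n} z = [:z i, 1:] * linprod ({1..n} - {i}) z" for z
    by (subst ins, subst linprod_insert) auto
  have "linprod ({1..n} - {i}) (joukowski (x(i := y))) = linprod ({1..n} - {i}) (joukowski x)"
    unfolding linprod_def by (rule prod.cong) auto
  thus ?thesis unfolding split by (simp add: algebra_simps)
qed

lemma cancel_factor:
  fixes g K B D P q u S :: complex
  assumes "D \<noteq> 0"
  shows "g / (K * B * D) * P * ((1 - q) * D / (q * u) * S) = (1 - q) / (q * K) * (g / (u * B) * P * S)"
proof -
  have "g / (K * B * D) * P * ((1 - q) * D / (q * u) * S)
      = (1 - q) / (q * K) * (g / (u * B) * P * S) * (D * inverse D)"
    by (simp add: divide_inverse mult_ac)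
  thus ?thesis using assms by simp
qed

text \<open>A function affine in z_i changes by its slope times the increment of z_i. The increment
  has the factor 1 - q x_i^2, or 1 - q / x_i^2 for the inverse shift, which cancels the denominator
  containing \<open>q\<close>; \<open>weight\<close> is what remains.\<close>

lemma koornwinder_op_linprod:
  assumes x: "regular_point n q x" and q: "q \<noteq> 0" "q \<noteq> 1"
    and par: "\<And>u. (1 - a * u) * (1 - b * u) * (1 - c * u) * (1 - d * u) = 1 - e * u ^ 2 + f * u ^ 4"
  shows "koornwinder_op n a b c d q t (\<lambda>x. \<Sum>k\<le>n. v k * coeff (linprod {1..n} (joukowski x)) k) x
    = (1 - q) / (q * koornwinder_alpha a b c d q * t ^ (n - 1)) * (\<Sum>k\<le>n. v k * coeff (op_poly n t e f x) k)"
proof -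
  define K where "K = koornwinder_alpha a b c d q * t ^ (n - 1)"
  define S where "S = (\<lambda>i. \<Sum>k\<le>n. v k * coeff (linprod ({1..n} - {i}) (joukowski x)) k)"
  let ?f = "\<lambda>x. \<Sum>k\<le>n. v k * coeff (linprod {1..n} (joukowski x)) k"
  have diff: "?f (x(i := y)) - ?f x = (y + inverse y - (x i + inverse (x i))) * S i" if "i \<in> {1..n}" for i y
  proof -
    have "?f (x(i := y)) - ?f x = (\<Sum>k\<le>n. v k * (coeff (linprod {1..n} (joukowski (x(i := y)))) k
         - coeff (linprod {1..n} (joukowski x)) k))"
      by (simp only: right_diff_distrib sum_subtractf)
    also have "\<dots> = (y + inverse y - (x i + inverse (x i))) * S i"
      by (simp only: linprod_update_diff[OF that] S_def sum_distrib_left mult_ac)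
    finally show ?thesis .
  qed
  have 1: "(1 - a * x i) * (1 - b * x i) * (1 - c * x i) * (1 - d * x i)
         / (K * (1 - (x i)\<^sup>2) * (1 - q * (x i)\<^sup>2))
       * (\<Prod>j\<in>{1..n} - {i}.
            (1 - t * x i * x j) * (1 - t * x i / x j) / ((1 - x i * x j) * (1 - x i / x j)))
       * (?f (x(i := q * x i)) - ?f x) = (1 - q) / (q * K) * (weight n t e f x i (x i) * S i)"
    (is "?g / _ * ?P * _ = _") if i: "i \<in> {1..n}" for i
  proof -
    have nz: "x i \<noteq> 0" "1 - q * (x i)\<^sup>2 \<noteq> 0" using x i by (auto simp: regular_point_def)
    have "q * x i + inverse (q * x i) - (x i + inverse (x i)) = (1 - q) * (1 - q * (x i)\<^sup>2) / (q * x i)"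
      using nz q by (simp add: field_simps power2_eq_square)
    hence "?g / (K * (1 - (x i)\<^sup>2) * (1 - q * (x i)\<^sup>2)) * ?P * (?f (x(i := q * x i)) - ?f x)
      = ?g / (K * (1 - (x i)\<^sup>2) * (1 - q * (x i)\<^sup>2)) * ?P * ((1 - q) * (1 - q * (x i)\<^sup>2) / (q * x i) * S i)"
      by (simp only: diff[OF i])
    also have "\<dots> = (1 - q) / (q * K) * (?g / (x i * (1 - (x i)\<^sup>2)) * ?P * S i)"
      by (rule cancel_factor[OF nz(2)])
    finally show ?thesis by (simp only: par weight_def)
  qed
  have 2: "(1 - a / x i) * (1 - b / x i) * (1 - c / x i) * (1 - d / x i)
         / (K * (1 - 1 / (x i)\<^sup>2) * (1 - q / (x i)\<^sup>2))
       * (\<Prod>j\<in>{1..n} - {i}.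
            (1 - t * x j / x i) * (1 - t / (x i * x j)) / ((1 - x j / x i) * (1 - 1 / (x i * x j))))
       * (?f (x(i := x i / q)) - ?f x) = (1 - q) / (q * K) * (weight n t e f x i (inverse (x i)) * S i)"
    (is "?g / _ * ?P * _ = _") if i: "i \<in> {1..n}" for i
  proof -
    let ?u = "inverse (x i)"
    have nz: "?u \<noteq> 0" "1 - q * ?u\<^sup>2 \<noteq> 0" using x i by (auto simp: regular_point_def field_simps)
    have g: "?g = (1 - a * ?u) * (1 - b * ?u) * (1 - c * ?u) * (1 - d * ?u)"
      by (simp add: divide_inverse)
    have P: "?P = (\<Prod>j\<in>{1..n} - {i}. (1 - t * ?u * x j) * (1 - t * ?u / x j) / ((1 - ?u * x j) * (1 - ?u / x j)))"
      by (rule prod.cong) (auto simp: divide_inverse mult_ac)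
    have "x i / q + inverse (x i / q) - (x i + inverse (x i)) = (1 - q) * (1 - q * ?u\<^sup>2) / (q * ?u)"
      using nz q by (simp add: field_simps power2_eq_square)
    hence "?g / (K * (1 - 1 / (x i)\<^sup>2) * (1 - q / (x i)\<^sup>2)) * ?P * (?f (x(i := x i / q)) - ?f x)
      = ?g / (K * (1 - 1 / (x i)\<^sup>2) * (1 - q / (x i)\<^sup>2)) * ?P * ((1 - q) * (1 - q * ?u\<^sup>2) / (q * ?u) * S i)"
      by (simp only: diff[OF i])
    also have "\<dots> = ?g / (K * (1 - ?u\<^sup>2) * (1 - q * ?u\<^sup>2)) * ?P * ((1 - q) * (1 - q * ?u\<^sup>2) / (q * ?u) * S i)"
      by (simp only: divide_inverse power_inverse mult_1)
    also have "\<dots> = (1 - q) / (q * K) * (?g / (?u * (1 - ?u\<^sup>2)) * ?P * S i)"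
      by (rule cancel_factor[OF nz(2)])
    finally show ?thesis by (simp only: par weight_def g P)
  qed
  have "koornwinder_op n a b c d q t ?f x
    = (\<Sum>i=1..n. (1 - q) / (q * K) * (weight n t e f x i (x i) * S i))
    + (\<Sum>i=1..n. (1 - q) / (q * K) * (weight n t e f x i (inverse (x i)) * S i))"
    unfolding koornwinder_op_def K_def[symmetric] 
    by (intro arg_cong2[of _ _ _ _ "(+)"] sum.cong refl 1 2)
  also have "\<dots> = (1 - q) / (q * K) * (\<Sum>i=1..n. (weight n t e f x i (x i) + weight n t e f x i (inverse (x i))) * S i)"
    by (simp only: sum_distrib_left[symmetric] distrib_left[symmetric] sum.distrib[symmetric] distrib_right)
  also have "(\<Sum>i=1..n. (weight n t e f x i (x i) + weight n t e f x i (inverse (x i))) * S i)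
     = (\<Sum>k\<le>n. v k * coeff (op_poly n t e f x) k)"
    unfolding S_def op_poly_def coeff_sum sum_distrib_left
    by (subst sum.swap) (simp add: mult_ac)
  finally show ?thesis by (simp add: K_def mult_ac)
qed

text \<open>Only the rows \<open>j \<le> r\<close> contribute, each through the scalar of
  \<open>koornwinder_op_linprod\<close>, and the remaining geometric sums give
  \<open>eigval\<close>. The assumption on \<alpha> makes \<open>f\<close> the product of the four
  parameters.\<close>

lemma koornwinder_eigenvalue_column:
  assumes r: "r \<le> n" and q: "q \<noteq> 0" and t: "t \<noteq> 0" "t \<noteq> 1"
    and \<alpha>: "koornwinder_alpha a b c d q ^ 2 * q = f" "koornwinder_alpha a b c d q \<noteq> 0"
  shows "koornwinder_eigenvalue n a b c d q t (column r)
    = (1 - q) / (q * koornwinder_alpha a b c d q * t ^ (n - 1)) * eigval n t f (n - r)"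
proof -
  define A where "A = koornwinder_alpha a b c d q"
  note A = \<alpha>[folded A_def]
  let ?F = "\<lambda>j. A * t ^ (n - j) * q ^ column r j + inverse A * inverse t ^ (n - j) * inverse q ^ column r j
       - A * t ^ (n - j) - inverse A * inverse t ^ (n - j)"
  have "koornwinder_eigenvalue n a b c d q t (column r) = (\<Sum>j=1..n. ?F j)"
    by (simp add: koornwinder_eigenvalue_def A_def Let_def)
  also have "\<dots> = (\<Sum>j=1..r. ?F j)"
    by (rule sum.mono_neutral_right) (use r in \<open>auto simp: column_def\<close>)
  also have "\<dots> = (\<Sum>j=1..r. (1 - q) / (q * A * t ^ (n - 1)) * (t ^ (j - 1) - f * t ^ (n - 1) * t ^ (n - j)))"
  proof (rule sum.cong[OF refl])
    fix j assume j: "j \<in> {1..r}"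
    have pow: "t ^ (n - 1) = t ^ (j - 1) * t ^ (n - j)"
      using j r by (simp flip: power_add)
    show "?F j = (1 - q) / (q * A * t ^ (n - 1)) * (t ^ (j - 1) - f * t ^ (n - 1) * t ^ (n - j))"
      using A(2) q t j unfolding pow A(1)[symmetric]
      by (simp add: column_def field_simps power2_eq_square)
  qed
  also have "\<dots> = (1 - q) / (q * A * t ^ (n - 1)) * (\<Sum>j=1..r. t ^ (j - 1) - f * t ^ (n - 1) * t ^ (n - j))"
    by (simp only: sum_distrib_left)
  also have "(\<Sum>j=1..r. t ^ (j - 1) - f * t ^ (n - 1) * t ^ (n - j)) = eigval n t f (n - r)"
    using r
  proof (induction r)
    case 0 thus ?case by (simp add: eigval_def)
  next
    case (Suc r)
    then obtain s where s: "n = s + Suc r" by (metis le_add_diff_inverse2)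
    have "(\<Sum>j=1..Suc r. t ^ (j - 1) - f * t ^ (n - 1) * t ^ (n - j))
        = eigval n t f (n - r) + (t ^ r - f * t ^ (n - 1) * t ^ (n - Suc r))"
      using Suc by simp
    thus ?case using t by (simp add: s eigval_def field_simps)
  qed
  finally show ?thesis by (simp add: A_def)
qed

section \<open>The Askey-Wilson equation in base \<open>t\<close>\<close>

definition aw_coeff :: "complex \<Rightarrow> complex \<Rightarrow> complex \<Rightarrow> complex \<Rightarrow> complex" where
  "aw_coeff t e f y = (1 - e * y ^ 2 + f * y ^ 4) / ((1 - y ^ 2) * (1 - t * y ^ 2))"

text \<open>The Askey-Wilson difference equation with shift \<open>t\<close>, whose eigenvalue is
  (t^(-m) - 1) (1 - f t^(m-1)). The excluded \<open>y\<close> are 0 and the zeros of the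
  denominators.\<close>

definition aw_eigenpoly :: "complex \<Rightarrow> complex \<Rightarrow> complex \<Rightarrow> nat \<Rightarrow> complex poly \<Rightarrow> bool" where
  "aw_eigenpoly t e f m p \<longleftrightarrow> (\<forall>y. y \<noteq> 0 \<and> y ^ 2 \<noteq> 1 \<and> t * y ^ 2 \<noteq> 1 \<and> y ^ 2 \<noteq> t \<longrightarrow>
     aw_coeff t e f y * (poly p (t * y + inverse (t * y)) - poly p (y + inverse y))
     + aw_coeff t e f (inverse y) * (poly p (y / t + inverse (y / t)) - poly p (y + inverse y))
     = (inverse t ^ m - 1 - f / t + f * t ^ m / t) * poly p (y + inverse y))"

text \<open>What remains of \<open>regular_point\<close> once the denominators containing
  \<open>q\<close> have cancelled.\<close>

definition weyl_regular :: "nat \<Rightarrow> (nat \<Rightarrow> complex) \<Rightarrow> bool" where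
  "weyl_regular n x \<longleftrightarrow> (\<forall>i\<in>{1..n}. x i \<noteq> 0 \<and> (x i)\<^sup>2 \<noteq> 1) \<and>
     (\<forall>i\<in>{1..n}. \<forall>j\<in>{1..n}. i \<noteq> j \<longrightarrow> x i * x j \<noteq> 1 \<and> x i \<noteq> x j)"

lemma regular_point_weyl_regular: "regular_point n q x \<Longrightarrow> weyl_regular n x"
  by (auto simp: regular_point_def weyl_regular_def)

lemma joukowski_eq_iff:
  fixes u w :: complex
  assumes "u \<noteq> 0" "w \<noteq> 0"
  shows "u + inverse u = w + inverse w \<longleftrightarrow> u = w \<or> u * w = 1"
proof -
  have "u + inverse u - (w + inverse w) = (u - w) * (u * w - 1) / (u * w)"
    using assms by (simp add: field_simps)
  moreover have "u + inverse u = w + inverse w \<longleftrightarrow> u + inverse u - (w + inverse w) = 0" by simp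
  ultimately show ?thesis using assms by simp
qed

text \<open>Factor \<open>j\<close> of the weight times z_j - z_k is t (z_j - w) with w = t u + 1 /
  (t u), so the product is \<Phi> at -w without its factor z_k - w. That factor is -(1 - t) (1 - t
  u^2) / (t u), and dividing by it supplies the second denominator of \<open>aw_coeff\<close>. The
  lemma serves u = x_k and u = 1 / x_k.\<close>

lemma weight_node:
  assumes t: "t \<noteq> 0" "t \<noteq> 1" and k: "k \<in> {1..n}" and u: "u \<noteq> 0" "u ^ 2 \<noteq> 1" "t * u ^ 2 \<noteq> 1"
    and zk: "u + inverse u = joukowski x k"
    and x: "\<And>j. j \<in> {1..n} \<Longrightarrow> x j \<noteq> 0" "\<And>j. j \<in> {1..n} - {k} \<Longrightarrow> joukowski x j \<noteq> joukowski x k"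
  shows "weight n t e f x k u * (\<Prod>j\<in>{1..n} - {k}. joukowski x j - joukowski x k)
    = - (t ^ n) / (1 - t) * (aw_coeff t e f u * poly (linprod {1..n} (joukowski x)) (- (t * u + inverse (t * u))))"
proof -
  let ?z = "joukowski x" and ?w = "t * u + inverse (t * u)" and ?A = "{1..n} - {k}"
  have card: "card ?A = n - 1" using k by simp
  have "(1 - t * u * x j) * (1 - t * u / x j) / ((1 - u * x j) * (1 - u / x j)) * (?z j - ?z k) = t * (?z j - ?w)"
    if j: "j \<in> ?A" for j
  proof -
    have 1: "(1 - t * u * x j) * (1 - t * u / x j) = t * u * (?w - ?z j)"
      using x(1)[of j] j u t by (simp add: field_simps)
    have "(1 - u * x j) * (1 - u / x j) = u * ((u + inverse u) - ?z j)"
      using x(1)[of j] j u by (simp add: field_simps)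
    hence 2: "(1 - u * x j) * (1 - u / x j) = u * (?z k - ?z j)" by (simp only: zk)
    have nz: "?z k - ?z j \<noteq> 0" using x(2)[OF j] by simp
    have "t * u * (?w - ?z j) / (u * (?z k - ?z j)) * (?z j - ?z k) = t * (?z j - ?w)"
      using u(1) nz by (simp add: divide_simps) (simp add: algebra_simps)
    thus ?thesis by (simp only: 1 2)
  qed
  hence "(\<Prod>j\<in>?A. (1 - t * u * x j) * (1 - t * u / x j) / ((1 - u * x j) * (1 - u / x j)))
      * (\<Prod>j\<in>?A. ?z j - ?z k) = (\<Prod>j\<in>?A. t * (?z j - ?w))"
    by (simp only: prod.distrib[symmetric] cong: prod.cong)
  also have "\<dots> = t ^ (n - 1) * (\<Prod>j\<in>?A. ?z j - ?w)"
    by (simp only: prod.distrib prod_constant card)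
  finally have P: "(\<Prod>j\<in>?A. (1 - t * u * x j) * (1 - t * u / x j) / ((1 - u * x j) * (1 - u / x j)))
      * (\<Prod>j\<in>?A. ?z j - ?z k) = t ^ (n - 1) * (\<Prod>j\<in>?A. ?z j - ?w)" .
  have Phi: "poly (linprod {1..n} ?z) (- ?w) = (?z k - ?w) * (\<Prod>j\<in>?A. ?z j - ?w)"
    unfolding poly_linprod diff_conv_add_uminus by (rule prod.remove) (use k in auto)
  have zw: "?z k - ?w = - (1 - t) * (1 - t * u ^ 2) / (t * u)"
    unfolding zk[symmetric] using u t by (simp add: field_simps power2_eq_square)
  define G where "G = 1 - e * u ^ 2 + f * u ^ 4"
  define Q where "Q = (\<Prod>j\<in>?A. ?z j - ?w)"
  define B where "B = 1 - u ^ 2"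
  define D where "D = 1 - t * u ^ 2"
  have nz: "B \<noteq> 0" "D \<noteq> 0" "1 - t \<noteq> 0" using u t by (auto simp: B_def D_def)
  have "weight n t e f x k u * (\<Prod>j\<in>?A. ?z j - ?z k) = G / (u * B) *
      ((\<Prod>j\<in>?A. (1 - t * u * x j) * (1 - t * u / x j) / ((1 - u * x j) * (1 - u / x j))) * (\<Prod>j\<in>?A. ?z j - ?z k))"
    unfolding weight_def G_def B_def by (rule mult.assoc)
  also have "\<dots> = G / (u * B) * (t ^ (n - 1) * Q)"
    unfolding P Q_def ..
  also have "\<dots> = - (t ^ n) / (1 - t) * (G / (B * D) * ((- (1 - t) * D / (t * u)) * Q))"
  proof -
    have tn: "t ^ n = t * t ^ (n - 1)" using k by (cases n) auto
    show ?thesis unfolding tn using nz u(1) t(1) by (simp add: divide_simps) (simp add: algebra_simps)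
  qed
  also have "\<dots> = - (t ^ n) / (1 - t) * (aw_coeff t e f u * poly (linprod {1..n} ?z) (- ?w))"
    unfolding Phi zw aw_coeff_def G_def B_def D_def Q_def ..
  finally show ?thesis .
qed

lemma poly_eq_0_if_roots:
  fixes p :: "complex poly"
  assumes "\<And>k. k \<ge> n \<Longrightarrow> coeff p k = 0" "inj_on z {1..n}" "\<And>i. i \<in> {1..n} \<Longrightarrow> poly p (z i) = 0"
  shows "p = 0"
proof (rule ccontr)
  assume p: "p \<noteq> 0"
  hence "degree p < n" using assms(1)[of "degree p"] by (meson leading_coeff_0_iff not_le)
  moreover have "card (z ` {1..n}) \<le> card {x. poly p x = 0}"
    by (rule card_mono) (use assms(3) p poly_roots_finite in auto)
  moreover have "card (z ` {1..n}) = n" using card_image[OF assms(2)] by simp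
  ultimately show False using card_poly_roots_bound[OF p] by simp
qed

text \<open>Subtracting the Askey-Wilson eigenvalue of index \<open>n\<close> accounts for the
  additive constant between the two operators; the prefactor is that of
  \<open>weight_node\<close>.\<close>

lemma eigval_aw:
  assumes "t \<noteq> 0" "t \<noteq> 1" "m \<le> n" "n \<ge> 1"
  shows "eigval n t f m = - (t ^ n) / (1 - t) *
    ((inverse t ^ m - 1 - f / t + f * t ^ m / t) - (inverse t ^ n - 1 - f / t + f * t ^ n / t))"
proof -
  obtain s where n: "n = m + s" using assms le_Suc_ex by blast
  have tn: "t ^ n = t ^ m * t ^ s" by (simp add: n power_add)
  have tn1: "t ^ (n - 1) = t ^ m * t ^ s / t" unfolding tn[symmetric] using assms by (cases n) auto
  have nm: "n - m = s" by (simp add: n)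
  show ?thesis unfolding eigval_def tn tn1 nm power_inverse using assms
    by (simp add: field_simps)
qed

lemma op_poly_expand_generic:
  assumes t: "t \<noteq> 0" "t \<noteq> 1" and n: "n \<ge> 1" and p: "monic_seq p"
    and aw: "\<And>m. m \<le> n \<Longrightarrow> aw_eigenpoly t e f m (p m)"
    and x: "weyl_regular n x" "\<And>i. i \<in> {1..n} \<Longrightarrow> t * (x i) ^ 2 \<noteq> 1 \<and> (x i) ^ 2 \<noteq> t"
    and c: "linprod {1..n} (joukowski x) = (\<Sum>m\<le>n. smult (c m) (p m))"
  shows "op_poly n t e f x = (\<Sum>m\<le>n. smult (c m * eigval n t f m) (p m))"
proof -
  let ?z = "joukowski x" and ?L = "linprod {1..n} (joukowski x)"
  define \<epsilon> where "\<epsilon> = (\<lambda>m. inverse t ^ m - 1 - f / t + f * t ^ m / t)"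
  have xnz: "x i \<noteq> 0" if "i \<in> {1..n}" for i using x that by (auto simp: weyl_regular_def)
  have zinj: "?z i \<noteq> ?z j" if "i \<in> {1..n}" "j \<in> {1..n}" "i \<noteq> j" for i j
    using joukowski_eq_iff[of "x i" "x j"] xnz that x(1) unfolding weyl_regular_def by blast
  have "op_poly n t e f x - (\<Sum>m\<le>n. smult (c m * eigval n t f m) (p m)) = 0"
  proof (rule poly_eq_0_if_roots)
    show "inj_on (\<lambda>i. - ?z i) {1..n}" using zinj unfolding inj_on_def by (metis neg_equal_iff_equal)
  next
    fix k assume k: "n \<le> k"
    have "coeff (op_poly n t e f x) k = 0"
      unfolding op_poly_def coeff_sum coeff_smult
      by (intro sum.neutral ballI mult_eq_0_iff[THEN iffD2] disjI2 coeff_linprod_eq_0) (use k in auto)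
    moreover have "coeff (\<Sum>m\<le>n. smult (c m * eigval n t f m) (p m)) k = 0"
      unfolding coeff_sum coeff_smult
    proof (intro sum.neutral ballI)
      fix m assume "m \<in> {..n}"
      thus "c m * eigval n t f m * coeff (p m) k = 0"
        using k monic_seqD(3)[OF p, of m k] by (cases "m = n") (auto simp: eigval_def)
    qed
    ultimately show "coeff (op_poly n t e f x - (\<Sum>m\<le>n. smult (c m * eigval n t f m) (p m))) k = 0"
      by (simp only: coeff_diff diff_self)
  next
    fix k assume k: "k \<in> {1..n}"
    \<comment> \<open>With this sign \<open>?y + inverse ?y\<close> is \<open>- ?z k\<close>, the
      zero of factor \<open>k\<close> of \<Phi>; the sign is harmless in \<open>aw_coeff\<close>,
      which is even.\<close>
    let ?A = "{1..n} - {k}" and ?y = "- x k"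
    have xk: "x k \<noteq> 0" "(x k) ^ 2 \<noteq> 1" "t * (x k) ^ 2 \<noteq> 1" "(x k) ^ 2 \<noteq> t"
      using x k by (auto simp: weyl_regular_def)
    let ?pr = "\<Prod>j\<in>?A. ?z j - ?z k"
    have op: "poly (op_poly n t e f x) (- ?z k) = (weight n t e f x k (x k) + weight n t e f x k (inverse (x k))) * ?pr"
    proof -
      have "poly (op_poly n t e f x) (- ?z k) = (\<Sum>i=1..n. (weight n t e f x i (x i) + weight n t e f x i (inverse (x i))) *
         poly (linprod ({1..n} - {i}) ?z) (- ?z k))"
        unfolding op_poly_def poly_sum poly_smult ..
      also have "\<dots> = (weight n t e f x k (x k) + weight n t e f x k (inverse (x k))) * poly (linprod ?A ?z) (- ?z k)
          + (\<Sum>i\<in>?A. (weight n t e f x i (x i) + weight n t e f x i (inverse (x i))) *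
         poly (linprod ({1..n} - {i}) ?z) (- ?z k))"
        by (rule sum.remove) (use k in auto)
      also have "(\<Sum>i\<in>?A. (weight n t e f x i (x i) + weight n t e f x i (inverse (x i))) *
         poly (linprod ({1..n} - {i}) ?z) (- ?z k)) = 0"
      proof (intro sum.neutral ballI)
        fix i assume i: "i \<in> ?A"
        have "poly (linprod ({1..n} - {i}) ?z) (- ?z k) = 0"
          unfolding poly_linprod
        proof (rule prod_zero)
          show "\<exists>j\<in>{1..n} - {i}. ?z j + - ?z k = 0" by (rule bexI[of _ k]) (use i k in auto)
        qed simp
        thus "(weight n t e f x i (x i) + weight n t e f x i (inverse (x i))) *
         poly (linprod ({1..n} - {i}) ?z) (- ?z k) = 0" by (simp only: mult_zero_right)
      qed
      finally show ?thesis by (simp only: poly_linprod add_0_right diff_conv_add_uminus)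
    qed
    have w1: "weight n t e f x k (x k) * ?pr = - (t ^ n) / (1 - t) * (aw_coeff t e f (x k) * poly ?L (- (t * x k + inverse (t * x k))))"
      by (rule weight_node) (use t k xk xnz zinj in auto)
    have w2: "weight n t e f x k (inverse (x k)) * ?pr = - (t ^ n) / (1 - t) *
        (aw_coeff t e f (inverse (x k)) * poly ?L (- (t * inverse (x k) + inverse (t * inverse (x k)))))"
      by (rule weight_node) (use t k xk xnz zinj in \<open>auto simp: field_simps\<close>)
    have L0: "poly ?L (- ?z k) = 0"
      unfolding poly_linprod
    proof (rule prod_zero)
      show "\<exists>j\<in>{1..n}. ?z j + - ?z k = 0" by (rule bexI[of _ k]) (use k in auto)
    qed simp
    have aw_even: "aw_coeff t e f (- u) = aw_coeff t e f u" for u by (simp add: aw_coeff_def)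
    have arg: "t * ?y + inverse (t * ?y) = - (t * x k + inverse (t * x k))"
      "?y / t + inverse (?y / t) = - (t * inverse (x k) + inverse (t * inverse (x k)))"
      "?y + inverse ?y = - ?z k" "inverse ?y = - inverse (x k)"
      by (simp_all add: divide_inverse algebra_simps)
    have eq: "aw_coeff t e f (x k) * (poly (p m) (- (t * x k + inverse (t * x k))) - poly (p m) (- ?z k))
        + aw_coeff t e f (inverse (x k)) * (poly (p m) (- (t * inverse (x k) + inverse (t * inverse (x k)))) - poly (p m) (- ?z k))
        = \<epsilon> m * poly (p m) (- ?z k)" if "m \<le> n" for m
    proof -
      have "?y \<noteq> 0 \<and> ?y ^ 2 \<noteq> 1 \<and> t * ?y ^ 2 \<noteq> 1 \<and> ?y ^ 2 \<noteq> t" using xk by simp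
      with aw[OF that, unfolded aw_eigenpoly_def, rule_format, of ?y]
      show ?thesis unfolding arg(1) arg(2) arg(3) unfolding arg(4) aw_even \<epsilon>_def by blast
    qed
    have polyL: "poly ?L Y = (\<Sum>m\<le>n. c m * poly (p m) Y)" for Y
      unfolding c by (simp add: poly_sum)
    have "aw_coeff t e f (x k) * poly ?L (- (t * x k + inverse (t * x k)))
        + aw_coeff t e f (inverse (x k)) * poly ?L (- (t * inverse (x k) + inverse (t * inverse (x k))))
      = aw_coeff t e f (x k) * (poly ?L (- (t * x k + inverse (t * x k))) - poly ?L (- ?z k))
        + aw_coeff t e f (inverse (x k)) * (poly ?L (- (t * inverse (x k) + inverse (t * inverse (x k)))) - poly ?L (- ?z k))"
      unfolding L0 diff_zero ..
    also have "\<dots> = (\<Sum>m\<le>n. c m * (aw_coeff t e f (x k) * (poly (p m) (- (t * x k + inverse (t * x k))) - poly (p m) (- ?z k))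
        + aw_coeff t e f (inverse (x k)) * (poly (p m) (- (t * inverse (x k) + inverse (t * inverse (x k)))) - poly (p m) (- ?z k))))"
      unfolding polyL sum_subtractf[symmetric] sum_distrib_left sum.distrib[symmetric]
      by (intro sum.cong refl) (simp only: algebra_simps)
    also have "\<dots> = (\<Sum>m\<le>n. c m * (\<epsilon> m * poly (p m) (- ?z k)))"
      by (intro sum.cong refl arg_cong2[of _ _ _ _ "(*)"] eq) simp
    \<comment> \<open>\<Phi> vanishes at the node, so any multiple of it may be subtracted. The
      multiple \<open>\<epsilon> n\<close> removes the term with \<open>p n\<close>, which brings
      the right-hand side to degree less than \<open>n\<close>.\<close>
    also have "\<dots> = (\<Sum>m\<le>n. c m * (\<epsilon> m * poly (p m) (- ?z k))) - \<epsilon> n * poly ?L (- ?z k)"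
      by (simp only: L0 mult_zero_right diff_zero)
    also have "\<dots> = (\<Sum>m\<le>n. c m * (\<epsilon> m - \<epsilon> n) * poly (p m) (- ?z k))"
      unfolding polyL by (simp only: sum_distrib_left sum_subtractf[symmetric] algebra_simps)
    finally have main: "aw_coeff t e f (x k) * poly ?L (- (t * x k + inverse (t * x k)))
        + aw_coeff t e f (inverse (x k)) * poly ?L (- (t * inverse (x k) + inverse (t * inverse (x k))))
        = (\<Sum>m\<le>n. c m * (\<epsilon> m - \<epsilon> n) * poly (p m) (- ?z k))" .
    have "poly (op_poly n t e f x) (- ?z k) = - (t ^ n) / (1 - t) * (\<Sum>m\<le>n. c m * (\<epsilon> m - \<epsilon> n) * poly (p m) (- ?z k))"
      unfolding op distrib_right w1 w2 distrib_left[symmetric] main ..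
    also have "\<dots> = (\<Sum>m\<le>n. c m * (- (t ^ n) / (1 - t) * (\<epsilon> m - \<epsilon> n)) * poly (p m) (- ?z k))"
      unfolding sum_distrib_left by (intro sum.cong refl) (simp only: mult_ac)
    also have "\<dots> = (\<Sum>m\<le>n. c m * eigval n t f m * poly (p m) (- ?z k))"
      by (intro sum.cong refl) (use eigval_aw[OF t _ n] in \<open>auto simp: \<epsilon>_def\<close>)
    also have "\<dots> = poly (\<Sum>m\<le>n. smult (c m * eigval n t f m) (p m)) (- ?z k)"
      by (simp add: poly_sum)
    finally show "poly (op_poly n t e f x - (\<Sum>m\<le>n. smult (c m * eigval n t f m) (p m))) (- ?z k) = 0"
      by (simp only: poly_diff diff_self)
  qed
  thus ?thesis by simp
qed

lemma tendsto_coeff_linprod: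
  assumes "finite A" "\<And>i. i \<in> A \<Longrightarrow> ((\<lambda>s. z s i) \<longlongrightarrow> z0 i) F"
  shows "((\<lambda>s. coeff (linprod A (z s)) k) \<longlongrightarrow> coeff (linprod A z0) k) F"
  using assms
proof (induction A arbitrary: k rule: finite_induct)
  case (insert a A)
  have IH: "((\<lambda>s. coeff (linprod A (z s)) k) \<longlongrightarrow> coeff (linprod A z0) k) F" for k
    using insert by auto
  have eq: "coeff (linprod (insert a A) z) k =
     z a * coeff (linprod A z) k + (case k of 0 \<Rightarrow> 0 | Suc j \<Rightarrow> coeff (linprod A z) j)" for z
    using insert by (simp add: linprod_insert coeff_pCons split: nat.split)
  have "((\<lambda>s. (case k of 0 \<Rightarrow> 0 | Suc j \<Rightarrow> coeff (linprod A (z s)) j))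
      \<longlongrightarrow> (case k of 0 \<Rightarrow> 0 | Suc j \<Rightarrow> coeff (linprod A z0) j)) F"
    by (cases k) (auto intro: IH)
  thus ?case unfolding eq by (intro tendsto_intros IH insert.prems) auto
qed (simp add: linprod_def)

lemma tendsto_weight:
  assumes u: "(u \<longlongrightarrow> u0) F" "u0 \<noteq> 0" "u0 ^ 2 \<noteq> 1"
    and X: "\<And>j. j \<in> {1..n} \<Longrightarrow> ((\<lambda>s. X s j) \<longlongrightarrow> x j) F"
    and x: "\<And>j. j \<in> {1..n} \<Longrightarrow> x j \<noteq> 0"
    and nz: "\<And>j. j \<in> {1..n} - {i} \<Longrightarrow> u0 * x j \<noteq> 1 \<and> u0 \<noteq> x j"
  shows "((\<lambda>s. weight n t e f (X s) i (u s)) \<longlongrightarrow> weight n t e f x i u0) F"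
  unfolding weight_def
proof (intro tendsto_mult tendsto_prod tendsto_divide)
  fix j assume j: "j \<in> {1..n} - {i}"
  show "(1 - u0 * x j) * (1 - u0 / x j) \<noteq> 0" using nz[OF j] x[of j] j by auto
  show "((\<lambda>s. 1 - t * u s * X s j) \<longlongrightarrow> 1 - t * u0 * x j) F"
    "((\<lambda>s. 1 - t * u s / X s j) \<longlongrightarrow> 1 - t * u0 / x j) F"
    "((\<lambda>s. 1 - u s * X s j) \<longlongrightarrow> 1 - u0 * x j) F"
    "((\<lambda>s. 1 - u s / X s j) \<longlongrightarrow> 1 - u0 / x j) F"
    using X[of j] x[of j] j by (auto intro!: tendsto_intros u(1))
qed (use u in \<open>auto intro!: tendsto_intros\<close>)

lemma weyl_regular_conds:
  assumes "weyl_regular n x" "i \<in> {1..n}"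
  shows "x i \<noteq> 0" "(x i)\<^sup>2 \<noteq> 1" "inverse (x i) \<noteq> 0" "(inverse (x i))\<^sup>2 \<noteq> 1"
    "\<And>j. j \<in> {1..n} - {i} \<Longrightarrow> x i * x j \<noteq> 1 \<and> x i \<noteq> x j"
    "\<And>j. j \<in> {1..n} - {i} \<Longrightarrow> inverse (x i) * x j \<noteq> 1 \<and> inverse (x i) \<noteq> x j"
  using assms unfolding weyl_regular_def by (auto simp: field_simps)

text \<open>At the points excluded in \<open>op_poly_expand_generic\<close> the divided differences that define the
  Askey--Wilson operator degenerate; they are reached along a dilation of \<open>x\<close>.\<close>

lemma op_poly_expand:
  assumes t: "t \<noteq> 0" "t \<noteq> 1" and n: "n \<ge> 1" and p: "monic_seq p"
    and aw: "\<And>m. m \<le> n \<Longrightarrow> aw_eigenpoly t e f m (p m)"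
    and x: "weyl_regular n x"
  shows "coeff (op_poly n t e f x) j
    = (\<Sum>m\<le>n. diag_matrix p (eigval n t f) m j * coeff (linprod {1..n} (joukowski x)) m)"
proof -
  let ?R = "\<lambda>x. \<Sum>m\<le>n. diag_matrix p (eigval n t f) m j * coeff (linprod {1..n} (joukowski x)) m"
  have gen: "coeff (op_poly n t e f x) j = ?R x"
    if x: "weyl_regular n x" "\<forall>i\<in>{1..n}. t * (x i) ^ 2 \<noteq> 1 \<and> (x i) ^ 2 \<noteq> t" for x
  proof -
    let ?L = "linprod {1..n} (joukowski x)"
    have "?L = (\<Sum>m\<le>n. smult (\<Sum>k\<le>n. inv_coeffs p k m * coeff ?L k) (p m))"
      by (rule expand_inv_coeffs[OF p], rule coeff_linprod_eq_0) auto
    hence "op_poly n t e f x = (\<Sum>m\<le>n. smult ((\<Sum>k\<le>n. inv_coeffs p k m * coeff ?L k) * eigval n t f m) (p m))"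
      by (rule op_poly_expand_generic[OF t n p aw x(1), rotated 2]) (use x in auto)
    hence "coeff (op_poly n t e f x) j = (\<Sum>m\<le>n. \<Sum>k\<le>n. inv_coeffs p k m * coeff ?L k * eigval n t f m * coeff (p m) j)"
      by (simp add: coeff_sum sum_distrib_right)
    also have "\<dots> = (\<Sum>k\<le>n. (\<Sum>m\<le>n. inv_coeffs p k m * eigval n t f m * coeff (p m) j) * coeff ?L k)"
      by (subst sum.swap) (simp add: sum_distrib_left mult_ac)
    also have "\<dots> = ?R x" by (intro sum.cong refl) (simp add: diag_matrix_upto[OF p])
    finally show ?thesis .
  qed
  define X where "X = (\<lambda>s::complex. \<lambda>i. (1 + s) * x i)"
  have X: "((\<lambda>s. X s i) \<longlongrightarrow> x i) (at 0)" for i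
    unfolding X_def by (auto intro!: tendsto_eq_intros)
  note rc = weyl_regular_conds[OF x]
  have jX: "((\<lambda>s. joukowski (X s) i) \<longlongrightarrow> joukowski x i) (at 0)" if "i \<in> {1..n}" for i
    by (intro tendsto_intros X) (use rc that in auto)
  have L1: "((\<lambda>s. coeff (op_poly n t e f (X s)) j) \<longlongrightarrow> coeff (op_poly n t e f x) j) (at 0)"
    unfolding op_poly_def coeff_sum coeff_smult
    by (intro tendsto_sum tendsto_mult tendsto_add tendsto_weight tendsto_coeff_linprod tendsto_inverse X jX)
       (use rc in auto)
  have L2: "((\<lambda>s. ?R (X s)) \<longlongrightarrow> ?R x) (at 0)"
    by (intro tendsto_sum tendsto_mult tendsto_const tendsto_coeff_linprod jX) auto
  have ev: "\<forall>\<^sub>F s in at 0. coeff (op_poly n t e f (X s)) j = ?R (X s)"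
  proof -
    \<comment> \<open>A quadratic equation excludes at most two values of \<open>s\<close>, and
      \<open>at 0\<close> leaves out \<open>s = 0\<close>; the condition thus holds eventually even
      where it fails at the limit point.\<close>
    have neq: "\<forall>\<^sub>F s in at 0. c * (1 + s) ^ 2 \<noteq> d" if d: "d \<noteq> 0" for c d :: complex
    proof (cases "c = 0")
      case True thus ?thesis using d by auto
    next
      case False
      have "\<forall>\<^sub>F s in at 0. s \<noteq> a" for a :: complex by (rule eventually_neq_at_within)
      from this[of "csqrt (d / c) - 1"] this[of "- csqrt (d / c) - 1"] show ?thesis
      proof eventually_elim
        case (elim s)
        show ?case
        proof
          assume "c * (1 + s) ^ 2 = d"
          hence "(1 + s) ^ 2 = (csqrt (d / c)) ^ 2" using False by (simp add: field_simps)
          hence "1 + s = csqrt (d / c) \<or> 1 + s = - csqrt (d / c)" unfolding power2_eq_iff .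
          hence "s = csqrt (d / c) - 1 \<or> s = - csqrt (d / c) - 1" by (metis add_diff_cancel_left')
          thus False using elim by blast
        qed
      qed
    qed
    have a: "\<forall>\<^sub>F s in at 0. \<forall>i\<in>{1..n}. t * (X s i) ^ 2 \<noteq> 1 \<and> (X s i) ^ 2 \<noteq> t \<and> X s i \<noteq> 0 \<and> (X s i) ^ 2 \<noteq> 1"
    proof (intro eventually_ball_finite ballI eventually_conj)
      fix i assume i: "i \<in> {1..n}"
      show "\<forall>\<^sub>F s in at 0. t * (X s i) ^ 2 \<noteq> 1"
        using neq[of 1 "t * (x i) ^ 2"] by (simp add: X_def power_mult_distrib mult_ac)
      show "\<forall>\<^sub>F s in at 0. (X s i) ^ 2 \<noteq> t"
        using neq[of t "(x i) ^ 2"] t by (simp add: X_def power_mult_distrib mult_ac)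
      show "\<forall>\<^sub>F s in at 0. X s i \<noteq> 0" by (rule tendsto_imp_eventually_ne[OF X]) (use rc i in auto)
      show "\<forall>\<^sub>F s in at 0. (X s i) ^ 2 \<noteq> 1"
        using neq[of 1 "(x i) ^ 2"] by (simp add: X_def power_mult_distrib mult_ac)
    qed auto
    have b: "\<forall>\<^sub>F s in at 0. \<forall>i\<in>{1..n}. \<forall>j\<in>{1..n}. i \<noteq> j \<longrightarrow> X s i * X s j \<noteq> 1 \<and> X s i \<noteq> X s j"
    proof (intro eventually_ball_finite ballI)
      fix i j assume ij: "i \<in> {1..n}" "j \<in> {1..n}"
      show "\<forall>\<^sub>F s in at 0. i \<noteq> j \<longrightarrow> X s i * X s j \<noteq> 1 \<and> X s i \<noteq> X s j"
      proof (cases "i = j")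
        case False
        have "\<forall>\<^sub>F s in at 0. X s i * X s j \<noteq> 1"
          by (rule tendsto_imp_eventually_ne[OF tendsto_mult[OF X X]]) (use rc ij False in auto)
        moreover have "\<forall>\<^sub>F s in at 0. X s i - X s j \<noteq> 0"
          by (rule tendsto_imp_eventually_ne[OF tendsto_diff[OF X X]]) (use rc ij False in auto)
        ultimately show ?thesis by eventually_elim auto
      qed auto
    qed auto
    from a b show ?thesis
    proof eventually_elim
      case (elim s)
      show ?case by (rule gen) (use elim in \<open>auto simp: weyl_regular_def\<close>)
    qed
  qed
  show ?thesis by (rule tendsto_unique[OF _ Lim_transform_eventually[OF L1 ev] L2]) simp
qed

text \<open>The properties of the operator matrix from which \<open>koornwinder_column\<close>
  follows, separated from \<open>diag_matrix\<close> so that parameters without an explicit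
  eigenbasis are covered.\<close>

definition represents :: "nat \<Rightarrow> complex \<Rightarrow> complex \<Rightarrow> complex \<Rightarrow> (nat \<Rightarrow> nat \<Rightarrow> complex) \<Rightarrow> bool" where
  "represents n t e f l \<longleftrightarrow> (\<forall>m k. m < k \<longrightarrow> l m k = 0) \<and> (\<forall>m. l m m = eigval n t f m) \<and>
     (\<forall>x k. weyl_regular n x \<longrightarrow> coeff (op_poly n t e f x) k = (\<Sum>m\<le>n. l m k * coeff (linprod {1..n} (joukowski x)) m))"

lemma represents_diag_matrix:
  assumes "t \<noteq> 0" "t \<noteq> 1" "n \<ge> 1" and p: "monic_seq p"
    and "\<And>m. m \<le> n \<Longrightarrow> aw_eigenpoly t e f m (p m)"
  shows "represents n t e f (diag_matrix p (eigval n t f))"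
  unfolding represents_def
  using diag_matrix_tri[OF p] diag_matrix_diag[OF p] op_poly_expand[OF assms] by blast

text \<open>Both \<open>weight\<close> and \<open>eigval\<close> are affine in
  \<open>(e, f)\<close>; weights with sum 1 reproduce the constant terms.\<close>

lemma represents_affine:
  assumes r: "represents n t e1 f1 l1" "represents n t e2 f2 l2" "represents n t e3 f3 l3"
    and abc: "a + b + c = 1" "e = a * e1 + b * e2 + c * e3" "f = a * f1 + b * f2 + c * f3"
  shows "represents n t e f (\<lambda>m k. a * l1 m k + b * l2 m k + c * l3 m k)"
proof -
  have w: "weight n t e f x i u = a * weight n t e1 f1 x i u + b * weight n t e2 f2 x i u + c * weight n t e3 f3 x i u"
    for x i u
  proof -
    have "1 - e * u ^ 2 + f * u ^ 4 = (a + b + c) - e * u ^ 2 + f * u ^ 4" by (simp only: abc(1))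
    also have "\<dots> = a * (1 - e1 * u ^ 2 + f1 * u ^ 4) + b * (1 - e2 * u ^ 2 + f2 * u ^ 4) + c * (1 - e3 * u ^ 2 + f3 * u ^ 4)"
      unfolding abc(2,3) by (simp only: algebra_simps mult_1 mult_1_right)
    finally show ?thesis unfolding weight_def by (simp only: divide_inverse distrib_right mult.assoc)
  qed
  have ev: "eigval n t f m = a * eigval n t f1 m + b * eigval n t f2 m + c * eigval n t f3 m" for m
  proof -
    let ?g = "\<lambda>f. 1 - t ^ (n - m) - f * t ^ (n - 1) * (t ^ m - t ^ n)"
    have "?g f = (a + b + c) * (1 - t ^ (n - m)) - f * t ^ (n - 1) * (t ^ m - t ^ n)" by (simp only: abc(1) mult_1)
    also have "\<dots> = a * ?g f1 + b * ?g f2 + c * ?g f3"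
      unfolding abc(3) by (simp only: algebra_simps mult_1 mult_1_right)
    finally show ?thesis unfolding eigval_def by (simp only: add_divide_distrib times_divide_eq_right)
  qed
  have op: "coeff (op_poly n t e f x) k = a * coeff (op_poly n t e1 f1 x) k + b * coeff (op_poly n t e2 f2 x) k
      + c * coeff (op_poly n t e3 f3 x) k" for x k
    unfolding op_poly_def coeff_sum coeff_smult w sum_distrib_left sum.distrib[symmetric]
    by (intro sum.cong refl) (simp only: algebra_simps)
  show ?thesis unfolding represents_def
  proof (intro conjI allI impI)
    fix x k assume "weyl_regular n x"
    thus "coeff (op_poly n t e f x) k = (\<Sum>m\<le>n. (a * l1 m k + b * l2 m k + c * l3 m k) * coeff (linprod {1..n} (joukowski x)) m)"
      using r unfolding represents_def op
      by (simp add: sum_distrib_left sum.distrib algebra_simps)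
  qed (use r in \<open>auto simp: represents_def ev\<close>)
qed

text \<open>Independence on regular points makes the eigenvalue equation equivalent to a linear
  system for the coefficient vector. Triangularity and distinct eigenvalues leave exactly one
  solution with leading entry 1, which resolves the definite description.\<close>

lemma koornwinder_column:
  assumes rep: "represents n t e f l" and i: "i \<le> n" 
    and dist: "\<And>m. i < m \<Longrightarrow> m \<le> n \<Longrightarrow> eigval n t f m \<noteq> eigval n t f i"
    and q: "q \<noteq> 0" "q \<noteq> 1" and t: "t \<noteq> 0" "t \<noteq> 1"
    and par: "\<And>u. (1 - a * u) * (1 - b * u) * (1 - c * u) * (1 - d * u) = 1 - e * u ^ 2 + f * u ^ 4"
    and \<alpha>: "koornwinder_alpha a b c d q ^ 2 * q = f" "koornwinder_alpha a b c d q \<noteq> 0"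
  shows "koornwinder n (column (n - i)) a b c d q t
    = (\<lambda>x. \<Sum>k\<le>n. tri_eigvec l i k * coeff (linprod {1..n} (joukowski x)) k)"
proof -
  let ?C = "\<lambda>x. coeff (linprod {1..n} (joukowski x))"
  let ?P = "\<lambda>v x. \<Sum>k\<le>n. v k * ?C x k"
  define K where "K = (1 - q) / (q * koornwinder_alpha a b c d q * t ^ (n - 1))"
  have K: "K \<noteq> 0" using q t \<alpha> by (simp add: K_def)
  have l: "\<And>m k. m < k \<Longrightarrow> l m k = 0" "\<And>m. l m m = eigval n t f m"
    and op: "\<And>x k. weyl_regular n x \<Longrightarrow> coeff (op_poly n t e f x) k = (\<Sum>m\<le>n. l m k * ?C x m)"
    using rep unfolding represents_def by blast+
  have ev: "koornwinder_eigenvalue n a b c d q t (column (n - i)) = K * l i i"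
    using koornwinder_eigenvalue_column[of "n - i" n q t a b c d f] i q t \<alpha> by (simp add: l K_def)
  have eigen_iff: "(\<forall>x. regular_point n q x \<longrightarrow>
        koornwinder_op n a b c d q t (?P v) x = koornwinder_eigenvalue n a b c d q t (column (n - i)) * ?P v x)
    \<longleftrightarrow> (\<forall>m\<le>n. (\<Sum>k\<le>n. l m k * v k) = l i i * v m)" (is "?lhs \<longleftrightarrow> ?rhs") for v
  proof -
    have eq: "koornwinder_op n a b c d q t (?P v) x - koornwinder_eigenvalue n a b c d q t (column (n - i)) * ?P v x
      = K * (\<Sum>m\<le>n. ((\<Sum>k\<le>n. l m k * v k) - l i i * v m) * ?C x m)" if x: "regular_point n q x" for x
    proof -
      have "koornwinder_op n a b c d q t (?P v) x = K * (\<Sum>k\<le>n. v k * (\<Sum>m\<le>n. l m k * ?C x m))"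
        unfolding koornwinder_op_linprod[OF x q par] K_def op[OF regular_point_weyl_regular[OF x]] ..
      also have "(\<Sum>k\<le>n. v k * (\<Sum>m\<le>n. l m k * ?C x m)) = (\<Sum>m\<le>n. (\<Sum>k\<le>n. l m k * v k) * ?C x m)"
        unfolding sum_distrib_left sum_distrib_right by (subst sum.swap) (simp add: mult_ac)
      finally show ?thesis unfolding ev
        by (simp add: left_diff_distrib sum_subtractf right_diff_distrib sum_distrib_left mult_ac)
    qed
    show ?thesis
    proof
      assume L: ?lhs
      have "(\<Sum>k\<le>n. l m k * v k) - l i i * v m = 0" if "m \<le> n" for m
      proof (rule linprod_coeffs_independent[OF q(1) _ that])
        fix x assume x: "regular_point n q x"
        have "K * (\<Sum>m\<le>n. ((\<Sum>k\<le>n. l m k * v k) - l i i * v m) * ?C x m) = 0"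
          unfolding eq[OF x, symmetric] using L x by simp
        thus "(\<Sum>m\<le>n. ((\<Sum>k\<le>n. l m k * v k) - l i i * v m) * ?C x m) = 0" using K by simp
      qed
      thus ?rhs by simp
    next
      assume R: ?rhs
      show ?lhs
      proof (intro allI impI)
        fix x assume x: "regular_point n q x"
        have "(\<Sum>m\<le>n. ((\<Sum>k\<le>n. l m k * v k) - l i i * v m) * ?C x m) = 0"
          using R by (intro sum.neutral) auto
        with eq[OF x] show "koornwinder_op n a b c d q t (?P v) x
            = koornwinder_eigenvalue n a b c d q t (column (n - i)) * ?P v x" by simp
      qed
    qed
  qed
  \<comment> \<open>Index \<open>k\<close> stands for the column of length \<open>n - k\<close>, so
    the dominated columns are the indices above \<open>i\<close>.\<close>
  have form: "(\<exists>u. P = (\<lambda>x. msym n (column (n - i)) x + (\<Sum>\<mu>\<in>strictly_dominated n (column (n - i)). u \<mu> * msym n \<mu> x)))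
     \<longleftrightarrow> (\<exists>v. v i = 1 \<and> (\<forall>k<i. v k = 0) \<and> P = ?P v)" for P
  proof -
    have dom: "(\<Sum>\<mu>\<in>strictly_dominated n (column (n - i)). u \<mu> * msym n \<mu> x)
       = (\<Sum>k\<in>{i<..n}. u (column (n - k)) * ?C x k)" for u x
    proof -
      have "(\<Sum>\<mu>\<in>strictly_dominated n (column (n - i)). u \<mu> * msym n \<mu> x)
          = (\<Sum>s<n - i. u (column s) * msym n (column s) x)"
        unfolding strictly_dominated_column[OF diff_le_self]
        by (subst sum.reindex) (auto intro: inj_onI column_inj)
      also have "\<dots> = (\<Sum>s<n - i. u (column s) * ?C x (n - s))"
        by (intro sum.cong refl) (simp add: msym_column)
      also have "\<dots> = (\<Sum>k\<in>{i<..n}. u (column (n - k)) * ?C x k)"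
        by (rule sum.reindex_bij_witness[of _ "\<lambda>k. n - k" "\<lambda>k. n - k"]) auto
      finally show ?thesis .
    qed
    have split: "?P v x = ?C x i + (\<Sum>k\<in>{i<..n}. v k * ?C x k)" if "v i = 1" "\<forall>k<i. v k = 0" for v x
    proof -
      have "?P v x = (\<Sum>k\<in>{i..n}. v k * ?C x k)"
        by (rule sum.mono_neutral_right) (use that in auto)
      also have "{i..n} = insert i {i<..n}" using i by auto
      finally show ?thesis using that by simp
    qed
    have lead: "msym n (column (n - i)) x = ?C x i" for x using msym_column[of "n - i" n x] i by simp
    show ?thesis
    proof
      assume "\<exists>u. P = (\<lambda>x. msym n (column (n - i)) x + (\<Sum>\<mu>\<in>strictly_dominated n (column (n - i)). u \<mu> * msym n \<mu> x))"
      then obtain u where u: "P = (\<lambda>x. ?C x i + (\<Sum>k\<in>{i<..n}. u (column (n - k)) * ?C x k))"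
        unfolding dom lead by blast
      let ?v = "\<lambda>k. if k < i then 0 else if k = i then 1 else u (column (n - k))"
      have "P = ?P ?v"
      proof
        fix x
        have "?P ?v x = ?C x i + (\<Sum>k\<in>{i<..n}. ?v k * ?C x k)" by (rule split) auto
        also have "(\<Sum>k\<in>{i<..n}. ?v k * ?C x k) = (\<Sum>k\<in>{i<..n}. u (column (n - k)) * ?C x k)"
          by (rule sum.cong) auto
        finally show "P x = ?P ?v x" by (simp only: u)
      qed
      thus "\<exists>v. v i = 1 \<and> (\<forall>k<i. v k = 0) \<and> P = ?P v" by (intro exI[of _ ?v]) simp
    next
      assume "\<exists>v. v i = 1 \<and> (\<forall>k<i. v k = 0) \<and> P = ?P v"
      then obtain v where v: "v i = 1" "\<forall>k<i. v k = 0" "P = ?P v" by blast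
      define u where "u = (\<lambda>\<mu>. v (n - (THE s. \<mu> = column s)))"
      have u: "u (column s) = v (n - s)" for s
        unfolding u_def by (rule arg_cong[of _ _ "\<lambda>s. v (n - s)"]) (auto dest: column_inj)
      have "P = (\<lambda>x. msym n (column (n - i)) x + (\<Sum>\<mu>\<in>strictly_dominated n (column (n - i)). u \<mu> * msym n \<mu> x))"
        unfolding v(3) dom lead split[OF v(1,2)] u by (intro ext arg_cong2[of _ _ _ _ "(+)"] sum.cong) auto
      thus "\<exists>u. P = (\<lambda>x. msym n (column (n - i)) x + (\<Sum>\<mu>\<in>strictly_dominated n (column (n - i)). u \<mu> * msym n \<mu> x))"
        by blast
    qed
  qed
  have dist': "\<And>m. i < m \<Longrightarrow> m \<le> n \<Longrightarrow> l m m \<noteq> l i i" using dist by (simp add: l)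
  have iff: "is_koornwinder n (column (n - i)) a b c d q t P \<longleftrightarrow> P = ?P (tri_eigvec l i)" for P
  proof
    assume "is_koornwinder n (column (n - i)) a b c d q t P"
    then obtain v where v: "v i = 1" "\<forall>k<i. v k = 0" "P = ?P v"
      and eig: "\<forall>m\<le>n. (\<Sum>k\<le>n. l m k * v k) = l i i * v m"
      unfolding is_koornwinder_def form using eigen_iff by blast
    have "v m = tri_eigvec l i m" if "m \<le> n" for m
      by (rule tri_eigvec_unique[where n = n]) (use v eig dist' l that in auto)
    thus "P = ?P (tri_eigvec l i)" unfolding v(3) by simp
  next
    assume P: "P = ?P (tri_eigvec l i)"
    have "\<forall>m\<le>n. (\<Sum>k\<le>n. l m k * tri_eigvec l i k) = l i i * tri_eigvec l i m"
      by (intro allI impI tri_eigvec_eigen) (use l dist' in auto)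
    thus "is_koornwinder n (column (n - i)) a b c d q t P"
      unfolding is_koornwinder_def form P using eigen_iff[of "tri_eigvec l i"]
      by (intro conjI exI[of _ "tri_eigvec l i"]) (auto simp: tri_eigvec_below tri_eigvec_diag)
  qed
  show ?thesis unfolding koornwinder_def iff by (rule the_equality) auto
qed

subsection \<open>Four families of Askey--Wilson polynomials\<close>

fun cheb_U :: "nat \<Rightarrow> complex poly" where
  "cheb_U 0 = 1"
| "cheb_U (Suc 0) = [:0, 1:]"
| "cheb_U (Suc (Suc m)) = [:0, 1:] * cheb_U (Suc m) - cheb_U m"

text \<open>For \<open>m > 0\<close> the value at y + 1/y is y^m + y^(-m), but monicity makes the
  value at \<open>m = 0\<close> equal to 1 and not 2. The recursion through \<open>cheb_U\<close> is
  the form used later for connection coefficients.\<close>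

fun cheb_T :: "nat \<Rightarrow> complex poly" where
  "cheb_T 0 = 1"
| "cheb_T (Suc 0) = [:0, 1:]"
| "cheb_T (Suc (Suc m)) = cheb_U (Suc (Suc m)) - cheb_U m"

lemma monic_seqI:
  assumes "\<And>m. coeff (p m) m = 1" "\<And>m k. m < k \<Longrightarrow> coeff (p m) k = 0"
  shows "monic_seq p"
  unfolding monic_seq_def
proof (intro allI conjI)
  fix m show "degree (p m) = m"
    by (rule antisym[OF degree_le le_degree]) (use assms in auto)
qed (rule assms)

lemma cheb_U_coeffs: "coeff (cheb_U m) m = 1 \<and> (\<forall>k>m. coeff (cheb_U m) k = 0)"
proof (induction m rule: cheb_U.induct)
  case (3 m)
  have "coeff (cheb_U (Suc (Suc m))) (Suc k) = coeff (cheb_U (Suc m)) k - coeff (cheb_U m) (Suc k)" for k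
    by (simp add: coeff_pCons)
  moreover have "\<exists>j. k = Suc j" if "k > Suc (Suc m)" for k using that by (cases k) auto
  ultimately show ?case using 3 by (metis Suc_lessD Suc_less_eq diff_zero lessI)
qed (auto simp: coeff_pCons split: nat.splits)

lemma monic_seq_cheb_U: "monic_seq cheb_U"
  by (rule monic_seqI) (auto simp: cheb_U_coeffs)

lemma cheb_T_coeffs: "coeff (cheb_T m) m = 1 \<and> (\<forall>k>m. coeff (cheb_T m) k = 0)"
proof (induction m rule: cheb_T.induct)
  case (3 m)
  show ?case using cheb_U_coeffs[of "Suc (Suc m)"] cheb_U_coeffs[of m] by (simp del: cheb_U.simps)
qed (auto simp: coeff_pCons split: nat.splits)

lemma monic_seq_cheb_T: "monic_seq cheb_T"
  by (rule monic_seqI) (auto simp: cheb_T_coeffs)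

lemma poly_cheb_U:
  fixes y :: complex
  assumes "y \<noteq> 0"
  shows "(y - inverse y) * poly (cheb_U m) (y + inverse y) = y ^ Suc m - inverse y ^ Suc m"
proof (induction m rule: cheb_U.induct)
  case (3 m)
  have "(y - inverse y) * poly (cheb_U (Suc (Suc m))) (y + inverse y)
     = (y + inverse y) * ((y - inverse y) * poly (cheb_U (Suc m)) (y + inverse y))
       - (y - inverse y) * poly (cheb_U m) (y + inverse y)"
    by (simp add: algebra_simps)
  also have "\<dots> = y ^ Suc (Suc (Suc m)) - inverse y ^ Suc (Suc (Suc m))"
    unfolding 3 using assms by (simp add: field_simps)
  finally show ?case .
qed (use assms in \<open>simp_all add: field_simps power2_eq_square\<close>)

lemma poly_cheb_T:
  fixes y :: complex
  assumes "y \<noteq> 0"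
  shows "poly (cheb_T (Suc m)) (y + inverse y) = y ^ Suc m + inverse y ^ Suc m"
proof -
  have U: "poly (cheb_U (Suc (Suc m))) (y + inverse y) - poly (cheb_U m) (y + inverse y)
     = y ^ Suc (Suc m) + inverse y ^ Suc (Suc m)" for m
  proof (induction m rule: cheb_U.induct)
    case 1 show ?case using assms by (simp add: field_simps power2_eq_square)
  next
    case 2 show ?case using assms by (simp add: field_simps power2_eq_square power3_eq_cube)
  next
    case (3 m)
    let ?U = "\<lambda>m. poly (cheb_U m) (y + inverse y)"
    have step: "?U (Suc (Suc m)) = (y + inverse y) * ?U (Suc m) - ?U m" for m by simp
    have "?U (Suc (Suc (Suc (Suc m)))) - ?U (Suc (Suc m))
       = (y + inverse y) * (?U (Suc (Suc (Suc m))) - ?U (Suc m)) - (?U (Suc (Suc m)) - ?U m)"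
      unfolding step[of "Suc (Suc m)"] step[of m] by (simp only: algebra_simps)
    also have "\<dots> = y ^ Suc (Suc (Suc (Suc m))) + inverse y ^ Suc (Suc (Suc (Suc m)))"
      unfolding 3 using assms by (simp add: field_simps)
    finally show ?case .
  qed
  show ?thesis using U by (cases m) auto
qed

text \<open>At the parameters 1, -1, sqrt t, -sqrt t the numerator of \<open>aw_coeff\<close> equals
  its denominator. The operator becomes a plain second difference, and y^m + y^(-m) has eigenvalue
  t^m + t^(-m) - 2.\<close>

lemma aw_eigenpoly_cheb_T:
  assumes t: "t \<noteq> 0"
  shows "aw_eigenpoly t (1 + t) t m (cheb_T m)"
  unfolding aw_eigenpoly_def
proof (intro allI impI, elim conjE)
  fix y :: complex
  assume y: "y \<noteq> 0" "y ^ 2 \<noteq> 1" "t * y ^ 2 \<noteq> 1" "y ^ 2 \<noteq> t"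
  have A: "aw_coeff t (1 + t) t u = 1" if "u ^ 2 \<noteq> 1" "t * u ^ 2 \<noteq> 1" for u
  proof -
    have "1 - (1 + t) * u ^ 2 + t * u ^ 4 = (1 - u ^ 2) * (1 - t * u ^ 2)"
      by (simp add: algebra_simps power2_eq_square power4_eq_xxxx)
    thus ?thesis using that by (simp add: aw_coeff_def)
  qed
  have A1: "aw_coeff t (1 + t) t y = 1" "aw_coeff t (1 + t) t (inverse y) = 1"
    by (rule A; use y in \<open>simp add: field_simps\<close>)+
  show "aw_coeff t (1 + t) t y * (poly (cheb_T m) (t * y + inverse (t * y)) - poly (cheb_T m) (y + inverse y))
     + aw_coeff t (1 + t) t (inverse y) * (poly (cheb_T m) (y / t + inverse (y / t)) - poly (cheb_T m) (y + inverse y))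
     = (inverse t ^ m - 1 - t / t + t * t ^ m / t) * poly (cheb_T m) (y + inverse y)"
  proof (cases m)
    case (Suc k)
    show ?thesis unfolding A1 Suc using t y
      by (subst poly_cheb_T, simp)+ (simp add: field_simps)
  qed (simp add: t)
qed

text \<open>Here A(y) = (1 - t^2 y^2) / (1 - y^2) is \<open>t\<close> times the quotient of y - 1/y
  at t y and at y, so multiplication by y - 1/y makes the coefficients of the shifts constant.
  Moreover A(y) + A(1/y) = 1 + t^2, and the numerator y^(m+1) - y^(-m-1) is an
  eigenfunction.\<close>

lemma aw_eigenpoly_cheb_U:
  assumes t: "t \<noteq> 0"
  shows "aw_eigenpoly t (t + t ^ 2) (t ^ 3) m (cheb_U m)"
  unfolding aw_eigenpoly_def
proof (intro allI impI, elim conjE)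
  fix y :: complex
  assume y: "y \<noteq> 0" "y ^ 2 \<noteq> 1" "t * y ^ 2 \<noteq> 1" "y ^ 2 \<noteq> t"
  let ?U = "\<lambda>w. poly (cheb_U m) (w + inverse w)"
  have A: "aw_coeff t (t + t ^ 2) (t ^ 3) u = (1 - t ^ 2 * u ^ 2) / (1 - u ^ 2)" if "t * u ^ 2 \<noteq> 1" for u
  proof -
    have "1 - (t + t ^ 2) * u ^ 2 + t ^ 3 * u ^ 4 = (1 - t ^ 2 * u ^ 2) * (1 - t * u ^ 2)"
      by (simp add: algebra_simps power2_eq_square power4_eq_xxxx power3_eq_cube)
    thus ?thesis using that by (simp add: aw_coeff_def)
  qed
  have A1: "aw_coeff t (t + t ^ 2) (t ^ 3) y = (1 - t ^ 2 * y ^ 2) / (1 - y ^ 2)"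
    by (rule A) (use y in simp)
  have A2: "aw_coeff t (t + t ^ 2) (t ^ 3) (inverse y) = (1 - t ^ 2 * (inverse y) ^ 2) / (1 - (inverse y) ^ 2)"
    by (rule A) (use y in \<open>simp add: field_simps\<close>)
  have nz: "1 - y ^ 2 \<noteq> 0" "1 - (inverse y) ^ 2 \<noteq> 0" using y by (auto simp: field_simps)
  define a where "a = y ^ Suc m"
  define b where "b = inverse y ^ Suc m"
  define s where "s = t ^ Suc m"
  define r where "r = inverse t ^ Suc m"
  have U0: "(1 - y ^ 2) * ?U y = - y * (a - b)"
    using poly_cheb_U[OF y(1), of m] y unfolding a_def b_def
    by (simp add: field_simps power2_eq_square)
  have U1: "(1 - t ^ 2 * y ^ 2) * ?U (t * y) = - (t * y) * (s * a - r * b)"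
  proof -
    have "t * y \<noteq> 0" using t y by simp
    from poly_cheb_U[OF this, of m] have "(t * y - inverse (t * y)) * ?U (t * y) = s * a - r * b"
      by (simp only: power_mult_distrib inverse_mult_distrib a_def b_def s_def r_def)
    hence "- (t * y) * (s * a - r * b) = - (t * y) * (t * y - inverse (t * y)) * ?U (t * y)"
      by simp
    also have "- (t * y) * (t * y - inverse (t * y)) = 1 - t ^ 2 * y ^ 2"
      using t y by (simp add: field_simps power2_eq_square)
    finally show ?thesis by simp
  qed
  have U2: "(1 - t ^ 2 * (inverse y) ^ 2) * ?U (y / t) = (t / y) * (r * a - s * b)"
  proof -
    have "y / t \<noteq> 0" using t y by simp
    from poly_cheb_U[OF this, of m] have "(y / t - inverse (y / t)) * ?U (y / t) = r * a - s * b"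
      by (simp only: power_mult_distrib inverse_mult_distrib a_def b_def s_def r_def divide_inverse inverse_inverse_eq mult_ac)
    hence "(t / y) * (r * a - s * b) = (t / y) * (y / t - inverse (y / t)) * ?U (y / t)"
      by simp
    also have "(t / y) * (y / t - inverse (y / t)) = 1 - t ^ 2 * (inverse y) ^ 2"
      using t y by (simp add: field_simps power2_eq_square)
    finally show ?thesis by simp
  qed
  have e: "inverse t ^ m - 1 - t ^ 3 / t + t ^ 3 * t ^ m / t = t * r - 1 - t ^ 2 + t * s"
    using t by (simp add: r_def s_def power2_eq_square power3_eq_cube)
  have cancel: "B * (P / B * (R - Z) + Q * (- (w / B)) * (S - Z)) = P * R - w * (Q * S) - (P - w * Q) * Z"
    if "B \<noteq> 0" for B P Q R S Z w :: complex
    using that by (simp add: field_simps)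
  have inv: "1 / (1 - (inverse y) ^ 2) = - (y ^ 2 / (1 - y ^ 2))"
    using y nz by (simp add: divide_simps) (simp add: algebra_simps)
  have "(1 - y ^ 2) * ((1 - t ^ 2 * y ^ 2) / (1 - y ^ 2) * (?U (t * y) - ?U y)
     + (1 - t ^ 2 * (inverse y) ^ 2) * (1 / (1 - (inverse y) ^ 2)) * (?U (y / t) - ?U y))
    = (1 - t ^ 2 * y ^ 2) * ?U (t * y) - y ^ 2 * ((1 - t ^ 2 * (inverse y) ^ 2) * ?U (y / t))
      - ((1 - t ^ 2 * y ^ 2) - y ^ 2 * (1 - t ^ 2 * (inverse y) ^ 2)) * ?U y"
    unfolding inv by (rule cancel[OF nz(1)])
  also have "(1 - t ^ 2 * y ^ 2) - y ^ 2 * (1 - t ^ 2 * (inverse y) ^ 2) = (1 + t ^ 2) * (1 - y ^ 2)"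
    using y by (simp add: field_simps)
  also have "(1 - t ^ 2 * y ^ 2) * ?U (t * y) - y ^ 2 * ((1 - t ^ 2 * (inverse y) ^ 2) * ?U (y / t))
      - (1 + t ^ 2) * (1 - y ^ 2) * ?U y
    = - (t * y) * (s * a - r * b) - y ^ 2 * ((t / y) * (r * a - s * b)) - (1 + t ^ 2) * (- y * (a - b))"
    unfolding U1 U2 mult.assoc U0 ..
  also have "\<dots> = (t * r - 1 - t ^ 2 + t * s) * (- y * (a - b))"
    using y by (simp add: field_simps power2_eq_square)
  also have "\<dots> = (1 - y ^ 2) * ((t * r - 1 - t ^ 2 + t * s) * ?U y)"
    unfolding U0[symmetric] by (simp only: mult_ac)
  finally have "(1 - t ^ 2 * y ^ 2) / (1 - y ^ 2) * (?U (t * y) - ?U y)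
     + (1 - t ^ 2 * (inverse y) ^ 2) * (1 / (1 - (inverse y) ^ 2)) * (?U (y / t) - ?U y)
     = (t * r - 1 - t ^ 2 + t * s) * ?U y" using nz(1) by simp
  thus "aw_coeff t (t + t ^ 2) (t ^ 3) y * (?U (t * y) - ?U y)
     + aw_coeff t (t + t ^ 2) (t ^ 3) (inverse y) * (?U (y / t) - ?U y)
     = (inverse t ^ m - 1 - t ^ 3 / t + t ^ 3 * t ^ m / t) * ?U y"
    unfolding A1 A2 e by simp
qed

section \<open>Palindromic sums and the two Hall-Littlewood families\<close>

definition palindromic_poly :: "(nat \<Rightarrow> complex) \<Rightarrow> nat \<Rightarrow> complex poly" where
  "palindromic_poly c m = (\<Sum>j\<le>m div 2. smult (c j) (cheb_T (m - 2 * j)))"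

lemma palindromic_poly_coeffs:
  assumes "c 0 = 1"
  shows "coeff (palindromic_poly c m) m = 1" "m < k \<Longrightarrow> coeff (palindromic_poly c m) k = 0"
proof -
  have "coeff (palindromic_poly c m) m = (\<Sum>j\<le>m div 2. if j = 0 then 1 else 0)"
    unfolding palindromic_poly_def coeff_sum coeff_smult
    by (rule sum.cong) (use assms cheb_T_coeffs in auto)
  thus "coeff (palindromic_poly c m) m = 1" by simp
  assume "m < k"
  thus "coeff (palindromic_poly c m) k = 0"
    unfolding palindromic_poly_def coeff_sum coeff_smult
    by (intro sum.neutral) (use cheb_T_coeffs in auto)
qed

lemma sum_fold:
  fixes g :: "nat \<Rightarrow> complex"
  shows "(\<Sum>k\<le>m. g k) = (\<Sum>j\<le>m div 2. if 2 * j = m then g j else g j + g (m - j))"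
proof (induction m arbitrary: g rule: nat_induct2)
  case (step m)
  have "(\<Sum>k\<le>m + 2. g k) = g 0 + g (m + 2) + (\<Sum>k\<le>m. g (Suc k))"
    using sum.atMost_Suc_shift[of g m] by simp
  also have "(\<Sum>k\<le>m. g (Suc k)) = (\<Sum>j\<le>m div 2. if 2 * j = m then g (Suc j) else g (Suc j) + g (Suc (m - j)))"
    by (rule step)
  also have "\<dots> = (\<Sum>j\<le>m div 2. if 2 * Suc j = m + 2 then g (Suc j) else g (Suc j) + g (m + 2 - Suc j))"
    by (intro sum.cong refl) (auto simp: Suc_diff_le)
  also have "g 0 + g (m + 2) + \<dots> = (\<Sum>j\<le>Suc (m div 2). if 2 * j = m + 2 then g j else g j + g (m + 2 - j))"
    by (subst sum.atMost_Suc_shift) simp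
  finally show ?case by simp
qed auto

text \<open>Pairing the terms \<open>k\<close> and \<open>m - k\<close> yields y^(m-2k) + y^(2k-m),
  a value of \<open>cheb_T\<close>; the unpaired middle term is right because
  \<open>cheb_T 0 = 1\<close>.\<close>

lemma poly_palindromic:
  assumes y: "y \<noteq> 0" and c: "\<And>k. k \<le> m \<Longrightarrow> c (m - k) = c k"
  shows "y ^ m * poly (palindromic_poly c m) (y + inverse y) = (\<Sum>k\<le>m. c k * (y ^ 2) ^ k)"
proof -
  have "y ^ m * poly (palindromic_poly c m) (y + inverse y)
    = (\<Sum>j\<le>m div 2. c j * (y ^ m * poly (cheb_T (m - 2 * j)) (y + inverse y)))"
    unfolding palindromic_poly_def poly_sum poly_smult sum_distrib_left by (simp only: mult_ac)
  also have "\<dots> = (\<Sum>j\<le>m div 2. if 2 * j = m then c j * (y ^ 2) ^ j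
       else c j * (y ^ 2) ^ j + c (m - j) * (y ^ 2) ^ (m - j))"
  proof (intro sum.cong refl)
    fix j assume "j \<in> {..m div 2}"
    hence j: "2 * j \<le> m" by auto
    show "c j * (y ^ m * poly (cheb_T (m - 2 * j)) (y + inverse y)) = (if 2 * j = m then c j * (y ^ 2) ^ j
       else c j * (y ^ 2) ^ j + c (m - j) * (y ^ 2) ^ (m - j))"
    proof (cases "2 * j = m")
      case True
      thus ?thesis by (simp add: power_mult[symmetric])
    next
      case False
      then obtain i where i: "m - 2 * j = Suc i" using j by (cases "m - 2 * j") auto
      hence m: "m = 2 * j + Suc i" using j by simp
      have "y ^ m * poly (cheb_T (m - 2 * j)) (y + inverse y) = y ^ m * (y ^ Suc i + inverse y ^ Suc i)"
        unfolding i poly_cheb_T[OF y] ..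
      also have "\<dots> = (y ^ 2) ^ (j + Suc i) + (y ^ 2) ^ j"
      proof -
        have "y ^ Suc i * inverse y ^ Suc i = 1"
          using y by (simp flip: power_mult_distrib del: power_Suc)
        hence "y ^ m * (y ^ Suc i + inverse y ^ Suc i) = y ^ (2 * j) * y ^ Suc i * y ^ Suc i + y ^ (2 * j)"
          unfolding m power_add by (simp only: distrib_left mult.assoc mult_1_right)
        thus ?thesis by (simp add: power_mult[symmetric] power_add[symmetric] mult_2)
      qed
      also have "j + Suc i = m - j" using m by simp
      finally show ?thesis using c[of j] j False by (simp add: algebra_simps)
    qed
  qed
  also have "\<dots> = (\<Sum>k\<le>m. c k * (y ^ 2) ^ k)" by (rule sum_fold[symmetric])
  finally show ?thesis .
qed

text \<open>Converts a first-order recurrence for coefficients into a functional equation; the two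
  boundary values remove the unmatched end terms.\<close>

lemma sum_shift_powers:
  fixes Z :: complex
  assumes "a 0 = 0" "b m = 0" "\<And>k. k < m \<Longrightarrow> a (Suc k) = b k"
  shows "(\<Sum>k\<le>m. a k * Z ^ k) = Z * (\<Sum>k\<le>m. b k * Z ^ k)"
proof (cases m)
  case 0 thus ?thesis using assms by simp
next
  case (Suc m')
  have "(\<Sum>k\<le>m. a k * Z ^ k) = (\<Sum>k\<le>m'. a (Suc k) * Z ^ Suc k)"
    unfolding Suc by (subst sum.atMost_Suc_shift) (simp add: assms)
  also have "\<dots> = (\<Sum>k\<le>m'. b k * Z ^ Suc k)" by (rule sum.cong) (use assms Suc in auto)
  also have "\<dots> = Z * (\<Sum>k\<le>m. b k * Z ^ k)" unfolding Suc using assms Suc by (simp add: sum_distrib_left mult_ac)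
  finally show ?thesis .
qed

lemma generic_t_facts:
  assumes "generic_t t"
  shows "t \<noteq> 0" "t \<noteq> 1" "k > 0 \<Longrightarrow> (t ^ 2) ^ k \<noteq> 1" "1 + t ^ m \<noteq> 0" "k > 0 \<Longrightarrow> t ^ k \<noteq> 1"
proof -
  have g: "t ^ k \<noteq> 1" if "k > 0" for k using assms that by (auto simp: generic_t_def)
  show "t \<noteq> 0" using assms by (auto simp: generic_t_def)
  show "t \<noteq> 1" using g[of 1] by simp
  show "k > 0 \<Longrightarrow> (t ^ 2) ^ k \<noteq> 1" using g[of "2 * k"] by (simp add: power_mult)
  show "k > 0 \<Longrightarrow> t ^ k \<noteq> 1" by (rule g)
  show "1 + t ^ m \<noteq> 0"
  proof
    assume h: "1 + t ^ m = 0"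
    hence "t ^ m = -1" by (simp add: eq_neg_iff_add_eq_0 add.commute)
    hence "t ^ (m * 2) = 1" by (simp add: power_mult)
    thus False using g[of "m * 2"] h by (cases "m = 0") auto
  qed
qed

text \<open>Coefficients of the Rogers-Szego polynomial in base t^2, hence of the continuous
  t^2-Hermite polynomial after symmetrisation.\<close>

definition hermite_coeff :: "complex \<Rightarrow> nat \<Rightarrow> nat \<Rightarrow> complex" where
  "hermite_coeff t m k = gauss (t ^ 2) k (m - k)"

text \<open>If h has the coefficients \<open>hermite_coeff t m\<close>, these are the coefficients
  of (h(t Z) + t^m h(Z / t)) / (1 + t^m), a symmetrised half step in base t^2; the denominator makes
  the family monic.\<close>

definition hermite_coeff' :: "complex \<Rightarrow> nat \<Rightarrow> nat \<Rightarrow> complex" where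
  "hermite_coeff' t m k = gauss (t ^ 2) k (m - k) * (t ^ k + t ^ (m - k)) / (1 + t ^ m)"

definition hl_C_poly :: "complex \<Rightarrow> nat \<Rightarrow> complex poly" where
  "hl_C_poly t m = palindromic_poly (hermite_coeff t m) m"

definition hl_D_poly :: "complex \<Rightarrow> nat \<Rightarrow> complex poly" where
  "hl_D_poly t m = palindromic_poly (hermite_coeff' t m) m"

lemma hermite_coeff_sym:
  "k \<le> m \<Longrightarrow> hermite_coeff t m (m - k) = hermite_coeff t m k"
  "k \<le> m \<Longrightarrow> hermite_coeff' t m (m - k) = hermite_coeff' t m k"
  by (auto simp: hermite_coeff_def hermite_coeff'_def gauss_sym[of _ "m - k" k] add.commute)

lemma monic_seq_hl_C: "monic_seq (hl_C_poly t)"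
  unfolding hl_C_poly_def by (rule monic_seqI) (simp_all add: palindromic_poly_coeffs hermite_coeff_def)

lemma monic_seq_hl_D: "generic_t t \<Longrightarrow> monic_seq (hl_D_poly t)"
  unfolding hl_D_poly_def
  by (rule monic_seqI) (simp_all add: palindromic_poly_coeffs hermite_coeff'_def generic_t_facts(4))

context
  fixes t :: complex
  assumes t: "generic_t t"
begin

lemma hermite_coeff_step:
  assumes "k < m"
  shows "gauss (t ^ 2) (Suc k) (m - Suc k) * (1 - (t ^ 2) ^ Suc k) = gauss (t ^ 2) k (m - k) * (1 - (t ^ 2) ^ (m - k))"
proof -
  have "m - k = Suc (m - Suc k)" using assms by simp
  thus ?thesis using gauss_step[of "t ^ 2" k "m - Suc k", OF generic_t_facts(3)[OF t]] by simp
qed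

lemma rescaled_sum:
  fixes Z v :: complex
  assumes "v \<noteq> 0"
  shows "v ^ m * (\<Sum>k\<le>m. c k * (Z / v) ^ k) = (\<Sum>k\<le>m. c k * v ^ (m - k) * Z ^ k)"
  unfolding sum_distrib_left
proof (intro sum.cong refl)
  fix k assume "k \<in> {..m}"
  hence "v ^ m = v ^ (m - k) * v ^ k" by (simp flip: power_add)
  thus "v ^ m * (c k * (Z / v) ^ k) = c k * v ^ (m - k) * Z ^ k" using assms by (simp add: power_divide)
qed

text \<open>The ratio of neighbouring Gaussian coefficients says h(Z) - h(v Z) = Z (h(Z) - v^m h(Z /
  v)) for the generating sum h.\<close>

lemma hermite_sum:
  fixes m :: nat and Z :: complex
  defines "v \<equiv> t ^ 2" and "c \<equiv> hermite_coeff t m"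
  shows "(\<Sum>k\<le>m. c k * v ^ k * Z ^ k) - Z * (\<Sum>k\<le>m. c k * v ^ (m - k) * Z ^ k) = (1 - Z) * (\<Sum>k\<le>m. c k * Z ^ k)"
proof -
  have "(\<Sum>k\<le>m. c k * (1 - v ^ k) * Z ^ k) = Z * (\<Sum>k\<le>m. c k * (1 - v ^ (m - k)) * Z ^ k)"
    by (rule sum_shift_powers) (auto simp: c_def v_def hermite_coeff_def hermite_coeff_step simp del: power_Suc)
  moreover have "(\<Sum>k\<le>m. c k * (1 - v ^ k) * Z ^ k) = (\<Sum>k\<le>m. c k * Z ^ k) - (\<Sum>k\<le>m. c k * v ^ k * Z ^ k)"
    "(\<Sum>k\<le>m. c k * (1 - v ^ (m - k)) * Z ^ k) = (\<Sum>k\<le>m. c k * Z ^ k) - (\<Sum>k\<le>m. c k * v ^ (m - k) * Z ^ k)"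
    by (simp_all add: algebra_simps sum_subtractf)
  ultimately have "(\<Sum>k\<le>m. c k * Z ^ k) - (\<Sum>k\<le>m. c k * v ^ k * Z ^ k)
      = Z * ((\<Sum>k\<le>m. c k * Z ^ k) - (\<Sum>k\<le>m. c k * v ^ (m - k) * Z ^ k))"
    by (simp only:)
  thus ?thesis by (simp add: algebra_simps)
qed

text \<open>Multiplied out, the coefficient of Z^(k+1) involves three consecutive entries of
  \<open>c\<close>. The ratio of neighbours expresses all three by \<open>g k\<close>, giving
  \<open>A'\<close>, \<open>B\<close> and \<open>C'\<close>, and their sum vanishes as a polynomial
  identity in t, t^k and t^(m-k).\<close>

lemma hermite_sum':
  fixes m :: nat and Z :: complex
  defines "v \<equiv> t ^ 2" and "c \<equiv> hermite_coeff' t m"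
  shows "(Z - t) * ((\<Sum>k\<le>m. c k * v ^ k * Z ^ k) - t ^ m * (\<Sum>k\<le>m. c k * Z ^ k))
    + Z * (1 - t * Z) * ((\<Sum>k\<le>m. c k * v ^ (m - k) * Z ^ k) - t ^ m * (\<Sum>k\<le>m. c k * Z ^ k))
    = (1 - t ^ m) * (1 - t * Z) * (Z - t) * (\<Sum>k\<le>m. c k * Z ^ k)"
proof -
  define h where "h = (\<Sum>k\<le>m. c k * Z ^ k)"
  define h1 where "h1 = (\<Sum>k\<le>m. c k * v ^ k * Z ^ k)"
  define h2 where "h2 = (\<Sum>k\<le>m. c k * v ^ (m - k) * Z ^ k)"
  define g where "g = (\<lambda>k. gauss v k (m - k))"
  define N where "N = 1 + t ^ m"
  have N: "N \<noteq> 0" using generic_t_facts(4)[OF t] by (simp add: N_def)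
  have c: "c k = g k * (t ^ k + t ^ (m - k)) / N" for k
    by (simp add: c_def hermite_coeff'_def g_def N_def v_def)
  have step: "g (Suc k) * (1 - v ^ Suc k) = g k * (1 - v ^ (m - k))" if "k < m" for k
    using hermite_coeff_step[OF that] by (simp add: g_def v_def)
  define A' where "A' = (\<lambda>k. g k * (1 - v ^ (m - k)) * (t ^ (k + 2) + t ^ (m - k)) / N)"
  define B where "B = (\<lambda>k. c k * (v ^ k + v ^ (m - k) - 1 - t ^ 2 - t ^ m * (1 - t ^ 2)))"
  define C' where "C' = (\<lambda>k. g k * (1 - v ^ k) * (t ^ k + t ^ (m - k + 2)) / N)"
  have A: "(\<Sum>k\<le>m. t * c k * (1 - v ^ k) * Z ^ k) = Z * (\<Sum>k\<le>m. A' k * Z ^ k)"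
  proof (rule sum_shift_powers)
    fix k assume k: "k < m"
    hence e: "t * (t ^ Suc k + t ^ (m - Suc k)) = t ^ (k + 2) + t ^ (m - k)"
      by (simp add: algebra_simps flip: power_Suc) (simp add: Suc_diff_Suc)
    have "t * c (Suc k) * (1 - v ^ Suc k) = g (Suc k) * (1 - v ^ Suc k) * (t * (t ^ Suc k + t ^ (m - Suc k))) / N"
      by (simp only: c times_divide_eq_left times_divide_eq_right mult_ac)
    thus "t * c (Suc k) * (1 - v ^ Suc k) = A' k" unfolding step[OF k] e A'_def .
  qed (auto simp: A'_def)
  have C: "(\<Sum>k\<le>m. C' k * Z ^ k) = Z * (\<Sum>k\<le>m. t * c k * (1 - v ^ (m - k)) * Z ^ k)"
  proof (rule sum_shift_powers)
    fix k assume k: "k < m"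
    hence "t ^ Suc k + t ^ (m - Suc k + 2) = t * (t ^ k + t ^ (m - k))"
      by (simp add: algebra_simps flip: power_Suc) (simp add: Suc_diff_Suc)
    hence "C' (Suc k) = g k * (1 - v ^ (m - k)) * (t * (t ^ k + t ^ (m - k))) / N"
      unfolding C'_def step[OF k] by simp
    thus "C' (Suc k) = t * c k * (1 - v ^ (m - k))"
      by (simp only: c times_divide_eq_left times_divide_eq_right mult_ac)
  qed (auto simp: C'_def)
  have zero: "A' k + B k + C' k = 0" if k: "k \<le> m" for k
  proof -
    define X where "X = t ^ k"
    define W where "W = t ^ (m - k)"
    have tm: "t ^ m = X * W" using k by (simp add: X_def W_def flip: power_add)
    have vk: "v ^ k = X ^ 2" "v ^ (m - k) = W ^ 2"
      by (simp_all add: v_def X_def W_def mult.commute flip: power_mult)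
    have pw: "t ^ (k + 2) = X * t ^ 2" "t ^ (m - k + 2) = W * t ^ 2" by (simp_all add: X_def W_def power2_eq_square)
    have "A' k + B k + C' k = g k * ((1 - W ^ 2) * (X * t ^ 2 + W)
        + (X + W) * (X ^ 2 + W ^ 2 - 1 - t ^ 2 - X * W * (1 - t ^ 2)) + (1 - X ^ 2) * (X + W * t ^ 2)) / N"
      unfolding A'_def B_def C'_def c vk pw tm X_def[symmetric] W_def[symmetric]
      by (simp add: add_divide_distrib[symmetric] algebra_simps)
    also have "(1 - W ^ 2) * (X * t ^ 2 + W)
        + (X + W) * (X ^ 2 + W ^ 2 - 1 - t ^ 2 - X * W * (1 - t ^ 2)) + (1 - X ^ 2) * (X + W * t ^ 2) = 0"
      by (simp add: algebra_simps power2_eq_square)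
    finally show ?thesis by simp
  qed
  have "Z * (\<Sum>k\<le>m. (A' k + B k + C' k) * Z ^ k) = 0" using zero by simp
  hence "Z * (\<Sum>k\<le>m. A' k * Z ^ k) + Z * (\<Sum>k\<le>m. B k * Z ^ k) + Z * (\<Sum>k\<le>m. C' k * Z ^ k) = 0"
    by (simp only: distrib_right sum.distrib distrib_left)
  moreover have "(\<Sum>k\<le>m. t * c k * (1 - v ^ k) * Z ^ k) = t * h - t * h1"
    "(\<Sum>k\<le>m. t * c k * (1 - v ^ (m - k)) * Z ^ k) = t * h - t * h2"
    "(\<Sum>k\<le>m. B k * Z ^ k) = h1 + h2 - (1 + t ^ 2 + t ^ m * (1 - t ^ 2)) * h"
    unfolding h_def h1_def h2_def B_def sum_distrib_left sum_subtractf[symmetric] sum.distrib[symmetric]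
    by (intro sum.cong refl; simp add: algebra_simps)+
  ultimately have "(t * h - t * h1) + Z * (h1 + h2 - (1 + t ^ 2 + t ^ m * (1 - t ^ 2)) * h) + Z * (Z * (t * h - t * h2)) = 0"
    using A C by simp
  moreover have "(Z - t) * (h1 - t ^ m * h) + Z * (1 - t * Z) * (h2 - t ^ m * h) - (1 - t ^ m) * (1 - t * Z) * (Z - t) * h
    = (t * h - t * h1) + Z * (h1 + h2 - (1 + t ^ 2 + t ^ m * (1 - t ^ 2)) * h) + Z * (Z * (t * h - t * h2))"
    by (simp add: algebra_simps power2_eq_square)
  ultimately have "(Z - t) * (h1 - t ^ m * h) + Z * (1 - t * Z) * (h2 - t ^ m * h) - (1 - t ^ m) * (1 - t * Z) * (Z - t) * h = 0"
    by simp
  thus ?thesis unfolding h_def h1_def h2_def by simp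
qed

text \<open>After scaling by y^m t^m both shifted values become power sums in Z with integral powers
  of t^2, the form of the two preceding identities.\<close>

lemma palindromic_values:
  fixes y :: complex and m :: nat and c :: "nat \<Rightarrow> complex"
  assumes y: "y \<noteq> 0" and c: "\<And>k. k \<le> m \<Longrightarrow> c (m - k) = c k"
  defines "Z \<equiv> y ^ 2" and "P \<equiv> \<lambda>w. poly (palindromic_poly c m) (w + inverse w)"
  shows "y ^ m * P y = (\<Sum>k\<le>m. c k * Z ^ k)"
    and "y ^ m * (t ^ m * P (t * y)) = (\<Sum>k\<le>m. c k * (t ^ 2) ^ k * Z ^ k)"
    and "y ^ m * (t ^ m * P (y / t)) = (\<Sum>k\<le>m. c k * (t ^ 2) ^ (m - k) * Z ^ k)"
proof -
  have t0: "t \<noteq> 0" by (rule generic_t_facts[OF t])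
  show "y ^ m * P y = (\<Sum>k\<le>m. c k * Z ^ k)"
    unfolding P_def Z_def by (rule poly_palindromic, rule y, erule c)
  have ty: "t * y \<noteq> 0" "y / t \<noteq> 0" using t0 y by auto
  have "(t * y) ^ m * P (t * y) = (\<Sum>k\<le>m. c k * ((t * y) ^ 2) ^ k)"
    unfolding P_def by (rule poly_palindromic, rule ty, erule c)
  thus "y ^ m * (t ^ m * P (t * y)) = (\<Sum>k\<le>m. c k * (t ^ 2) ^ k * Z ^ k)"
    by (simp add: power_mult_distrib Z_def mult_ac)
  have "(y / t) ^ m * P (y / t) = (\<Sum>k\<le>m. c k * ((y / t) ^ 2) ^ k)"
    unfolding P_def by (rule poly_palindromic, rule ty, erule c)
  hence "(t ^ 2) ^ m * ((y / t) ^ m * P (y / t)) = (t ^ 2) ^ m * (\<Sum>k\<le>m. c k * (Z / t ^ 2) ^ k)"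
    by (simp add: power_divide Z_def)
  also have "\<dots> = (\<Sum>k\<le>m. c k * (t ^ 2) ^ (m - k) * Z ^ k)"
    by (rule rescaled_sum) (use t0 in simp)
  also have "(t ^ 2) ^ m * ((y / t) ^ m * P (y / t)) = y ^ m * (t ^ m * P (y / t))"
    using t0 by (simp add: power_divide power2_eq_square power_mult_distrib)
  finally show "y ^ m * (t ^ m * P (y / t)) = (\<Sum>k\<le>m. c k * (t ^ 2) ^ (m - k) * Z ^ k)" .
qed

text \<open>The parameters sqrt t, -sqrt t, 0, 0 cancel the factor 1 - t y^2, so
  \<open>aw_coeff\<close> is 1 / (1 - Z) and the equation is \<open>hermite_sum\<close>.\<close>

lemma aw_eigenpoly_hl_C: "aw_eigenpoly t t 0 m (hl_C_poly t m)"
  unfolding aw_eigenpoly_def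
proof (intro allI impI, elim conjE)
  fix y :: complex
  assume y: "y \<noteq> 0" "y ^ 2 \<noteq> 1" "t * y ^ 2 \<noteq> 1" "y ^ 2 \<noteq> t"
  have t0: "t \<noteq> 0" by (rule generic_t_facts[OF t])
  let ?P = "\<lambda>w. poly (hl_C_poly t m) (w + inverse w)"
  define Z where "Z = y ^ 2"
  define h where "h = (\<Sum>k\<le>m. hermite_coeff t m k * Z ^ k)"
  define h1 where "h1 = (\<Sum>k\<le>m. hermite_coeff t m k * (t ^ 2) ^ k * Z ^ k)"
  define h2 where "h2 = (\<Sum>k\<le>m. hermite_coeff t m k * (t ^ 2) ^ (m - k) * Z ^ k)"
  have vals: "y ^ m * ?P y = h" "y ^ m * (t ^ m * ?P (t * y)) = h1" "y ^ m * (t ^ m * ?P (y / t)) = h2"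
    unfolding h_def h1_def h2_def Z_def hl_C_poly_def
    by (rule palindromic_values[OF y(1)]; erule hermite_coeff_sym)+
  have key: "h1 - Z * h2 = (1 - Z) * h" using hermite_sum[of m Z] unfolding h_def h1_def h2_def .
  have Z: "Z \<noteq> 0" "1 - Z \<noteq> 0" using y by (auto simp: Z_def)
  have A1: "aw_coeff t t 0 y = 1 / (1 - Z)" using y by (simp add: aw_coeff_def Z_def)
  have A2: "aw_coeff t t 0 (inverse y) = - (Z / (1 - Z))"
  proof -
    have "1 - t * (inverse y) ^ 2 \<noteq> 0" using y by (simp add: field_simps)
    hence "aw_coeff t t 0 (inverse y) = 1 / (1 - inverse Z)"
      by (simp add: aw_coeff_def Z_def power_inverse)
    also have "\<dots> = - (Z / (1 - Z))" using Z by (simp add: divide_simps) (simp add: algebra_simps)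
    finally show ?thesis .
  qed
  have nz: "y ^ m * t ^ m \<noteq> 0" using y t0 by simp
  have cancel: "(w * s) * (1 / (1 - Z) * (a - p) + - (Z / (1 - Z)) * (b - p))
      = (w * (s * a) - Z * (w * (s * b)) - s * (1 - Z) * (w * p)) / (1 - Z)"
    if "1 - Z \<noteq> 0" for w s a b p Z :: complex
    using that by (simp add: divide_simps) (simp add: algebra_simps)
  have "(y ^ m * t ^ m) * (1 / (1 - Z) * (?P (t * y) - ?P y) + - (Z / (1 - Z)) * (?P (y / t) - ?P y))
    = (y ^ m * (t ^ m * ?P (t * y)) - Z * (y ^ m * (t ^ m * ?P (y / t))) - t ^ m * (1 - Z) * (y ^ m * ?P y)) / (1 - Z)"
    by (rule cancel[OF Z(2)])
  also have "\<dots> = (1 - t ^ m) * h"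
    unfolding vals key using Z by (simp add: field_simps)
  also have "\<dots> = (y ^ m * t ^ m) * ((inverse t ^ m - 1) * ?P y)"
    unfolding vals(1)[symmetric] using t0 by (simp add: field_simps)
  finally have "1 / (1 - Z) * (?P (t * y) - ?P y) + - (Z / (1 - Z)) * (?P (y / t) - ?P y) = (inverse t ^ m - 1) * ?P y"
    using nz by (simp only: mult_left_cancel simp_thms)
  thus "aw_coeff t t 0 y * (?P (t * y) - ?P y) + aw_coeff t t 0 (inverse y) * (?P (y / t) - ?P y)
     = (inverse t ^ m - 1 - 0 / t + 0 * t ^ m / t) * ?P y"
    unfolding A1 A2 by simp
qed

text \<open>The parameters 1, -1, 0, 0 cancel the factor 1 - y^2 instead; with 1 / (1 - t Z) and Z /
  (Z - t) as coefficients the equation is \<open>hermite_sum'\<close>.\<close>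

lemma aw_eigenpoly_hl_D: "aw_eigenpoly t 1 0 m (hl_D_poly t m)"
  unfolding aw_eigenpoly_def
proof (intro allI impI, elim conjE)
  fix y :: complex
  assume y: "y \<noteq> 0" "y ^ 2 \<noteq> 1" "t * y ^ 2 \<noteq> 1" "y ^ 2 \<noteq> t"
  have t0: "t \<noteq> 0" by (rule generic_t_facts[OF t])
  let ?P = "\<lambda>w. poly (hl_D_poly t m) (w + inverse w)"
  define Z where "Z = y ^ 2"
  define h where "h = (\<Sum>k\<le>m. hermite_coeff' t m k * Z ^ k)"
  define h1 where "h1 = (\<Sum>k\<le>m. hermite_coeff' t m k * (t ^ 2) ^ k * Z ^ k)"
  define h2 where "h2 = (\<Sum>k\<le>m. hermite_coeff' t m k * (t ^ 2) ^ (m - k) * Z ^ k)"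
  have vals: "y ^ m * ?P y = h" "y ^ m * (t ^ m * ?P (t * y)) = h1" "y ^ m * (t ^ m * ?P (y / t)) = h2"
    unfolding h_def h1_def h2_def Z_def hl_D_poly_def
    by (rule palindromic_values[OF y(1)]; erule hermite_coeff_sym)+
  have key: "(Z - t) * (h1 - t ^ m * h) + Z * (1 - t * Z) * (h2 - t ^ m * h) = (1 - t ^ m) * (1 - t * Z) * (Z - t) * h"
    using hermite_sum'[of Z m] unfolding h_def h1_def h2_def .
  have Z: "Z \<noteq> 0" "1 - t * Z \<noteq> 0" "Z - t \<noteq> 0" using y by (auto simp: Z_def)
  have A1: "aw_coeff t 1 0 y = 1 / (1 - t * Z)" using y by (simp add: aw_coeff_def Z_def)
  have A2: "aw_coeff t 1 0 (inverse y) = Z / (Z - t)"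
  proof -
    have "1 - (inverse y) ^ 2 \<noteq> 0" using y by (simp add: field_simps)
    hence "aw_coeff t 1 0 (inverse y) = 1 / (1 - t * inverse Z)"
      by (simp add: aw_coeff_def Z_def power_inverse)
    also have "\<dots> = Z / (Z - t)" using Z by (simp add: field_simps)
    finally show ?thesis .
  qed
  have nz: "y ^ m * t ^ m * ((1 - t * Z) * (Z - t)) \<noteq> 0" using y t0 Z by simp
  have cancel: "(w * s * (B * D)) * (1 / B * (a - p) + Z / D * (b - p))
      = D * (w * (s * a) - s * (w * p)) + Z * B * (w * (s * b) - s * (w * p))"
    if "B \<noteq> 0" "D \<noteq> 0" for w s a b p B D :: complex
    using that by (simp add: field_simps)
  have "(y ^ m * t ^ m * ((1 - t * Z) * (Z - t))) * (1 / (1 - t * Z) * (?P (t * y) - ?P y) + Z / (Z - t) * (?P (y / t) - ?P y))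
    = (1 - t ^ m) * (1 - t * Z) * (Z - t) * h"
    unfolding cancel[OF Z(2,3)] vals key ..
  also have "\<dots> = (y ^ m * t ^ m * ((1 - t * Z) * (Z - t))) * ((inverse t ^ m - 1) * ?P y)"
  proof -
    have "t ^ m * (inverse t ^ m - 1) = 1 - t ^ m" using t0 by (simp add: field_simps)
    hence "(1 - t ^ m) * (1 - t * Z) * (Z - t) * h = (t ^ m * (inverse t ^ m - 1)) * (1 - t * Z) * (Z - t) * h"
      by (simp only:)
    thus ?thesis unfolding vals(1)[symmetric] by (simp only: mult_ac)
  qed
  finally have "1 / (1 - t * Z) * (?P (t * y) - ?P y) + Z / (Z - t) * (?P (y / t) - ?P y) = (inverse t ^ m - 1) * ?P y"
    using nz by (simp only: mult_left_cancel simp_thms)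
  thus "aw_coeff t 1 0 y * (?P (t * y) - ?P y) + aw_coeff t 1 0 (inverse y) * (?P (y / t) - ?P y)
     = (inverse t ^ m - 1 - 0 / t + 0 * t ^ m / t) * ?P y"
    unfolding A1 A2 by simp
qed

end

subsection \<open>Schur and Hall--Littlewood polynomials of columns\<close>

text \<open>The difference of the eigenvalues is t^(n-m) (t^(m-i) - 1) (1 - f t^(m+i-1)) / (1 -
  t).\<close>

lemma eigval_distinct:
  assumes "t \<noteq> 0" "t \<noteq> 1" "i < m" "m \<le> n" "t ^ (m - i) \<noteq> 1" "f * t ^ (m + i - 1) \<noteq> 1"
  shows "eigval n t f m \<noteq> eigval n t f i"
proof -
  obtain d where d: "m = i + d" "d > 0" using \<open>i < m\<close> less_imp_add_positive by blast
  obtain s where s: "n = i + d + s" using \<open>m \<le> n\<close> d le_Suc_ex by blast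
  have pow: "t ^ (n - 1) * t ^ i = t ^ s * t ^ (m + i - 1)"
  proof -
    have "n - 1 + i = s + (m + i - 1)" using d s by linarith
    thus ?thesis by (simp only: power_add[symmetric])
  qed
  have "eigval n t f m - eigval n t f i = (t ^ (n - i) - t ^ (n - m) - f * (t ^ (n - 1) * t ^ i) * (t ^ d - 1)) / (1 - t)"
    using d by (simp add: eigval_def diff_divide_distrib[symmetric] power_add algebra_simps)
  also have "t ^ (n - i) - t ^ (n - m) - f * (t ^ (n - 1) * t ^ i) * (t ^ d - 1) = t ^ s * (t ^ d - 1) * (1 - f * t ^ (m + i - 1))"
    unfolding pow using d s by (simp add: power_add algebra_simps)
  also have "\<dots> / (1 - t) \<noteq> 0" using assms d by auto
  finally show ?thesis by auto
qed

lemma generic_t_if_small: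
  fixes q :: complex
  assumes "0 < norm q" "norm q < 1"
  shows "generic_t q"
proof -
  have *: "q ^ k \<noteq> 1" if "k > 0" for k
  proof
    assume "q ^ k = 1"
    hence "norm (q ^ k) = 1" by simp
    moreover have "norm q ^ k < 1" using assms that power_Suc_less_one[of "norm q"] by (cases k) auto
    ultimately show False by (simp add: norm_power)
  qed
  show "generic_t q" unfolding generic_t_def using assms(1) * by auto
qed

lemma macdonald_C_params:
  fixes t q :: complex
  assumes "t \<noteq> 0" "q \<noteq> 0"
  shows "(1 - csqrt t * u) * (1 - (- csqrt t) * u) * (1 - csqrt q * csqrt t * u) * (1 - (- csqrt q * csqrt t) * u)
      = 1 - (t + q * t) * u ^ 2 + (q * t ^ 2) * u ^ 4"
    and "koornwinder_alpha (csqrt t) (- csqrt t) (csqrt q * csqrt t) (- csqrt q * csqrt t) q ^ 2 * q = q * t ^ 2"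
    and "koornwinder_alpha (csqrt t) (- csqrt t) (csqrt q * csqrt t) (- csqrt q * csqrt t) q \<noteq> 0"
proof -
  have factor: "(1 - a * u) * (1 - (- a) * u) * (1 - b * a * u) * (1 - (- b * a) * u)
      = (1 - a ^ 2 * u ^ 2) * (1 - b ^ 2 * a ^ 2 * u ^ 2)" for a b :: complex
    by (simp add: algebra_simps power2_eq_square)
  have "(1 - csqrt t * u) * (1 - (- csqrt t) * u) * (1 - csqrt q * csqrt t * u) * (1 - (- csqrt q * csqrt t) * u)
    = (1 - (csqrt t) ^ 2 * u ^ 2) * (1 - (csqrt q) ^ 2 * (csqrt t) ^ 2 * u ^ 2)"
    by (rule factor)
  also have "\<dots> = 1 - (t + q * t) * u ^ 2 + (q * t ^ 2) * u ^ 4"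
    unfolding power2_csqrt by (simp add: algebra_simps power2_eq_square power4_eq_xxxx)
  finally show "(1 - csqrt t * u) * (1 - (- csqrt t) * u) * (1 - csqrt q * csqrt t * u) * (1 - (- csqrt q * csqrt t) * u)
      = 1 - (t + q * t) * u ^ 2 + (q * t ^ 2) * u ^ 4" .
  have "csqrt t * (- csqrt t) * (csqrt q * csqrt t) * (- csqrt q * csqrt t) / q = ((csqrt t) ^ 2) ^ 2 * (csqrt q) ^ 2 / q"
    by (simp add: power2_eq_square mult_ac)
  also have "\<dots> = t ^ 2" using assms by simp
  \<comment> \<open>The branch makes this \<open>t\<close> or \<open>- t\<close>; only its square
    and its being nonzero enter.\<close>
  finally have \<alpha>: "koornwinder_alpha (csqrt t) (- csqrt t) (csqrt q * csqrt t) (- csqrt q * csqrt t) q = csqrt (t ^ 2)"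
    unfolding koornwinder_alpha_def by simp
  show "koornwinder_alpha (csqrt t) (- csqrt t) (csqrt q * csqrt t) (- csqrt q * csqrt t) q ^ 2 * q = q * t ^ 2"
    unfolding \<alpha> by simp
  show "koornwinder_alpha (csqrt t) (- csqrt t) (csqrt q * csqrt t) (- csqrt q * csqrt t) q \<noteq> 0"
    unfolding \<alpha> using assms by simp
qed

lemma macdonald_D_params:
  fixes q :: complex
  assumes "q \<noteq> 0"
  shows "(1 - 1 * u) * (1 - (- 1) * u) * (1 - csqrt q * u) * (1 - (- csqrt q) * u) = 1 - (1 + q) * u ^ 2 + q * u ^ 4"
    and "koornwinder_alpha 1 (- 1) (csqrt q) (- csqrt q) q ^ 2 * q = q"
    and "koornwinder_alpha 1 (- 1) (csqrt q) (- csqrt q) q \<noteq> 0"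
proof -
  have "(1 - 1 * u) * (1 - (- 1) * u) * (1 - b * u) * (1 - (- b) * u) = (1 - u ^ 2) * (1 - b ^ 2 * u ^ 2)" for b
    by (simp add: algebra_simps power2_eq_square)
  from this[of "csqrt q"]
  have "(1 - 1 * u) * (1 - (- 1) * u) * (1 - csqrt q * u) * (1 - (- csqrt q) * u) = (1 - u ^ 2) * (1 - q * u ^ 2)"
    by (simp only: power2_csqrt)
  thus "(1 - 1 * u) * (1 - (- 1) * u) * (1 - csqrt q * u) * (1 - (- csqrt q) * u) = 1 - (1 + q) * u ^ 2 + q * u ^ 4"
    by (simp add: algebra_simps power2_eq_square power4_eq_xxxx)
  have "1 * (- 1) * csqrt q * (- csqrt q) / q = (csqrt q) ^ 2 / q" by (simp add: power2_eq_square)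
  also have "\<dots> = 1" using assms by simp
  finally have \<alpha>: "koornwinder_alpha 1 (- 1) (csqrt q) (- csqrt q) q = 1"
    unfolding koornwinder_alpha_def by simp
  show "koornwinder_alpha 1 (- 1) (csqrt q) (- csqrt q) q ^ 2 * q = q"
    "koornwinder_alpha 1 (- 1) (csqrt q) (- csqrt q) q \<noteq> 0"
    unfolding \<alpha> by simp_all
qed

text \<open>The coefficient of \<open>p m\<close> in \<Phi>, written through
  \<open>inv_coeffs\<close> so that it matches the eigenvectors of
  \<open>diag_matrix\<close>.\<close>

definition basis_dual :: "(nat \<Rightarrow> complex poly) \<Rightarrow> nat \<Rightarrow> nat \<Rightarrow> (nat \<Rightarrow> complex) \<Rightarrow> complex" where
  "basis_dual p n m x = (\<Sum>k\<le>n. inv_coeffs p k m * coeff (linprod {1..n} (joukowski x)) k)"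

lemma linprod_basis_dual:
  assumes "monic_seq p"
  shows "linprod {1..n} (joukowski x) = (\<Sum>m\<le>n. smult (basis_dual p n m x) (p m))"
  unfolding basis_dual_def by (rule expand_inv_coeffs[OF assms], rule coeff_linprod_eq_0) auto

lemma koornwinder_column_dual:
  assumes p: "monic_seq p" and aw: "\<And>m. m \<le> n \<Longrightarrow> aw_eigenpoly t e f m (p m)"
    and n: "n \<ge> 1" and i: "i \<le> n" 
    and dist: "\<And>m. i < m \<Longrightarrow> m \<le> n \<Longrightarrow> eigval n t f m \<noteq> eigval n t f i"
    and q: "q \<noteq> 0" "q \<noteq> 1" and t: "t \<noteq> 0" "t \<noteq> 1"
    and par: "\<And>u. (1 - a * u) * (1 - b * u) * (1 - c * u) * (1 - d * u) = 1 - e * u ^ 2 + f * u ^ 4"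
    and \<alpha>: "koornwinder_alpha a b c d q ^ 2 * q = f" "koornwinder_alpha a b c d q \<noteq> 0"
  shows "koornwinder n (column (n - i)) a b c d q t = basis_dual p n i"
proof
  fix x
  have "koornwinder n (column (n - i)) a b c d q t x
      = (\<Sum>k\<le>n. tri_eigvec (diag_matrix p (eigval n t f)) i k * coeff (linprod {1..n} (joukowski x)) k)"
    by (rule fun_cong[OF koornwinder_column[OF represents_diag_matrix[OF t n p aw] i dist q t par \<alpha>]])
  also have "\<dots> = basis_dual p n i x"
    unfolding basis_dual_def
    by (intro sum.cong refl arg_cong2[of _ _ _ _ "(*)"] tri_eigvec_diag_matrix[where d = "eigval n t f" and n = n, OF p dist _ i]) auto
  finally show "koornwinder n (column (n - i)) a b c d q t x = basis_dual p n i x" .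
qed

text \<open>The equation for \<open>cheb_U\<close> holds in every base, and here the base is
  \<open>q\<close> itself. The result is free of \<open>q\<close>, which is the independence of the
  Schur polynomials of \<open>q\<close>.\<close>

lemma schur_C_dual:
  assumes q: "0 < norm q" "norm q < 1" and n: "n \<ge> 1" and i: "i \<le> n"
  shows "schur_C n (n - i) q = basis_dual cheb_U n i"
proof -
  note g = generic_t_if_small[OF q]
  note gf = generic_t_facts[OF g]
  have e: "q + q * q = q + q ^ 2" "q * q ^ 2 = q ^ 3" by (simp_all add: power2_eq_square power3_eq_cube)
  note par = macdonald_C_params[OF gf(1) gf(1), unfolded e]
  show ?thesis unfolding schur_C_def macdonald_C_def
  proof (rule koornwinder_column_dual[OF monic_seq_cheb_U aw_eigenpoly_cheb_U[OF gf(1)] n i _ gf(1,2) gf(1,2) par])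
    fix m assume m: "i < m" "m \<le> n"
    show "eigval n q (q ^ 3) m \<noteq> eigval n q (q ^ 3) i"
    proof (rule eigval_distinct[OF gf(1,2) m])
      show "q ^ (m - i) \<noteq> 1" using gf(5) m by simp
      show "q ^ 3 * q ^ (m + i - 1) \<noteq> 1" using gf(5)[of "3 + (m + i - 1)"] by (simp only: power_add) simp
    qed
  qed
qed

lemma schur_D_dual:
  assumes q: "0 < norm q" "norm q < 1" and n: "n \<ge> 1" and i: "i \<le> n"
  shows "schur_D n (n - i) q = basis_dual cheb_T n i"
proof -
  note g = generic_t_if_small[OF q]
  note gf = generic_t_facts[OF g]
  note par = macdonald_D_params[OF gf(1)]
  show ?thesis unfolding schur_D_def macdonald_D_def
  proof (rule koornwinder_column_dual[OF monic_seq_cheb_T aw_eigenpoly_cheb_T[OF gf(1)] n i _ gf(1,2) gf(1,2) par])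
    fix m assume m: "i < m" "m \<le> n"
    show "eigval n q q m \<noteq> eigval n q q i"
    proof (rule eigval_distinct[OF gf(1,2) m])
      show "q ^ (m - i) \<noteq> 1" using gf(5) m by simp
      show "q * q ^ (m + i - 1) \<noteq> 1" using gf(5)[of "Suc (m + i - 1)"] by (simp only: power_Suc) simp
    qed
  qed
qed

text \<open>For fixed \<open>t\<close> the operator is affine in \<open>(e, f)\<close>, and its matrix is known at the three affinely
  independent points \<open>(1, 0)\<close>, \<open>(t, 0)\<close> and \<open>(1 + t, t)\<close>.\<close>

definition op_matrix :: "nat \<Rightarrow> complex \<Rightarrow> complex \<Rightarrow> complex \<Rightarrow> nat \<Rightarrow> nat \<Rightarrow> complex" where
  "op_matrix n t e f m k =
     (1 - (e - 1 - f) / (t - 1) - f / t) * diag_matrix (hl_D_poly t) (eigval n t 0) m k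
     + (e - 1 - f) / (t - 1) * diag_matrix (hl_C_poly t) (eigval n t 0) m k
     + f / t * diag_matrix cheb_T (eigval n t t) m k"

lemma represents_op_matrix:
  assumes t: "generic_t t" and n: "n \<ge> 1"
  shows "represents n t e f (op_matrix n t e f)"
proof -
  note gf = generic_t_facts[OF t]
  have "represents n t e f (\<lambda>m k. (1 - (e - 1 - f) / (t - 1) - f / t) * diag_matrix (hl_D_poly t) (eigval n t 0) m k
     + (e - 1 - f) / (t - 1) * diag_matrix (hl_C_poly t) (eigval n t 0) m k
     + f / t * diag_matrix cheb_T (eigval n t t) m k)"
  \<comment> \<open>The weights solve a + b + c = 1, a + b t + c (1 + t) = e and c t = f.\<close>
  proof (rule represents_affine)
    show "represents n t 1 0 (diag_matrix (hl_D_poly t) (eigval n t 0))"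
      by (rule represents_diag_matrix[OF gf(1,2) n monic_seq_hl_D[OF t] aw_eigenpoly_hl_D[OF t]])
    show "represents n t t 0 (diag_matrix (hl_C_poly t) (eigval n t 0))"
      by (rule represents_diag_matrix[OF gf(1,2) n monic_seq_hl_C aw_eigenpoly_hl_C[OF t]])
    show "represents n t (1 + t) t (diag_matrix cheb_T (eigval n t t))"
      by (rule represents_diag_matrix[OF gf(1,2) n monic_seq_cheb_T aw_eigenpoly_cheb_T[OF gf(1)]])
    have nz: "t - 1 \<noteq> 0" using gf by simp
    define b where "b = (e - 1 - f) / (t - 1)"
    have b: "b * t = b + (e - 1 - f)" using nz by (simp add: b_def field_simps)
    show "e = (1 - (e - 1 - f) / (t - 1) - f / t) * 1 + (e - 1 - f) / (t - 1) * t + f / t * (1 + t)"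
      unfolding b_def[symmetric] b using gf(1) by (simp add: field_simps)
    show "f = (1 - (e - 1 - f) / (t - 1) - f / t) * 0 + (e - 1 - f) / (t - 1) * 0 + f / t * t"
      using gf(1) by simp
  qed simp
  thus ?thesis by (simp add: op_matrix_def[abs_def])
qed

text \<open>For nonzero \<open>q\<close> the matrix of the operator is known, in the limit also its
  eigenbasis \<open>p\<close>. The eigenvalues stay distinct near \<open>f = 0\<close>, so the
  vectors \<open>tri_eigvec\<close> converge to those of the limit matrix, which are the columns of
  \<open>inv_coeffs p\<close>.\<close>

lemma tendsto_koornwinder_column:
  assumes t: "generic_t t" and n: "n \<ge> 1" and i: "i \<le> n" and p: "monic_seq p"
    and f: "(f \<longlongrightarrow> 0) (at 0)"
    and lim: "\<And>m k. ((\<lambda>q. op_matrix n t (e q) (f q) m k) \<longlongrightarrow> diag_matrix p (eigval n t 0) m k) (at 0)"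
    and par: "\<And>q u. q \<noteq> 0 \<Longrightarrow> (1 - a q * u) * (1 - b q * u) * (1 - c q * u) * (1 - d q * u) = 1 - e q * u ^ 2 + f q * u ^ 4"
    and \<alpha>: "\<And>q. q \<noteq> 0 \<Longrightarrow> koornwinder_alpha (a q) (b q) (c q) (d q) q ^ 2 * q = f q"
      "\<And>q. q \<noteq> 0 \<Longrightarrow> koornwinder_alpha (a q) (b q) (c q) (d q) q \<noteq> 0"
  shows "((\<lambda>q. koornwinder n (column (n - i)) (a q) (b q) (c q) (d q) q t x) \<longlongrightarrow> basis_dual p n i x) (at 0)"
proof -
  note gf = generic_t_facts[OF t]
  have dist0: "eigval n t 0 m \<noteq> eigval n t 0 i" if "i < m" "m \<le> n" for m
    by (rule eigval_distinct[OF gf(1,2) that]) (use gf(5) that in auto)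
  have "\<forall>\<^sub>F q in at 0. \<forall>m\<in>{i<..n}. eigval n t (f q) m - eigval n t (f q) i \<noteq> 0"
  proof (intro eventually_ball_finite ballI)
    fix m assume m: "m \<in> {i<..n}"
    have "((\<lambda>q. eigval n t (f q) m - eigval n t (f q) i) \<longlongrightarrow> eigval n t 0 m - eigval n t 0 i) (at 0)"
      unfolding eigval_def by (intro tendsto_intros f) (use gf in auto)
    thus "\<forall>\<^sub>F q in at 0. eigval n t (f q) m - eigval n t (f q) i \<noteq> 0"
      by (rule tendsto_imp_eventually_ne) (use dist0 m in auto)
  qed simp
  moreover have "\<forall>\<^sub>F q in at 0. q \<noteq> (0::complex)" "\<forall>\<^sub>F q in at 0. q \<noteq> (1::complex)"
    by (rule eventually_neq_at_within)+
  ultimately have ev: "\<forall>\<^sub>F q in at 0. (\<Sum>k\<le>n. tri_eigvec (op_matrix n t (e q) (f q)) i k * coeff (linprod {1..n} (joukowski x)) k)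
      = koornwinder n (column (n - i)) (a q) (b q) (c q) (d q) q t x"
  proof eventually_elim
    case (elim q)
    have "koornwinder n (column (n - i)) (a q) (b q) (c q) (d q) q t
      = (\<lambda>x. \<Sum>k\<le>n. tri_eigvec (op_matrix n t (e q) (f q)) i k * coeff (linprod {1..n} (joukowski x)) k)"
      by (rule koornwinder_column[OF represents_op_matrix[OF t n] i _ elim(2,3) gf(1,2) par \<alpha>])
         (use elim in auto)
    thus ?case by simp
  qed
  have "((\<lambda>q. \<Sum>k\<le>n. tri_eigvec (op_matrix n t (e q) (f q)) i k * coeff (linprod {1..n} (joukowski x)) k) \<longlongrightarrow> basis_dual p n i x) (at 0)"
    unfolding basis_dual_def
  proof (intro tendsto_sum tendsto_mult tendsto_const)
    fix k assume "k \<in> {..n}"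
    hence k: "k \<le> n" by simp
    have "((\<lambda>q. tri_eigvec (op_matrix n t (e q) (f q)) i k) \<longlongrightarrow> tri_eigvec (diag_matrix p (eigval n t 0)) i k) (at 0)"
      by (rule tendsto_tri_eigvec[where n = n]) (use lim dist0 i k in \<open>auto simp: diag_matrix_diag[OF p]\<close>)
    also have "tri_eigvec (diag_matrix p (eigval n t 0)) i k = inv_coeffs p k i"
      by (rule tri_eigvec_diag_matrix[OF p _ k i]) (use dist0 in auto)
    finally show "((\<lambda>q. tri_eigvec (op_matrix n t (e q) (f q)) i k) \<longlongrightarrow> inv_coeffs p k i) (at 0)" .
  qed
  thus ?thesis by (rule Lim_transform_eventually[OF _ ev])
qed

text \<open>The parameters tend to \<open>(t, 0)\<close>, so the three weights in
  \<open>op_matrix\<close> tend to 0, 1, 0.\<close>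

lemma hall_littlewood_C_dual:
  assumes t: "generic_t t" and n: "n \<ge> 1" and i: "i \<le> n"
  shows "hall_littlewood_C n (n - i) t = basis_dual (hl_C_poly t) n i"
proof
  fix x
  note gf = generic_t_facts[OF t]
  have "((\<lambda>q. koornwinder n (column (n - i)) (csqrt t) (- csqrt t) (csqrt q * csqrt t) (- csqrt q * csqrt t) q t x)
      \<longlongrightarrow> basis_dual (hl_C_poly t) n i x) (at 0)"
  proof (rule tendsto_koornwinder_column[OF t n i monic_seq_hl_C, where e = "\<lambda>q. t + q * t" and f = "\<lambda>q. q * t ^ 2"])
    show "((\<lambda>q. q * t ^ 2) \<longlongrightarrow> 0) (at 0)" by (auto intro!: tendsto_eq_intros)
    show "((\<lambda>q. op_matrix n t (t + q * t) (q * t ^ 2) m k) \<longlongrightarrow> diag_matrix (hl_C_poly t) (eigval n t 0) m k) (at 0)" for m k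
      unfolding op_matrix_def using gf(1,2) by (auto intro!: tendsto_eq_intros)
  qed (use macdonald_C_params[OF gf(1)] in blast)+
  thus "hall_littlewood_C n (n - i) t x = basis_dual (hl_C_poly t) n i x"
    unfolding hall_littlewood_C_def macdonald_C_def by (intro tendsto_Lim) simp_all
qed

text \<open>The parameters tend to \<open>(1, 0)\<close>, so the three weights in
  \<open>op_matrix\<close> tend to 1, 0, 0.\<close>

lemma hall_littlewood_D_dual:
  assumes t: "generic_t t" and n: "n \<ge> 1" and i: "i \<le> n"
  shows "hall_littlewood_D n (n - i) t = basis_dual (hl_D_poly t) n i"
proof
  fix x
  note gf = generic_t_facts[OF t]
  have "((\<lambda>q. koornwinder n (column (n - i)) 1 (- 1) (csqrt q) (- csqrt q) q t x)
      \<longlongrightarrow> basis_dual (hl_D_poly t) n i x) (at 0)"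
  proof (rule tendsto_koornwinder_column[OF t n i monic_seq_hl_D[OF t], where e = "\<lambda>q. 1 + q" and f = "\<lambda>q. q"])
    show "((\<lambda>q. op_matrix n t (1 + q) q m k) \<longlongrightarrow> diag_matrix (hl_D_poly t) (eigval n t 0) m k) (at 0)" for m k
      unfolding op_matrix_def using gf(1,2) by (auto intro!: tendsto_eq_intros)
  qed (use macdonald_D_params in \<open>blast intro: tendsto_ident_at\<close>)+
  thus "hall_littlewood_D n (n - i) t x = basis_dual (hl_D_poly t) n i x"
    unfolding hall_littlewood_D_def macdonald_D_def by (intro tendsto_Lim) simp_all
qed

subsection \<open>Transition coefficients\<close>

text \<open>Connection coefficients pass to the dual side in the opposite direction: inserting
  \<open>p'\<close> in terms of \<open>p\<close> into the second expansion of \<Phi> and comparing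
  coefficients of \<open>p\<close> writes the duals of \<open>p\<close> in those of
  \<open>p'\<close>.\<close>

lemma basis_dual_transition:
  assumes p: "monic_seq p" and p': "monic_seq p'" and r: "r \<le> n"
    and \<kappa>: "\<And>m. p' m = (\<Sum>j\<le>m div 2. smult (\<kappa> m j) (p (m - 2 * j)))"
  shows "basis_dual p n (n - r) x = (\<Sum>j=0..r div 2. \<kappa> (n - r + 2 * j) j * basis_dual p' n (n - r + 2 * j) x)"
proof -
  let ?b = "\<lambda>m. basis_dual p' n m x"
  have expand: "smult c (p' m) = (\<Sum>j\<le>m div 2. smult (c * \<kappa> m j) (p (m - 2 * j)))" for c m
    unfolding \<kappa>[of m] by (rule poly_eqI) (simp add: coeff_sum sum_distrib_left mult_ac)
  have "(\<Sum>m\<le>n. smult (basis_dual p n m x) (p m)) = linprod {1..n} (joukowski x)"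
    by (rule linprod_basis_dual[OF p, symmetric])
  also have "\<dots> = (\<Sum>m\<le>n. smult (?b m) (p' m))" by (rule linprod_basis_dual[OF p'])
  also have "\<dots> = (\<Sum>m\<le>n. \<Sum>j\<le>m div 2. smult (?b m * \<kappa> m j) (p (m - 2 * j)))"
    by (intro sum.cong refl expand)
  also have "\<dots> = (\<Sum>(m, j)\<in>(SIGMA m:{..n}. {..m div 2}). smult (?b m * \<kappa> m j) (p (m - 2 * j)))"
    by (rule sum.Sigma) auto
  \<comment> \<open>Terms are collected by the degree \<open>i = m - 2 * j\<close> of the polynomial
    \<open>p i\<close>.\<close>
  also have "\<dots> = (\<Sum>(i, j)\<in>(SIGMA i:{..n}. {..(n - i) div 2}). smult (?b (i + 2 * j) * \<kappa> (i + 2 * j) j) (p i))"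
    by (rule sum.reindex_bij_witness[of _ "\<lambda>(i, j). (i + 2 * j, j)" "\<lambda>(m, j). (m - 2 * j, j)"]) auto
  also have "\<dots> = (\<Sum>i\<le>n. \<Sum>j\<le>(n - i) div 2. smult (?b (i + 2 * j) * \<kappa> (i + 2 * j) j) (p i))"
    by (rule sum.Sigma[symmetric]) auto
  also have "\<dots> = (\<Sum>i\<le>n. smult (\<Sum>j\<le>(n - i) div 2. ?b (i + 2 * j) * \<kappa> (i + 2 * j) j) (p i))"
    by (intro sum.cong refl poly_eqI) (simp add: coeff_sum sum_distrib_right)
  finally have "basis_dual p n (n - r) x = (\<Sum>j\<le>(n - (n - r)) div 2. ?b (n - r + 2 * j) * \<kappa> (n - r + 2 * j) j)"
    by (rule monic_seq_unique[OF p]) simp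
  also have "n - (n - r) = r" using r by simp
  finally show ?thesis by (simp add: atLeast0AtMost mult.commute)
qed

text \<open>Pairing with the coefficients of \<open>p (\<iota> j)\<close> inverts
  \<open>inv_coeffs\<close> and isolates \<open>d j\<close>. The value 1/2 of \<open>q\<close> fixes
  a supply of regular points.\<close>

lemma basis_dual_independent:
  assumes p: "monic_seq p" and J: "finite J" "inj_on \<iota> J" "\<And>j. j \<in> J \<Longrightarrow> \<iota> j \<le> n"
    and eq: "\<And>x. (\<forall>i\<in>{1..n}. x i \<noteq> 0) \<Longrightarrow> (\<Sum>j\<in>J. d j * basis_dual p n (\<iota> j) x) = 0"
    and j: "j \<in> J"
  shows "d j = 0"
proof -
  have 0: "(\<Sum>j\<in>J. d j * inv_coeffs p k (\<iota> j)) = 0" if k: "k \<le> n" for k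
  proof (rule linprod_coeffs_independent[where q = "1 / 2" and v = "\<lambda>k. \<Sum>j\<in>J. d j * inv_coeffs p k (\<iota> j)", OF _ _ k])
    fix x assume "regular_point n (1 / 2) x"
    hence "\<forall>i\<in>{1..n}. x i \<noteq> 0" by (auto simp: regular_point_def)
    hence "(\<Sum>j\<in>J. d j * basis_dual p n (\<iota> j) x) = 0" by (rule eq)
    thus "(\<Sum>k\<le>n. (\<Sum>j\<in>J. d j * inv_coeffs p k (\<iota> j)) * coeff (linprod {1..n} (joukowski x)) k) = 0"
      unfolding basis_dual_def sum_distrib_left sum_distrib_right
      by (subst sum.swap) (simp add: mult_ac)
  qed simp
  have "0 = (\<Sum>k\<le>n. (\<Sum>i\<in>J. d i * inv_coeffs p k (\<iota> i)) * coeff (p (\<iota> j)) k)"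
    using 0 by simp
  also have "\<dots> = (\<Sum>i\<in>J. d i * (\<Sum>k\<le>n. inv_coeffs p k (\<iota> i) * coeff (p (\<iota> j)) k))"
    unfolding sum_distrib_left sum_distrib_right by (subst sum.swap) (simp add: mult_ac)
  also have "\<dots> = (\<Sum>i\<in>J. if i = j then d j else 0)"
    by (rule sum.cong) (use J j in \<open>auto simp: inv_coeffs_inverse[OF p] inj_on_eq_iff\<close>)
  also have "\<dots> = d j" using J j by simp
  finally show ?thesis by simp
qed

lemma transition_coeffs_iff:
  fixes s :: "complex \<Rightarrow> (nat \<Rightarrow> complex) \<Rightarrow> complex"
  assumes p: "monic_seq p" and r: "r \<le> n"
    and P: "\<And>s. s \<le> n \<Longrightarrow> P s = basis_dual p n (n - s)"
    and s: "\<And>q x. 0 < norm q \<Longrightarrow> norm q < 1 \<Longrightarrow>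
      s q x = (\<Sum>j=0..r div 2. \<kappa> j * basis_dual p n (n - r + 2 * j) x)"
  shows "transition_coeffs n r s P K \<longleftrightarrow> K = (\<lambda>j. if j \<le> r div 2 then \<kappa> j else 0)"
proof -
  have P': "P (r - 2 * j) = basis_dual p n (n - r + 2 * j)" if "j \<le> r div 2" for j
  proof -
    have "n - (r - 2 * j) = n - r + 2 * j" using r that by linarith
    thus ?thesis using P[of "r - 2 * j"] r by simp
  qed
  show ?thesis
  proof
    assume K: "transition_coeffs n r s P K"
    have "K j - \<kappa> j = 0" if "j \<in> {0..r div 2}" for j
    proof (rule basis_dual_independent[OF p, where J = "{0..r div 2}" and \<iota> = "\<lambda>j. n - r + 2 * j" and n = n])
      fix x :: "nat \<Rightarrow> complex" assume x: "\<forall>i\<in>{1..n}. x i \<noteq> 0"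
      have half: "0 < norm (1 / 2 :: complex)" "norm (1 / 2 :: complex) < 1" by (simp_all add: norm_divide)
      have "s (1 / 2) x = (\<Sum>j=0..r div 2. K j * P (r - 2 * j) x)"
        using K x half unfolding transition_coeffs_def by blast
      also have "\<dots> = (\<Sum>j=0..r div 2. K j * basis_dual p n (n - r + 2 * j) x)"
        by (intro sum.cong refl) (simp add: P')
      finally show "(\<Sum>j=0..r div 2. (K j - \<kappa> j) * basis_dual p n (n - r + 2 * j) x) = 0"
        unfolding s[OF half] by (simp add: left_diff_distrib sum_subtractf)
    next
      fix j assume "j \<in> {0..r div 2}"
      thus "n - r + 2 * j \<le> n" using r by auto
    qed (use that in \<open>auto simp: inj_on_def\<close>)
    moreover have "K j = 0" if "j > r div 2" for j using K that by (auto simp: transition_coeffs_def)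
    ultimately show "K = (\<lambda>j. if j \<le> r div 2 then \<kappa> j else 0)" by (auto simp: fun_eq_iff)
  next
    assume K: "K = (\<lambda>j. if j \<le> r div 2 then \<kappa> j else 0)"
    show "transition_coeffs n r s P K"
      unfolding transition_coeffs_def
    proof (intro conjI allI impI)
      fix q :: complex and x :: "nat \<Rightarrow> complex" assume "0 < norm q \<and> norm q < 1 \<and> (\<forall>i\<in>{1..n}. x i \<noteq> 0)"
      hence "s q x = (\<Sum>j=0..r div 2. \<kappa> j * basis_dual p n (n - r + 2 * j) x)" using s by blast
      also have "\<dots> = (\<Sum>j=0..r div 2. K j * P (r - 2 * j) x)"
        by (intro sum.cong refl) (simp add: K P')
      finally show "s q x = (\<Sum>j=0..r div 2. K j * P (r - 2 * j) x)" .
    qed (simp add: K)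
  qed
qed

text \<open>Summation by parts from \<open>cheb_T m = cheb_U m - cheb_U (m - 2)\<close> for
  \<open>m > 1\<close>; the last summand has no lower neighbour because the two families agree in
  degrees 0 and 1.\<close>

lemma hl_C_poly_cheb_U:
  "hl_C_poly t m = (\<Sum>j\<le>m div 2. smult (hermite_coeff t m j - (if j = 0 then 0 else hermite_coeff t m (j - 1))) (cheb_U (m - 2 * j)))"
proof -
  let ?c = "hermite_coeff t m" and ?M = "m div 2"
  have T: "cheb_T (m - 2 * j) = cheb_U (m - 2 * j) - (if j < ?M then cheb_U (m - 2 * Suc j) else 0)" if "j \<le> ?M" for j
  proof (cases "j < ?M")
    case True
    hence "2 * Suc j \<le> m" by presburger
    then obtain d where "m = 2 * Suc j + d" using le_Suc_ex by blast
    hence "m - 2 * j = Suc (Suc (m - 2 * Suc j))" by simp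
    thus ?thesis using True by (simp only: cheb_T.simps if_True)
  next
    case False
    hence "m - 2 * j = 0 \<or> m - 2 * j = Suc 0" using that by presburger
    thus ?thesis using False by auto
  qed
  have "hl_C_poly t m = (\<Sum>j\<le>?M. smult (?c j) (cheb_U (m - 2 * j)) - smult (?c j) (if j < ?M then cheb_U (m - 2 * Suc j) else 0))"
    unfolding hl_C_poly_def palindromic_poly_def by (intro sum.cong refl) (simp only: T atMost_iff smult_diff_right)
  also have "\<dots> = (\<Sum>j\<le>?M. smult (?c j) (cheb_U (m - 2 * j))) - (\<Sum>j\<le>?M. smult (?c j) (if j < ?M then cheb_U (m - 2 * Suc j) else 0))"
    by (rule sum_subtractf)
  also have "(\<Sum>j\<le>?M. smult (?c j) (if j < ?M then cheb_U (m - 2 * Suc j) else 0)) = (\<Sum>j<?M. smult (?c j) (cheb_U (m - 2 * Suc j)))"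
    by (rule sum.mono_neutral_cong_right) auto
  also have "\<dots> = (\<Sum>j\<le>?M. smult (if j = 0 then 0 else ?c (j - 1)) (cheb_U (m - 2 * j)))"
  proof (cases ?M)
    case (Suc M)
    show ?thesis unfolding Suc by (subst sum.atMost_Suc_shift) (simp add: lessThan_Suc_atMost)
  qed simp
  finally show ?thesis by (simp only: sum_subtractf[symmetric] smult_diff_left)
qed

lemma kostka_C_iff:
  assumes t: "generic_t t" and n: "1 \<le> n" and r: "r \<le> n"
  shows "is_kostka_C n r t K \<longleftrightarrow> K = (\<lambda>j. if j \<le> r div 2 then hermite_coeff t (n - r + 2 * j) j
      - (if j = 0 then 0 else hermite_coeff t (n - r + 2 * j) (j - 1)) else 0)"
  unfolding is_kostka_C_def
proof (rule transition_coeffs_iff[OF monic_seq_hl_C r])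
  fix s assume "s \<le> n"
  thus "hall_littlewood_C n s t = basis_dual (hl_C_poly t) n (n - s)"
    using hall_littlewood_C_dual[OF t n, of "n - s"] by simp
next
  fix q :: complex and x
  assume q: "0 < norm q" "norm q < 1"
  have "schur_C n r q x = basis_dual cheb_U n (n - r) x"
    using schur_C_dual[OF q n, of "n - r"] r by simp
  thus "schur_C n r q x = (\<Sum>j=0..r div 2. (hermite_coeff t (n - r + 2 * j) j
      - (if j = 0 then 0 else hermite_coeff t (n - r + 2 * j) (j - 1))) * basis_dual (hl_C_poly t) n (n - r + 2 * j) x)"
    by (simp only: basis_dual_transition[OF monic_seq_cheb_U monic_seq_hl_C r hl_C_poly_cheb_U])
qed

text \<open>\<open>hl_D_poly\<close> is defined by its expansion in \<open>cheb_T\<close>, so its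
  coefficients are themselves the connection coefficients.\<close>

lemma kostka_D_iff:
  assumes t: "generic_t t" and n: "1 \<le> n" and r: "r \<le> n"
  shows "is_kostka_D n r t K \<longleftrightarrow> K = (\<lambda>j. if j \<le> r div 2 then hermite_coeff' t (n - r + 2 * j) j else 0)"
  unfolding is_kostka_D_def
proof (rule transition_coeffs_iff[OF monic_seq_hl_D[OF t] r])
  fix s assume "s \<le> n"
  thus "hall_littlewood_D n s t = basis_dual (hl_D_poly t) n (n - s)"
    using hall_littlewood_D_dual[OF t n, of "n - s"] by simp
next
  fix q :: complex and x
  assume q: "0 < norm q" "norm q < 1"
  have "schur_D n r q x = basis_dual cheb_T n (n - r) x"
    using schur_D_dual[OF q n, of "n - r"] r by simp
  thus "schur_D n r q x = (\<Sum>j=0..r div 2. hermite_coeff' t (n - r + 2 * j) j * basis_dual (hl_D_poly t) n (n - r + 2 * j) x)"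
    by (simp only: basis_dual_transition[OF monic_seq_cheb_T monic_seq_hl_D[OF t] r hl_D_poly_def[unfolded palindromic_poly_def]])
qed

section \<open>Closed formulas and positivity\<close>

lemma kostka_C_eq:
  assumes "generic_t t" "1 \<le> n" "r \<le> n" "j \<le> r div 2"
  shows "kostka_C n r j t = gauss (t ^ 2) j (n - r + j) - (if j = 0 then 0 else gauss (t ^ 2) (j - 1) (Suc (n - r + j)))"
proof -
  have "n - r + 2 * j - j = n - r + j" "j \<noteq> 0 \<Longrightarrow> n - r + 2 * j - (j - 1) = Suc (n - r + j)" by auto
  thus ?thesis using assms unfolding kostka_C_def kostka_C_iff[OF assms(1-3)] the_eq_trivial hermite_coeff_def by simp
qed

lemma kostka_D_eq:
  assumes "generic_t t" "1 \<le> n" "r \<le> n" "j \<le> r div 2"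
  shows "kostka_D n r j t = gauss (t ^ 2) j (n - r + j) * (t ^ j + t ^ (n - r + j)) / (1 + t ^ (n - r + 2 * j))"
proof -
  have "n - r + 2 * j - j = n - r + j" by auto
  thus ?thesis using assms unfolding kostka_D_def kostka_D_iff[OF assms(1-3)] the_eq_trivial hermite_coeff'_def by simp
qed

text \<open>With v = t^2, the left neighbour in the row is the coefficient times (1 - v^j) / (1 -
  v^(N+j+1)), and the numerators differ by v^j (1 - v^(N+1)).\<close>

lemma kostka_C_product:
  assumes t: "generic_t t"
  shows "gauss (t ^ 2) j (N + j) - (if j = 0 then 0 else gauss (t ^ 2) (j - 1) (Suc (N + j)))
    = t ^ (2 * j) * ((1 - (t ^ 2) ^ (N + 1)) / (1 - (t ^ 2) ^ (N + j + 1))) * gauss (t ^ 2) j (N + j)"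
proof -
  define v where "v = t ^ 2"
  have v: "\<And>k. k > 0 \<Longrightarrow> v ^ k \<noteq> 1" using generic_t_facts(3)[OF t] by (simp add: v_def)
  have nz: "1 - v ^ (N + j + 1) \<noteq> 0" using v[of "N + j + 1"] by simp
  have "(if j = 0 then 0 else gauss v (j - 1) (Suc (N + j))) * (1 - v ^ (N + j + 1)) = gauss v j (N + j) * (1 - v ^ j)"
  proof (cases j)
    case (Suc i)
    show ?thesis using gauss_step[OF v, where a = i and b = "N + j"] Suc by simp
  qed simp
  hence "(if j = 0 then 0 else gauss v (j - 1) (Suc (N + j))) = gauss v j (N + j) * (1 - v ^ j) / (1 - v ^ (N + j + 1))"
    by (rule eq_divide_imp[OF nz])
  hence "gauss v j (N + j) - (if j = 0 then 0 else gauss v (j - 1) (Suc (N + j)))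
      = gauss v j (N + j) * ((1 - v ^ (N + j + 1)) - (1 - v ^ j)) / (1 - v ^ (N + j + 1))"
    using nz by (simp add: field_simps)
  also have "(1 - v ^ (N + j + 1)) - (1 - v ^ j) = v ^ j * (1 - v ^ (N + 1))"
    by (simp add: power_add algebra_simps)
  also have "v ^ j = t ^ (2 * j)" by (simp add: v_def power_mult)
  finally show ?thesis unfolding v_def by (simp only: mult_ac times_divide_eq_left times_divide_eq_right)
qed

text \<open>With X = t^(i+1), W = t^(N+i+1) and m = N + 2 (i + 1), both coefficients of the row
  above are multiples of \<open>g\<close> over 1 - v^m = (1 + X W) (1 - X W). The formula reduces to
  W (1 - X^2) + X (1 - W^2) = (X + W) (1 - X W).\<close>

lemma kostka_D_sum:
  assumes t: "generic_t t"
  shows "gauss (t ^ 2) (Suc i) (N + Suc i) * (t ^ Suc i + t ^ (N + Suc i)) / (1 + t ^ (N + 2 * Suc i))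
    = t ^ (N + Suc i) * gauss (t ^ 2) i (N + Suc i) + t ^ Suc i * gauss (t ^ 2) (Suc i) (N + i)"
proof -
  define v where "v = t ^ 2"
  have v: "\<And>k. k > 0 \<Longrightarrow> v ^ k \<noteq> 1" using generic_t_facts(3)[OF t] by (simp add: v_def)
  define g where "g = gauss v (Suc i) (N + Suc i)"
  define m where "m = N + 2 * Suc i"
  define X where "X = t ^ Suc i"
  define W where "W = t ^ (N + Suc i)"
  have tm: "t ^ m = X * W" by (simp add: m_def X_def W_def mult_2 add_ac flip: power_add power_Suc)
  have pw: "v ^ Suc i = X ^ 2" "v ^ (N + Suc i) = W ^ 2"
    by (simp_all only: v_def X_def W_def power_mult[symmetric] mult.commute)
  have vm: "v ^ m = (X * W) ^ 2" unfolding v_def tm[symmetric] power_mult[symmetric] by (simp add: mult.commute)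
  have 1: "gauss v i (N + Suc i) * (1 - v ^ m) = g * (1 - X ^ 2)"
  proof -
    have "g * (1 - v ^ Suc i) = (1 - v ^ Suc (i + (N + Suc i))) * gauss v i (N + Suc i)"
      unfolding g_def by (rule gauss_mult_top[OF v])
    moreover have "Suc (i + (N + Suc i)) = m" by (simp add: m_def)
    ultimately show ?thesis by (simp only: pw mult.commute)
  qed
  have 2: "gauss v (Suc i) (N + i) * (1 - v ^ m) = g * (1 - W ^ 2)"
  proof -
    have "gauss v (Suc (N + i)) (Suc i) * (1 - v ^ Suc (N + i)) = (1 - v ^ Suc (N + i + Suc i)) * gauss v (N + i) (Suc i)"
      by (rule gauss_mult_top[OF v])
    moreover have "Suc (N + i) = N + Suc i" "Suc (N + i + Suc i) = m" by (simp_all add: m_def)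
    ultimately have "gauss v (N + Suc i) (Suc i) * (1 - W ^ 2) = (1 - v ^ m) * gauss v (N + i) (Suc i)"
      by (simp only: pw)
    thus ?thesis by (simp only: g_def gauss_sym[of v "N + Suc i" "Suc i"] gauss_sym[of v "N + i" "Suc i"] mult.commute)
  qed
  have "m > 0" by (simp add: m_def)
  hence nz: "1 - v ^ m \<noteq> 0" "1 + X * W \<noteq> 0"
    using v[of m] generic_t_facts(4)[OF t, of m] by (auto simp: tm)
  have "(W * gauss v i (N + Suc i) + X * gauss v (Suc i) (N + i)) * (1 - v ^ m) = W * (g * (1 - X ^ 2)) + X * (g * (1 - W ^ 2))"
    unfolding 1[symmetric] 2[symmetric] by (simp only: distrib_right mult.assoc)
  also have "\<dots> = g * (X + W) * (1 - X * W)" by (simp add: algebra_simps power2_eq_square)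
  also have "\<dots> = g * (X + W) / (1 + X * W) * (1 - v ^ m)"
  proof -
    have "1 - v ^ m = (1 + X * W) * (1 - X * W)" unfolding vm by (simp add: algebra_simps power2_eq_square)
    thus ?thesis using nz(2) by simp
  qed
  finally have "W * gauss v i (N + Suc i) + X * gauss v (Suc i) (N + i) = g * (X + W) / (1 + X * W)"
    using mult_right_cancel[OF nz(1)] by blast
  thus ?thesis by (simp only: v_def g_def X_def W_def tm[symmetric, unfolded X_def W_def] m_def)
qed

text \<open>For \<open>j > 0\<close> this is the case \<open>c = 0\<close> of
  \<open>nonneg_poly_gauss_diff\<close> in base t^2.\<close>

lemma kostka_C_nonneg:
  assumes "1 \<le> n" "r \<le> n" "j \<le> r div 2"
  shows "nonneg_int_polynomial (kostka_C n r j)"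
proof -
  let ?v = "monom 1 2 :: int poly"
  define p where "p = gauss ?v j (n - r + j) - (if j = 0 then 0 else gauss ?v (j - 1) (Suc (n - r + j)))"
  have v: "nonneg_poly ?v" by auto
  have "nonneg_poly p"
  proof (cases j)
    case 0 thus ?thesis by (auto simp: p_def)
  next
    case (Suc i)
    show ?thesis using nonneg_poly_gauss_diff[OF v, of i "n - r + j" 0] Suc by (simp add: p_def del: gauss.simps)
  qed
  moreover have "kostka_C n r j t = poly (map_poly of_int p) t" if "generic_t t" for t
    unfolding kostka_C_eq[OF that assms] p_def
    by (simp add: poly_of_int_hom poly_of_int_gauss)
  ultimately show ?thesis unfolding nonneg_int_polynomial_def nonneg_poly_def by blast
qed

text \<open>The product form has a denominator, so for \<open>j > 0\<close> the polynomial is read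
  off from the additive form, whose terms are visibly nonnegative.\<close>

lemma kostka_D_nonneg:
  assumes "1 \<le> n" "r \<le> n" "j \<le> r div 2"
  shows "nonneg_int_polynomial (kostka_D n r j)"
proof -
  let ?v = "monom 1 2 :: int poly"
  have v: "nonneg_poly ?v" by auto
  show ?thesis
  proof (cases j)
    case 0
    have "kostka_D n r j t = poly (map_poly of_int 1) t" if "generic_t t" for t
      unfolding kostka_D_eq[OF that assms] using 0 generic_t_facts(4)[OF that, of "n - r"] by simp
    moreover have "nonneg_poly 1" by auto
    ultimately show ?thesis unfolding nonneg_int_polynomial_def nonneg_poly_def by blast
  next
    case (Suc i)
    define p where "p = monom 1 (n - r + j) * gauss ?v i (n - r + j) + monom 1 j * gauss ?v j (n - r + i)"
    have "nonneg_poly p" unfolding p_def by (intro nonneg_poly_simps nonneg_poly_gauss v)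
    moreover have "kostka_D n r j t = poly (map_poly of_int p) t" if "generic_t t" for t
      unfolding kostka_D_eq[OF that assms] p_def
      using kostka_D_sum[OF that, of i "n - r"] Suc
      by (simp add: poly_of_int_hom poly_of_int_gauss del: gauss.simps)
    ultimately show ?thesis unfolding nonneg_int_polynomial_def nonneg_poly_def by blast
  qed
qed

theorem theorem1p6:
  fixes n r :: nat
  assumes "1 \<le> n" and "r \<le> n"
  shows "(\<forall>t. generic_t t \<longrightarrow> (\<exists>!K. is_kostka_C n r t K) \<and> (\<exists>!K. is_kostka_D n r t K)) \<and>
    (\<forall>j \<le> r div 2.
       nonneg_int_polynomial (kostka_C n r j) \<and>
       nonneg_int_polynomial (kostka_D n r j) \<and>
       (\<forall>t. generic_t t \<longrightarrow>
          kostka_C n r j t =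
            t ^ (2 * j) * (qnum (t\<^sup>2) (int n - int r + 1) / qnum (t\<^sup>2) (int n - int r + int j + 1))
              * qbinom (t\<^sup>2) (int n - int r + 2 * int j) (int j) \<and>
          kostka_C n r j t =
            qbinom (t\<^sup>2) (int n - int r + 2 * int j) (int j)
              - qbinom (t\<^sup>2) (int n - int r + 2 * int j) (int j - 1) \<and>
          kostka_D n r j t =
            t ^ j * ((1 + t ^ (n - r)) / (1 + t ^ (n - r + 2 * j)))
              * qbinom (t\<^sup>2) (int n - int r + 2 * int j) (int j) \<and>
          kostka_D n r j t =
            t ^ (n - r + j) * qbinom (t\<^sup>2) (int n - int r + 2 * int j - 1) (int j - 1)
              + t ^ j * qbinom (t\<^sup>2) (int n - int r + 2 * int j - 1) (int j)))"
proof (intro conjI allI impI)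
  fix t assume t: "generic_t t"
  show "\<exists>!K. is_kostka_C n r t K" "\<exists>!K. is_kostka_D n r t K"
    unfolding kostka_C_iff[OF t assms] kostka_D_iff[OF t assms] by simp_all
next
  fix j assume j: "j \<le> r div 2"
  show "nonneg_int_polynomial (kostka_C n r j)" "nonneg_int_polynomial (kostka_D n r j)"
    using kostka_C_nonneg[OF assms j] kostka_D_nonneg[OF assms j] by simp_all
  fix t assume t: "generic_t t"
  define N where "N = n - r"
  have N: "int n - int r = int N" using assms(2) by (simp add: N_def of_nat_diff)
  have v: "\<And>k. k > 0 \<Longrightarrow> (t\<^sup>2) ^ k \<noteq> 1" by (rule generic_t_facts(3)[OF t])
  note C = kostka_C_eq[OF t assms j, folded N_def] and D = kostka_D_eq[OF t assms j, folded N_def]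
  have top: "qbinom (t\<^sup>2) (int n - int r + 2 * int j) (int j) = gauss (t\<^sup>2) j (N + j)"
  proof -
    have "int n - int r + 2 * int j = int (j + (N + j))" unfolding N by simp
    thus ?thesis by (simp only: qbinom_gauss[OF v])
  qed
  show "kostka_C n r j t =
      t ^ (2 * j) * (qnum (t\<^sup>2) (int n - int r + 1) / qnum (t\<^sup>2) (int n - int r + int j + 1))
      * qbinom (t\<^sup>2) (int n - int r + 2 * int j) (int j)"
  proof -
    have "int n - int r + 1 = int (N + 1)" "int n - int r + int j + 1 = int (N + j + 1)" unfolding N by simp_all
    hence "qnum (t\<^sup>2) (int n - int r + 1) / qnum (t\<^sup>2) (int n - int r + int j + 1)
       = (1 - (t\<^sup>2) ^ (N + 1)) / (1 - t\<^sup>2) / ((1 - (t\<^sup>2) ^ (N + j + 1)) / (1 - t\<^sup>2))"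
      by (simp only: qnum_nat[OF v])
    also have "\<dots> = (1 - (t\<^sup>2) ^ (N + 1)) / (1 - (t\<^sup>2) ^ (N + j + 1))"
      using v[of 1] by simp
    finally show ?thesis unfolding C top kostka_C_product[OF t] by simp
  qed
  show "kostka_C n r j t = qbinom (t\<^sup>2) (int n - int r + 2 * int j) (int j)
              - qbinom (t\<^sup>2) (int n - int r + 2 * int j) (int j - 1)"
  proof (cases j)
    \<comment> \<open>The lower index \<open>j - 1\<close> is -1, where \<open>qbinom\<close> is 0
      by definition.\<close>
    case 0
    thus ?thesis unfolding C top by (simp add: qbinom_def)
  next
    case (Suc i)
    have e: "int n - int r + 2 * int j = int (i + Suc (N + j))" "int j - 1 = int i"
      unfolding N Suc by simp_all
    have "qbinom (t\<^sup>2) (int n - int r + 2 * int j) (int j - 1) = gauss (t\<^sup>2) i (Suc (N + j))"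
      unfolding e by (rule qbinom_gauss[OF v])
    thus ?thesis unfolding C top using Suc by simp
  qed
  show "kostka_D n r j t = t ^ j * ((1 + t ^ (n - r)) / (1 + t ^ (n - r + 2 * j)))
              * qbinom (t\<^sup>2) (int n - int r + 2 * int j) (int j)"
    unfolding D top N_def[symmetric] by (simp add: power_add algebra_simps)
  show "kostka_D n r j t = t ^ (n - r + j) * qbinom (t\<^sup>2) (int n - int r + 2 * int j - 1) (int j - 1)
              + t ^ j * qbinom (t\<^sup>2) (int n - int r + 2 * int j - 1) (int j)"
  proof (cases j)
    \<comment> \<open>For \<open>n = r\<close> the upper index is -1, out of range for
      \<open>qbinom_gauss\<close>; the values 0 and 1 come from the definition of
      \<open>qbinom\<close>.\<close>
    case 0
    thus ?thesis unfolding D using generic_t_facts(4)[OF t, of N] by (simp add: qbinom_def)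
  next
    case (Suc i)
    have e: "int n - int r + 2 * int j - 1 = int (i + (N + Suc i))" "int j - 1 = int i"
      and e': "int n - int r + 2 * int j - 1 = int (Suc i + (N + i))" "int j = int (Suc i)"
      unfolding N Suc by simp_all
    have "qbinom (t\<^sup>2) (int n - int r + 2 * int j - 1) (int j - 1) = gauss (t\<^sup>2) i (N + Suc i)"
      unfolding e by (rule qbinom_gauss[OF v])
    moreover have "qbinom (t\<^sup>2) (int n - int r + 2 * int j - 1) (int j) = gauss (t\<^sup>2) (Suc i) (N + i)"
      unfolding e'(1) unfolding e'(2) by (rule qbinom_gauss[OF v])
    ultimately show ?thesis unfolding D N_def[symmetric] using kostka_D_sum[OF t, of i N] Suc by simp
  qed
qed

end
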